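(* Let $U:\mathbb{R}^d\to\mathbb{R}$ be three times continuously differentiable, and let $L\ge 0$, $m>0$, $\tilde L\ge0$ be such that for all $x,y\in\mathbb{R}^d$, $\|\nabla U(x)-\nabla U(y)\|\le L\|x-y\|$, $U(y)\ge U(x)+\langle\nabla U(x),y-x\rangle+(m/2)\|x-y\|^2$, and $\|\nabla^2U(x)-\nabla^2U(y)\|\le\tilde L\|x-y\|$. Let $\gamma\in(0,1/(m+L)]$. Then $$W_2^2(\pi,\pi_\gamma)\le 2\kappa^{-1}d\gamma^2\left\{2L^2+\gamma L^4(\gamma/6+m^{-1})+\kappa^{-1}\left(\frac{4d\tilde L^2}{3}+\gamma L^4+\frac{4L^4}{3m}\right)\right\}.$$
   Context: Here $d\ge1$, $\|\cdot\|$ is the Euclidean norm on vectors and the associated operator norm on matrices, $\kappa=2mL/(m+L)$, and $\pi$ is the probability measure on $\mathbb{R}^d$ with density proportional to $e^{-U}$. For $\gamma>0$, $R_\gamma$ is the Markov kernel on $\mathbb{R}^d$ such that $R_\gamma(x,\cdot)$ is the Gaussian distribution with mean $x-\gamma\nabla U(x)$ and covariance matrix $2\gamma I_d$; for $\gamma\le 2/(m+L)$, $R_\gamma$ has a unique stationary distribution, denoted $\pi_\gamma$. $W_2$ is the Wasserstein distance of order $2$ associated with the Euclidean distance. *)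

theory Defs
  imports "HOL-Probability.Probability"
begin

section \<open>Derivatives\<close>

text \<open>
  The directional derivatives of order \<open>k\<close> are used in place of the \<open>k\<close>-linear derivative, whose
  type would depend on \<open>k\<close>; in finite dimension their continuity for all directions is the same
  as continuity of the \<open>k\<close>-th derivative.
\<close>

primrec times_cont_differentiable ::
    "nat \<Rightarrow> ('a::euclidean_space \<Rightarrow> 'b::real_normed_vector) \<Rightarrow> bool" where
  "times_cont_differentiable 0 f \<longleftrightarrow> continuous_on UNIV f"
| "times_cont_differentiable (Suc k) f \<longleftrightarrow>
     (\<forall>x. f differentiable (at x)) \<and>
     (\<forall>v. times_cont_differentiable k (\<lambda>x. frechet_derivative f (at x) v))"

definition grad :: "('a::euclidean_space \<Rightarrow> real) \<Rightarrow> 'a \<Rightarrow> 'a" where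
  "grad U x = (THE g. GDERIV U x :> g)"

text \<open>The Hessian as a linear endomorphism, so that its operator norm is \<^const>\<open>onorm\<close>.\<close>

definition hess :: "('a::euclidean_space \<Rightarrow> real) \<Rightarrow> 'a \<Rightarrow> 'a \<Rightarrow> 'a" where
  "hess U x = frechet_derivative (grad U) (at x)"

section \<open>Target measure, Euler kernel and stationarity\<close>

definition gibbs :: "('a::euclidean_space \<Rightarrow> real) \<Rightarrow> 'a measure" where
  "gibbs U = density lborel
     (\<lambda>x. ennreal (exp (- U x)) / (\<integral>\<^sup>+ y. ennreal (exp (- U y)) \<partial>lborel))"

text \<open>The Gaussian distribution with mean \<open>\<mu>\<close> and covariance matrix \<open>v I\<close>, for \<open>v > 0\<close>.\<close>

definition isotropic_gaussian :: "'a::euclidean_space \<Rightarrow> real \<Rightarrow> 'a measure" where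
  "isotropic_gaussian \<mu> v = density lborel
     (\<lambda>y. ennreal (1 / sqrt (2 * pi * v) ^ DIM('a) * exp (- (norm (y - \<mu>))\<^sup>2 / (2 * v))))"

definition ula_kernel :: "('a::euclidean_space \<Rightarrow> real) \<Rightarrow> real \<Rightarrow> 'a \<Rightarrow> 'a measure" where
  "ula_kernel U \<gamma> x = isotropic_gaussian (x - \<gamma> *\<^sub>R grad U x) (2 * \<gamma>)"

definition stationary_distribution ::
    "('a::euclidean_space \<Rightarrow> 'a measure) \<Rightarrow> 'a measure \<Rightarrow> bool" where
  "stationary_distribution K \<mu> \<longleftrightarrow>
     prob_space \<mu> \<and> sets \<mu> = sets borel \<and>
     (\<forall>A\<in>sets borel. (\<integral>\<^sup>+ x. emeasure (K x) A \<partial>\<mu>) = emeasure \<mu> A)"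

section \<open>Wasserstein distance of order 2\<close>

definition couplings ::
    "'a::euclidean_space measure \<Rightarrow> 'a measure \<Rightarrow> ('a \<times> 'a) measure set" where
  "couplings \<mu> \<nu> = {\<zeta>. prob_space \<zeta> \<and> sets \<zeta> = sets borel \<and>
     distr \<zeta> borel fst = \<mu> \<and> distr \<zeta> borel snd = \<nu>}"

definition ennreal_sqrt :: "ennreal \<Rightarrow> ennreal" where
  "ennreal_sqrt a = (if a = \<top> then \<top> else ennreal (sqrt (enn2real a)))"

text \<open>
  Extended-valued, since the measures are not required to have finite second moments.
\<close>

definition wasserstein2 :: "'a::euclidean_space measure \<Rightarrow> 'a measure \<Rightarrow> ennreal" where
  "wasserstein2 \<mu> \<nu> =
     ennreal_sqrt (\<Sqinter>\<zeta>\<in>couplings \<mu> \<nu>. \<integral>\<^sup>+ z. ennreal ((dist (fst z) (snd z))\<^sup>2) \<partial>\<zeta>)"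

lemma ennreal_sqrt_square [simp]: "(ennreal_sqrt a)\<^sup>2 = a"
  by (cases a) (auto simp: ennreal_sqrt_def ennreal_power power2_eq_square ennreal_top_mult
      simp flip: ennreal_mult)

section \<open>Constants\<close>

definition kappa :: "real \<Rightarrow> real \<Rightarrow> real" where
  "kappa m L = 2 * m * L / (m + L)"

end

(* The Langevin diffusion is replaced by the Metropolis-adjusted Euler scheme with a small step
   h = gamma / N: it leaves pi = gibbs U exactly invariant, and since the Hessian is Lipschitz its
   rejection probability is O(h^(3/2)), so that it differs from the Euler scheme by O(h^(5/4)) in
   L2 per step.  Run N steps of it from Y_0 ~ pi and one Euler step of size gamma from
   X_0 ~ pi_gamma, driven by the same Gaussian increments.  Then Y_N ~ pi, X_1 ~ pi_gamma and
     Y_N - X_1 = (Y_0 - X_0) - gamma (grad U(Y_0) - grad U(X_0)) + D,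
   where the first part contracts by 1 - kappa gamma in squared norm (co-coercivity) and D is the
   accumulated error of freezing the gradient at Y_0.  Up to terms vanishing with h, D has L2 norm
   of order gamma^(3/2), and its inner product with functions of (Y_0, X_0) is of order gamma^2,
   because the symmetry w -> -w of the Gaussian turns a gradient increment into a second difference.
   Letting h -> 0 and minimising over the coupling of Y_0 and X_0 yields
   W^2 <= (1 - kappa gamma / 2) W^2 + O(gamma^3). *)

theory Submission
  imports Defs
begin

section \<open>Strongly convex potentials with Lipschitz gradient and Hessian\<close>

text \<open>What shapes the proof is the cross term. From the L2 norm of D alone, Young's inequality
  would leave an error of order \<gamma>^2 per Euler step; as the contraction gains only a factor 1
  - \<open>kappa\<close> \<gamma>, W^2 would come out of order \<gamma>. Hence the separate estimate
  of inner products of D with functions of the initial pair, the only source of the Hessian constant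
  in the final bound. The reflection of the Gaussian cannot be applied to the Metropolis step
  itself, whose acceptance is not even in w, so acceptance is first split off as an error. Of that
  error only a bound \<eta> h in L2 per step is used: the triangle inequality over \<gamma> / h
  steps leaves \<eta> \<gamma>, whatever the dependence between the steps, and \<eta> tends to 0 at
  the end. Exact invariance also makes the moment bounds uniform in time: the current point always
  has law \<open>gibbs U\<close>, for which E |grad U|^2 <= d L.\<close>

locale strongly_convex_potential =
  fixes U :: "'a::euclidean_space \<Rightarrow> real" and g :: "'a \<Rightarrow> 'a" and H :: "'a \<Rightarrow> 'a \<Rightarrow> 'a"
    and L m Lt :: real
  assumes deriv_U: "\<And>x. (U has_derivative (\<lambda>v. g x \<bullet> v)) (at x)"
    and deriv_g: "\<And>x. (g has_derivative H x) (at x)"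
    and m_pos: "m > 0" and Lt_nonneg: "Lt \<ge> 0"
    and Lipschitz: "\<And>x y. norm (g x - g y) \<le> L * norm (x - y)"
    and convex: "\<And>x y. U x + g x \<bullet> (y - x) + m / 2 * (norm (x - y))\<^sup>2 \<le> U y"
    and hess_Lipschitz: "\<And>x y v. norm (H x v - H y v) \<le> Lt * norm (x - y) * norm v"
begin

section \<open>Co-coercivity and contraction of the gradient step\<close>

text \<open>Adding the convexity inequalities for (b, 0) and (0, b), with b a unit basis vector,
  gives strong monotonicity, which Cauchy-Schwarz compares with the Lipschitz bound.\<close>

lemma m_le_L: "m \<le> L"
proof -
  obtain b :: 'a where b: "b \<in> Basis" using nonempty_Basis by blast
  have "m * (norm b)\<^sup>2 \<le> (g b - g 0) \<bullet> b"
    using convex[of b 0] convex[of 0 b] by (simp add: inner_diff_left)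
  also have "\<dots> \<le> norm (g b - g 0) * norm b" by (rule norm_cauchy_schwarz)
  also have "\<dots> \<le> L" using Lipschitz[of b 0] b by simp
  finally show ?thesis using b by simp
qed

lemma L_pos: "L > 0" using m_le_L m_pos by simp

lemma line_deriv_U:
  "((\<lambda>t. U (x + t *\<^sub>R v)) has_real_derivative g (x + t *\<^sub>R v) \<bullet> v) (at t)"
proof -
  have "((\<lambda>t. U (x + t *\<^sub>R v)) has_derivative (\<lambda>s. g (x + t *\<^sub>R v) \<bullet> (s *\<^sub>R v))) (at t)"
    by (rule has_derivative_compose[OF _ deriv_U, of "\<lambda>t. x + t *\<^sub>R v", simplified])
       (auto intro!: derivative_eq_intros)
  then show ?thesis by (simp add: has_field_derivative_def mult_commute_abs)
qed

lemma line_deriv_g: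
  "((\<lambda>t. g (x + t *\<^sub>R v)) has_derivative (\<lambda>s. s *\<^sub>R H (x + t *\<^sub>R v) v)) (at t)"
proof -
  have "((\<lambda>t. g (x + t *\<^sub>R v)) has_derivative (\<lambda>s. H (x + t *\<^sub>R v) (s *\<^sub>R v))) (at t)"
    by (rule has_derivative_compose[OF _ deriv_g, of "\<lambda>t. x + t *\<^sub>R v", simplified])
       (auto intro!: derivative_eq_intros)
  moreover have "H y (s *\<^sub>R v) = s *\<^sub>R H y v" for y s
    by (rule linear_scale[OF has_derivative_linear[OF deriv_g]])
  ultimately show ?thesis by simp
qed

text \<open>The descent lemma: on the segment, U minus its quadratic majorant has nonpositive
  derivative by the Lipschitz bound on g.\<close>

lemma U_upper: "U y \<le> U x + g x \<bullet> (y - x) + L / 2 * (norm (y - x))\<^sup>2"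
proof -
  define v where "v = y - x"
  define f where "f t = U (x + t *\<^sub>R v) - t * (g x \<bullet> v) - L / 2 * t\<^sup>2 * (norm v)\<^sup>2" for t
  have "f 1 \<le> f 0"
  proof (rule DERIV_nonpos_imp_nonincreasing[of 0 1 f])
    fix t :: real assume t: "0 \<le> t" "t \<le> 1"
    have "(f has_real_derivative g (x + t *\<^sub>R v) \<bullet> v - g x \<bullet> v - L * t * (norm v)\<^sup>2) (at t)"
      unfolding f_def by (rule derivative_eq_intros line_deriv_U refl | simp)+
    moreover have "g (x + t *\<^sub>R v) \<bullet> v - g x \<bullet> v \<le> L * t * (norm v)\<^sup>2"
    proof -
      have "(g (x + t *\<^sub>R v) - g x) \<bullet> v \<le> norm (g (x + t *\<^sub>R v) - g x) * norm v"
        by (rule norm_cauchy_schwarz)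
      also have "\<dots> \<le> L * norm (t *\<^sub>R v) * norm v"
        using Lipschitz[of "x + t *\<^sub>R v" x] by (intro mult_right_mono) auto
      finally show ?thesis using t by (simp add: inner_diff_left power2_eq_square)
    qed
    ultimately show "\<exists>d. (f has_real_derivative d) (at t) \<and> d \<le> 0" by force
  qed simp
  then show ?thesis by (simp add: f_def v_def)
qed

text \<open>\<open>p\<close> is the gradient of the convex function U - (m/2) |x|^2, which has
  smoothness constant L - m. Keeping \<open>s\<close> free instead of taking the optimal 1 / (L - m)
  avoids the degenerate case L = m; the Euler step uses s = \<gamma>.\<close>

lemma cocoercive:
  assumes "0 \<le> s" "s \<le> 1 / (m + L)"
  defines "p \<equiv> \<lambda>x. g x - m *\<^sub>R x"
  shows "s * (norm (p x - p y))\<^sup>2 \<le> (p x - p y) \<bullet> (x - y)"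
proof -
  define d where "d = p x - p y"
  have half: "U b - U a - g a \<bullet> (b - a) - m / 2 * (norm (b - a))\<^sup>2
      \<ge> (s - (L - m) / 2 * s\<^sup>2) * (norm (p b - p a))\<^sup>2" for a b
  proof -
    define c where "c = p b - p a"
    \<comment> \<open>A gradient step from b for the convex part, tilted so that its gradient
      vanishes at a. Bounding U at \<open>?z\<close> from below through a and from above through b
      leaves a multiple of |c|^2.\<close>
    let ?z = "b - s *\<^sub>R c"
    have 1: "U a + g a \<bullet> (?z - a) + m / 2 * (norm (a - ?z))\<^sup>2 \<le> U ?z" by (rule convex)
    have 2: "U ?z \<le> U b + g b \<bullet> (?z - b) + L / 2 * (norm (?z - b))\<^sup>2" by (rule U_upper)
    have 3: "(norm (a - ?z))\<^sup>2 = (norm (b - a))\<^sup>2 - 2 * s * (c \<bullet> (b - a)) + s\<^sup>2 * (norm c)\<^sup>2"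
      unfolding power2_norm_eq_inner
      by (simp add: inner_diff_left inner_diff_right inner_commute algebra_simps power2_eq_square)
    have 4: "(norm (?z - b))\<^sup>2 = s\<^sup>2 * (norm c)\<^sup>2" by (simp add: power_mult_distrib)
    have 5: "g b \<bullet> c - g a \<bullet> c = (norm c)\<^sup>2 + m * (c \<bullet> (b - a))"
    proof -
      have "g b - g a = c + m *\<^sub>R (b - a)" by (simp add: c_def p_def algebra_simps)
      then have "(g b - g a) \<bullet> c = (c + m *\<^sub>R (b - a)) \<bullet> c" by simp
      then show ?thesis
        by (simp add: inner_diff_left inner_add_left power2_norm_eq_inner inner_commute algebra_simps)
    qed
    have 6: "g a \<bullet> (?z - a) = g a \<bullet> (b - a) - s * (g a \<bullet> c)" "g b \<bullet> (?z - b) = - s * (g b \<bullet> c)"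
      by (simp_all add: algebra_simps)
    have 7: "s * (g b \<bullet> c) = s * (g a \<bullet> c) + s * (norm c)\<^sup>2 + s * m * (c \<bullet> (b - a))"
      using arg_cong[OF 5, of "\<lambda>t. s * t"] by (simp add: algebra_simps)
    show ?thesis using 1 2 unfolding 3 4 6 c_def[symmetric] using 7
      by (simp add: algebra_simps add_divide_distrib diff_divide_distrib)
  qed
  \<comment> \<open>The inequalities for (x, y) and (y, x) are added, which cancels the values of
    U.\<close>
  have "(2 * s - (L - m) * s\<^sup>2) * (norm d)\<^sup>2 \<le> (g x - g y) \<bullet> (x - y) - m * (norm (x - y))\<^sup>2"
    using half[of x y] half[of y x] unfolding d_def
    by (simp add: norm_minus_commute inner_diff_left inner_diff_right algebra_simps diff_divide_distrib)
  also have "\<dots> = d \<bullet> (x - y)"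
    by (simp add: d_def p_def power2_norm_eq_inner inner_diff_left inner_diff_right algebra_simps)
  finally have *: "(2 * s - (L - m) * s\<^sup>2) * (norm d)\<^sup>2 \<le> d \<bullet> (x - y)" .
  have "(L - m) * s \<le> (L + m) * s" using assms m_pos by (intro mult_right_mono) auto
  also have "\<dots> \<le> 1" using assms m_pos L_pos by (simp add: field_simps)
  finally have "(L - m) * s * s \<le> 1 * s" using assms by (intro mult_right_mono) auto
  then have "s * (norm d)\<^sup>2 \<le> (2 * s - (L - m) * s\<^sup>2) * (norm d)\<^sup>2"
    by (intro mult_right_mono) (auto simp: power2_eq_square algebra_simps)
  with * show ?thesis unfolding d_def by linarith
qed

lemma kappa_pos: "kappa m L > 0"
  unfolding kappa_def using m_pos L_pos by simp

lemma kappa_step_le: 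
  assumes "0 < \<gamma>" "\<gamma> \<le> 1 / (m + L)" shows "kappa m L * \<gamma> \<le> 1/2"
proof -
  have "kappa m L * \<gamma> \<le> kappa m L * (1 / (m + L))"
    using kappa_pos assms by (intro mult_left_mono) auto
  also have "\<dots> \<le> 1/2"
  proof -
    have "0 \<le> (m - L)\<^sup>2" by simp
    then have "4 * (m * L) \<le> (m + L) * (m + L)" by (simp add: power2_eq_square algebra_simps)
    then show ?thesis using m_pos L_pos by (simp add: kappa_def divide_simps)
  qed
  finally show ?thesis .
qed

text \<open>With g split into m times the identity and a co-coercive part, the new difference is (1
  - \<gamma> m) e - \<gamma> d. Since \<gamma> m <= 1/2, the cross term absorbs \<gamma>^2 |d|^2;
  and (1 - \<gamma> m)^2 <= 1 - \<open>kappa\<close> \<gamma> because 2 m - \<open>kappa\<close> = 2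
  m^2 / (m + L) dominates \<gamma> m^2.\<close>

lemma gradient_step_contraction:
  assumes "0 < \<gamma>" "\<gamma> \<le> 1 / (m + L)"
  shows "(norm (x - y - \<gamma> *\<^sub>R (g x - g y)))\<^sup>2 \<le> (1 - kappa m L * \<gamma>) * (norm (x - y))\<^sup>2"
proof -
  define e where "e = x - y"
  define d where "d = (g x - m *\<^sub>R x) - (g y - m *\<^sub>R y)"
  have "x - y - \<gamma> *\<^sub>R (g x - g y) = (1 - \<gamma> * m) *\<^sub>R e - \<gamma> *\<^sub>R d"
    by (simp add: e_def d_def algebra_simps)
  moreover have "(norm ((1 - \<gamma> * m) *\<^sub>R e - \<gamma> *\<^sub>R d))\<^sup>2
      = (1 - \<gamma> * m)\<^sup>2 * (norm e)\<^sup>2 - (1 - \<gamma> * m) * \<gamma> * (d \<bullet> e + d \<bullet> e) + \<gamma>\<^sup>2 * (norm d)\<^sup>2"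
    unfolding power2_norm_eq_inner
    by (simp add: inner_diff_left inner_diff_right inner_commute algebra_simps power2_eq_square)
  ultimately have "(norm (x - y - \<gamma> *\<^sub>R (g x - g y)))\<^sup>2
      = (1 - \<gamma> * m)\<^sup>2 * (norm e)\<^sup>2 - (1 - \<gamma> * m) * \<gamma> * (d \<bullet> e + d \<bullet> e) + \<gamma>\<^sup>2 * (norm d)\<^sup>2"
    by simp
  moreover have "\<gamma> * (norm d)\<^sup>2 \<le> d \<bullet> e"
    using cocoercive[of \<gamma> x y] assms unfolding d_def e_def by simp
  then have "\<gamma> * (\<gamma> * (norm d)\<^sup>2) \<le> \<gamma> * (d \<bullet> e)" using assms by (intro mult_left_mono) auto
  moreover have gm: "\<gamma> * m \<le> 1 / 2"
  proof -
    have "\<gamma> * m \<le> 1 / (m + L) * m" using assms m_pos by (intro mult_right_mono) auto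
    also have "\<dots> \<le> 1/2" using m_pos m_le_L by (simp add: field_simps)
    finally show ?thesis .
  qed
  have de: "0 \<le> \<gamma> * (d \<bullet> e)"
    using \<open>\<gamma> * (\<gamma> * (norm d)\<^sup>2) \<le> \<gamma> * (d \<bullet> e)\<close> assms
    by (meson less_imp_le mult_nonneg_nonneg order_trans zero_le_power2)
  have "(1 / 2) * (2 * (\<gamma> * (d \<bullet> e))) \<le> (1 - \<gamma> * m) * (2 * (\<gamma> * (d \<bullet> e)))"
    using gm de by (intro mult_right_mono) auto
  moreover have "(1 - \<gamma> * m)\<^sup>2 * (norm e)\<^sup>2 \<le> (1 - kappa m L * \<gamma>) * (norm e)\<^sup>2"
  proof (rule mult_right_mono)
    have "\<gamma> * m * m \<le> 1 / (m + L) * m * m" using assms m_pos by (intro mult_right_mono) auto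
    also have "\<dots> \<le> 2 * m - kappa m L" using m_pos L_pos by (simp add: kappa_def field_simps)
    finally have "\<gamma> * (\<gamma> * m * m) \<le> \<gamma> * (2 * m - kappa m L)" using assms by (intro mult_left_mono) auto
    then show "(1 - \<gamma> * m)\<^sup>2 \<le> 1 - kappa m L * \<gamma>" by (simp add: power2_eq_square algebra_simps)
  qed simp
  ultimately show ?thesis unfolding e_def[symmetric] by (simp add: power2_eq_square algebra_simps)
qed

section \<open>Taylor estimates from the Lipschitz Hessian\<close>

lemma taylor_g: "norm (g (y + v) - g y - H y v) \<le> Lt * (norm v)\<^sup>2"
proof -
  define f where "f t = g (y + t *\<^sub>R v) - t *\<^sub>R H y v" for t :: real
  have d: "(f has_derivative (\<lambda>s. s *\<^sub>R H (y + t *\<^sub>R v) v - s *\<^sub>R H y v)) (at t)" for t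
    unfolding f_def by (intro derivative_intros line_deriv_g)
  have "continuous_on {0..1} f"
    using d by (meson continuous_at_imp_continuous_on has_derivative_continuous)
  then obtain t where t: "0 < t" "t < 1" 
     "norm (f 1 - f 0) \<le> norm ((1 - 0) *\<^sub>R H (y + t *\<^sub>R v) v - (1 - 0) *\<^sub>R H y v)"
    using mvt_general[OF zero_less_one _ d] by auto
  note t(3)
  also have "norm ((1 - 0) *\<^sub>R H (y + t *\<^sub>R v) v - (1 - 0) *\<^sub>R H y v) \<le> Lt * norm (t *\<^sub>R v) * norm v"
    using hess_Lipschitz[of "y + t *\<^sub>R v" v y] by simp
  also have "\<dots> \<le> Lt * norm v * norm v"
    using t Lt_nonneg by (intro mult_right_mono mult_left_mono) (auto simp: mult_left_le_one_le)
  finally show ?thesis by (simp add: f_def power2_eq_square algebra_simps)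
qed

text \<open>The derivative of g(y + t v) + g(y - t v) in t is a difference of Hessians at points 2 t
  |v| apart, applied to v; integrating 2 t over [0, 1] keeps the constant 1, which reaches the final
  bound.\<close>

lemma second_difference: "norm (g (y + v) + g (y - v) - 2 *\<^sub>R g y) \<le> Lt * (norm v)\<^sup>2"
proof -
  define f where "f t = g (y + t *\<^sub>R v) + g (y + t *\<^sub>R (- v))" for t :: real
  have Hm: "H z (- v) = - H z v" for z
    by (rule linear_neg[OF has_derivative_linear[OF deriv_g]])
  have d: "(f has_derivative (\<lambda>s. s *\<^sub>R H (y + t *\<^sub>R v) v + s *\<^sub>R H (y + t *\<^sub>R (- v)) (- v))) (at t)" for t
    unfolding f_def by (intro derivative_intros line_deriv_g)
  have "norm (f 1 - f 0) \<le> Lt * (norm v)\<^sup>2 * 1\<^sup>2 - Lt * (norm v)\<^sup>2 * 0\<^sup>2"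
  proof (rule differentiable_bound_general[of 0 1 f "\<lambda>t. Lt * (norm v)\<^sup>2 * t\<^sup>2" _ "\<lambda>t. Lt * (norm v)\<^sup>2 * (2 * t)"])
    show "continuous_on {0..1} f"
      using d by (meson continuous_at_imp_continuous_on has_derivative_continuous)
    fix t :: real assume t: "0 < t" "t < 1"
    show "(f has_vector_derivative H (y + t *\<^sub>R v) v - H (y + t *\<^sub>R (- v)) v) (at t)"
      using d[of t] unfolding has_vector_derivative_def Hm by (simp add: algebra_simps)
    show "((\<lambda>t. Lt * (norm v)\<^sup>2 * t\<^sup>2) has_vector_derivative Lt * (norm v)\<^sup>2 * (2 * t)) (at t)"
      unfolding has_real_derivative_iff_has_vector_derivative[symmetric]
      by (auto intro!: derivative_eq_intros)
    have "norm ((y + t *\<^sub>R v) - (y + t *\<^sub>R (- v))) = 2 * t * norm v"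
      using t by (simp flip: scaleR_left.add scaleR_2)
    then show "norm (H (y + t *\<^sub>R v) v - H (y + t *\<^sub>R (- v)) v) \<le> Lt * (norm v)\<^sup>2 * (2 * t)"
      using hess_Lipschitz[of "y + t *\<^sub>R v" v "y + t *\<^sub>R (- v)"] by (simp add: power2_eq_square algebra_simps)
  qed (auto intro!: continuous_intros)
  then show ?thesis by (simp add: f_def scaleR_2 algebra_simps)
qed

text \<open>The error of the trapezoidal rule for U on the segment from y to z. Its derivative in t
  is -1/2 times the inner product of v with the Taylor remainder of g expanded from y + t v back to
  y. The cubic order is what makes rejections rare.\<close>

lemma trapezoid: "\<bar>U z - U y - (z - y) \<bullet> (g z + g y) / 2\<bar> \<le> Lt / 2 * norm (z - y) ^ 3"
proof -
  define v where "v = z - y"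
  define f where "f t = U (y + t *\<^sub>R v) - t / 2 * (v \<bullet> (g (y + t *\<^sub>R v) + g y))" for t
  define f' where "f' t = g (y + t *\<^sub>R v) \<bullet> v - t / 2 * (v \<bullet> H (y + t *\<^sub>R v) v)
       - 1 / 2 * (v \<bullet> (g (y + t *\<^sub>R v) + g y))" for t
  have d: "(f has_derivative (\<lambda>s. s * f' t)) (at t)" for t
    unfolding f_def f'_def
    by (rule derivative_eq_intros line_deriv_U[unfolded has_field_derivative_def] line_deriv_g refl | simp)+
       (auto simp: algebra_simps fun_eq_iff inner_add_right)
  have "continuous_on {0..1} f"
    using d by (meson continuous_at_imp_continuous_on has_derivative_continuous)
  then obtain t where t: "0 < t" "t < 1" "norm (f 1 - f 0) \<le> norm ((1 - 0) * f' t)"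
    using mvt_general[OF zero_less_one _ d] by auto
  have Hm: "H w (- (t *\<^sub>R v)) = - t *\<^sub>R H w v" for w
    using linear_neg[OF has_derivative_linear[OF deriv_g]] linear_scale[OF has_derivative_linear[OF deriv_g]]
    by simp
  define r where "r = g (y + t *\<^sub>R v + - (t *\<^sub>R v)) - g (y + t *\<^sub>R v) - H (y + t *\<^sub>R v) (- (t *\<^sub>R v))"
  have "f' t = - (v \<bullet> r) / 2"
    unfolding f'_def r_def Hm by (simp add: inner_commute field_simps inner_diff_right inner_add_right)
  then have "norm ((1 - 0) * f' t) = \<bar>v \<bullet> r\<bar> / 2" by simp
  also have "\<dots> \<le> norm v * norm r / 2"
    by (intro divide_right_mono Cauchy_Schwarz_ineq2) simp
  also have "norm r \<le> Lt * (norm (- (t *\<^sub>R v)))\<^sup>2" unfolding r_def by (rule taylor_g)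
  also have "(norm (- (t *\<^sub>R v)))\<^sup>2 \<le> (norm v)\<^sup>2"
    using t by (intro power_mono) (simp_all add: mult_left_le_one_le)
  finally have "norm ((1 - 0) * f' t) \<le> norm v * (Lt * (norm v)\<^sup>2) / 2"
    using Lt_nonneg by (simp add: mult_left_mono divide_right_mono)
  with t(3) have "norm (f 1 - f 0) \<le> norm v * (Lt * (norm v)\<^sup>2) / 2" by linarith
  moreover have "f 1 - f 0 = U z - U y - (z - y) \<bullet> (g z + g y) / 2" by (simp add: f_def v_def)
  ultimately show ?thesis by (simp add: v_def power3_eq_cube power2_eq_square mult_ac)
qed

end

section \<open>Bounds in mean square\<close>

text \<open>Square integrability and a bound on the L2 norm in one predicate, so that error terms
  add up by the triangle inequality; \<open>nn_integral\<close> makes sense without integrability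
  being known beforehand.\<close>

definition l2_bound :: "'s measure \<Rightarrow> ('s \<Rightarrow> 'a::euclidean_space) \<Rightarrow> real \<Rightarrow> bool" where
  "l2_bound M f a \<longleftrightarrow> f \<in> borel_measurable M \<and> 0 \<le> a \<and>
     (\<integral>\<^sup>+ x. ennreal ((norm (f x))\<^sup>2) \<partial>M) \<le> ennreal (a\<^sup>2)"

lemma l2_boundD:
  assumes "l2_bound M f a"
  shows "f \<in> borel_measurable M" "0 \<le> a" "(\<integral>\<^sup>+ x. ennreal ((norm (f x))\<^sup>2) \<partial>M) \<le> ennreal (a\<^sup>2)"
  using assms by (auto simp: l2_bound_def)

lemma l2_bound_AE_zero:
  assumes "l2_bound M f 0" shows "AE x in M. f x = 0"
proof -
  note [measurable] = l2_boundD(1)[OF assms]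
  have "(\<integral>\<^sup>+ x. ennreal ((norm (f x))\<^sup>2) \<partial>M) = 0" using l2_boundD(3)[OF assms] by simp
  then show ?thesis by (subst (asm) nn_integral_0_iff_AE) auto
qed

lemma l2_bound_mono: "l2_bound M f a \<Longrightarrow> a \<le> b \<Longrightarrow> l2_bound M f b"
  unfolding l2_bound_def by (auto intro: order_trans ennreal_leI power_mono)

lemma l2_bound_norm_le:
  assumes "l2_bound M f a" "g \<in> borel_measurable M" "\<And>x. x \<in> space M \<Longrightarrow> norm (g x) \<le> c * norm (f x)" "0 \<le> c"
  shows "l2_bound M g (c * a)"
proof -
  note [measurable] = l2_boundD(1)[OF assms(1)]
  have "(\<integral>\<^sup>+ x. ennreal ((norm (g x))\<^sup>2) \<partial>M) \<le> (\<integral>\<^sup>+ x. ennreal (c\<^sup>2) * ennreal ((norm (f x))\<^sup>2) \<partial>M)"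
    using assms(3,4)
    by (intro nn_integral_mono) (auto simp flip: ennreal_mult power_mult_distrib intro!: ennreal_leI power_mono)
  also have "\<dots> \<le> ennreal (c\<^sup>2) * ennreal (a\<^sup>2)"
    using l2_boundD(3)[OF assms(1)] by (subst nn_integral_cmult) (auto intro: mult_left_mono)
  finally show ?thesis
    using assms l2_boundD(2)[OF assms(1)] by (auto simp: l2_bound_def power_mult_distrib ennreal_mult)
qed

lemma l2_bound_scaleR:
  assumes "l2_bound M f a" shows "l2_bound M (\<lambda>x. c *\<^sub>R f x) (\<bar>c\<bar> * a)"
proof -
  note [measurable] = l2_boundD(1)[OF assms]
  show ?thesis by (rule l2_bound_norm_le[OF assms]) auto
qed

lemma l2_bound_minus: "l2_bound M f a \<Longrightarrow> l2_bound M (\<lambda>x. - f x) a"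
  using l2_bound_scaleR[of M f a "-1"] by simp

lemma l2_bound_mult_nn_integral:
  assumes f: "l2_bound M f a" and g: "l2_bound M g b"
  shows "(\<integral>\<^sup>+ x. ennreal (norm (f x) * norm (g x)) \<partial>M) \<le> ennreal (a * b)"
proof -
  note [measurable] = l2_boundD(1)[OF f] l2_boundD(1)[OF g]
  have ab: "a \<ge> 0" "b \<ge> 0" using f g by (auto simp: l2_bound_def)
  \<comment> \<open>The weights b / (2 a) and a / (2 b) make Young's inequality yield exactly a b.
    They degenerate when a bound is 0, but then the function vanishes almost everywhere.\<close>
  consider "a = 0" | "b = 0" | "a > 0" "b > 0" using ab by fastforce
  then show ?thesis
  proof cases
    case 1
    then have "AE x in M. ennreal (norm (f x) * norm (g x)) = 0" using l2_bound_AE_zero f by fastforce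
    then have "(\<integral>\<^sup>+ x. ennreal (norm (f x) * norm (g x)) \<partial>M) = 0" by (subst nn_integral_0_iff_AE) auto
    then show ?thesis by simp
  next
    case 2
    then have "AE x in M. ennreal (norm (f x) * norm (g x)) = 0" using l2_bound_AE_zero g by fastforce
    then have "(\<integral>\<^sup>+ x. ennreal (norm (f x) * norm (g x)) \<partial>M) = 0" by (subst nn_integral_0_iff_AE) auto
    then show ?thesis by simp
  next
    case 3
    have pw: "u * v \<le> b / (2 * a) * u\<^sup>2 + a / (2 * b) * v\<^sup>2" for u v :: real
    proof -
      have "0 \<le> (b * u - a * v)\<^sup>2 / (2 * a * b)" using 3 by simp
      also have "\<dots> = b / (2 * a) * u\<^sup>2 + a / (2 * b) * v\<^sup>2 - u * v"
        using 3 by (simp add: power2_eq_square field_simps)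
      finally show ?thesis by simp
    qed
    have "(\<integral>\<^sup>+ x. ennreal (norm (f x) * norm (g x)) \<partial>M)
        \<le> (\<integral>\<^sup>+ x. ennreal (b / (2 * a)) * ennreal ((norm (f x))\<^sup>2) + ennreal (a / (2 * b)) * ennreal ((norm (g x))\<^sup>2) \<partial>M)"
      using 3 pw
      by (intro nn_integral_mono) (auto simp flip: ennreal_mult ennreal_plus intro!: ennreal_leI)
    also have "\<dots> = ennreal (b / (2 * a)) * (\<integral>\<^sup>+ x. ennreal ((norm (f x))\<^sup>2) \<partial>M) + ennreal (a / (2 * b)) * (\<integral>\<^sup>+ x. ennreal ((norm (g x))\<^sup>2) \<partial>M)"
      by (simp add: nn_integral_add nn_integral_cmult)
    also have "\<dots> \<le> ennreal (b / (2 * a)) * ennreal (a\<^sup>2) + ennreal (a / (2 * b)) * ennreal (b\<^sup>2)"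
      using f g by (intro add_mono mult_left_mono) (auto simp: l2_bound_def)
    also have "\<dots> = ennreal (a * b)"
      using 3 by (auto simp flip: ennreal_mult ennreal_plus simp: power2_eq_square)
    finally show ?thesis .
  qed
qed

lemma l2_bound_inner:
  assumes f: "l2_bound M f a" and g: "l2_bound M g b"
  shows "integrable M (\<lambda>x. f x \<bullet> g x)" "\<bar>\<integral>x. f x \<bullet> g x \<partial>M\<bar> \<le> a * b"
proof -
  note [measurable] = l2_boundD(1)[OF f] l2_boundD(1)[OF g]
  have "(\<integral>\<^sup>+ x. ennreal (norm (f x \<bullet> g x)) \<partial>M) \<le> (\<integral>\<^sup>+ x. ennreal (norm (f x) * norm (g x)) \<partial>M)"
    by (intro nn_integral_mono ennreal_leI) (simp add: Cauchy_Schwarz_ineq2)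
  also note l2_bound_mult_nn_integral[OF f g]
  finally have *: "(\<integral>\<^sup>+ x. ennreal (norm (f x \<bullet> g x)) \<partial>M) \<le> ennreal (a * b)" .
  show int: "integrable M (\<lambda>x. f x \<bullet> g x)"
    using * by (intro integrableI_bounded) (auto simp: order_le_less_trans)
  have "ennreal (norm (\<integral>x. f x \<bullet> g x \<partial>M)) \<le> ennreal (a * b)"
    using integral_norm_bound_ennreal[OF int] * by (rule order_trans)
  then show "\<bar>\<integral>x. f x \<bullet> g x \<partial>M\<bar> \<le> a * b"
    using f g by (subst (asm) ennreal_le_iff) (auto simp: l2_bound_def)
qed

lemma l2_bound_add:
  assumes f: "l2_bound M f a" and g: "l2_bound M g b"
  shows "l2_bound M (\<lambda>x. f x + g x) (a + b)"
proof -
  note [measurable] = l2_boundD(1)[OF f] l2_boundD(1)[OF g]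
  have ab: "a \<ge> 0" "b \<ge> 0" using f g by (auto simp: l2_bound_def)
  have "(\<integral>\<^sup>+ x. ennreal ((norm (f x + g x))\<^sup>2) \<partial>M)
     \<le> (\<integral>\<^sup>+ x. (ennreal ((norm (f x))\<^sup>2) + 2 * ennreal (norm (f x) * norm (g x))) + ennreal ((norm (g x))\<^sup>2) \<partial>M)"
  proof (intro nn_integral_mono)
    fix x
    have "(norm (f x + g x))\<^sup>2 \<le> (norm (f x) + norm (g x))\<^sup>2" by (intro power_mono norm_triangle_ineq) auto
    also have "\<dots> = (norm (f x))\<^sup>2 + 2 * (norm (f x) * norm (g x)) + (norm (g x))\<^sup>2"
      by (simp add: power2_sum)
    finally have "ennreal ((norm (f x + g x))\<^sup>2) \<le> ennreal \<dots>" by (rule ennreal_leI)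
    then show "ennreal ((norm (f x + g x))\<^sup>2) \<le> (ennreal ((norm (f x))\<^sup>2) + 2 * ennreal (norm (f x) * norm (g x))) + ennreal ((norm (g x))\<^sup>2)"
      by (simp add: ennreal_mult)
  qed
  also have "\<dots> = ((\<integral>\<^sup>+ x. ennreal ((norm (f x))\<^sup>2) \<partial>M) + 2 * (\<integral>\<^sup>+ x. ennreal (norm (f x) * norm (g x)) \<partial>M)) + (\<integral>\<^sup>+ x. ennreal ((norm (g x))\<^sup>2) \<partial>M)"
    by (simp add: nn_integral_add nn_integral_cmult)
  also have "\<dots> \<le> (ennreal (a\<^sup>2) + 2 * ennreal (a * b)) + ennreal (b\<^sup>2)"
    using f g l2_bound_mult_nn_integral[OF f g] by (intro add_mono mult_left_mono) (auto simp: l2_bound_def)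
  also have "\<dots> = ennreal ((a + b)\<^sup>2)"
    using ab by (simp add: power2_sum ennreal_mult algebra_simps)
  finally show ?thesis using ab by (auto simp: l2_bound_def)
qed

lemma l2_bound_diff: "l2_bound M f a \<Longrightarrow> l2_bound M g b \<Longrightarrow> l2_bound M (\<lambda>x. f x - g x) (a + b)"
  using l2_bound_add[OF _ l2_bound_minus, of M f a g b] by simp

lemma l2_bound_distr:
  assumes "T \<in> measurable M N" "f \<in> borel_measurable N"
  shows "l2_bound (distr M N T) f a \<longleftrightarrow> l2_bound M (\<lambda>x. f (T x)) a"
  using assms by (simp add: l2_bound_def nn_integral_distr)

lemma nn_integral_pair_fst:
  assumes "prob_space N" "f \<in> borel_measurable M"
  shows "(\<integral>\<^sup>+ x. f (fst x) \<partial>(M \<Otimes>\<^sub>M N)) = (\<integral>\<^sup>+ x. f x \<partial>M)"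
proof -
  interpret N: prob_space N by fact
  note [measurable] = assms(2)
  show ?thesis
    by (subst N.nn_integral_fst[symmetric]) (simp_all add: N.emeasure_space_1)
qed

lemma l2_bound_pair_fst:
  assumes "prob_space N" "l2_bound M f a"
  shows "l2_bound (M \<Otimes>\<^sub>M N) (\<lambda>x. f (fst x)) a"
proof -
  note [measurable] = l2_boundD(1)[OF assms(2)]
  show ?thesis
    using assms nn_integral_pair_fst[OF assms(1), of "\<lambda>x. ennreal ((norm (f x))\<^sup>2)" M]
    by (auto simp: l2_bound_def)
qed

text \<open>By independence the first factor enters only through its L1 norm, at most
  \<open>a\<close> by Cauchy-Schwarz against a constant unit vector. With h = |w|^2 the second
  moment of the noise therefore suffices.\<close>

lemma l2_bound_indep_prod:
  fixes f :: "'s \<Rightarrow> 'c::euclidean_space"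
  assumes "prob_space N" "l2_bound M f a" "(\<integral>\<^sup>+ y. ennreal (h y) \<partial>N) \<le> ennreal c" "0 \<le> c" 
    and [measurable]: "h \<in> borel_measurable N" and M: "prob_space M"
  shows "(\<integral>\<^sup>+ x. ennreal (norm (f (fst x))) * ennreal (h (snd x)) \<partial>(M \<Otimes>\<^sub>M N)) \<le> ennreal (a * c)"
proof -
  interpret N: prob_space N by fact
  interpret M: prob_space M by fact
  note [measurable] = l2_boundD(1)[OF assms(2)]
  obtain b :: 'c where b: "b \<in> Basis" using nonempty_Basis by blast
  have "l2_bound M (\<lambda>_. b) 1" using b by (auto simp: l2_bound_def M.emeasure_space_1)
  from l2_bound_mult_nn_integral[OF assms(2) this] b
  have 1: "(\<integral>\<^sup>+ x. ennreal (norm (f x)) \<partial>M) \<le> ennreal a" by simp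
  have "(\<integral>\<^sup>+ x. ennreal (norm (f (fst x))) * ennreal (h (snd x)) \<partial>(M \<Otimes>\<^sub>M N))
     = (\<integral>\<^sup>+ x. \<integral>\<^sup>+ y. ennreal (norm (f x)) * ennreal (h y) \<partial>N \<partial>M)"
    by (subst N.nn_integral_fst[symmetric]) auto
  also have "\<dots> = (\<integral>\<^sup>+ x. ennreal (norm (f x)) \<partial>M) * (\<integral>\<^sup>+ y. ennreal (h y) \<partial>N)"
    by (simp add: nn_integral_cmult nn_integral_multc)
  also have "\<dots> \<le> ennreal a * ennreal c" using 1 assms(3) by (rule mult_mono) auto
  finally show ?thesis using assms(4) l2_boundD(2)[OF assms(2)] by (simp add: ennreal_mult)
qed

section \<open>Isotropic Gaussian measures\<close>

lemma nn_integral_gaussian_real: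
  assumes "v > 0"
  shows "(\<integral>\<^sup>+ (x::real). ennreal (exp (- x\<^sup>2 / (2 * v))) \<partial>lborel) = ennreal (sqrt (2 * pi * v))"
    and "(\<integral>\<^sup>+ (x::real). ennreal (x\<^sup>2 * exp (- x\<^sup>2 / (2 * v))) \<partial>lborel) = ennreal (v * sqrt (2 * pi * v))"
proof -
  have nd: "normal_density 0 (sqrt v) x = exp (- x\<^sup>2 / (2 * v)) / sqrt (2 * pi * v)" for x
    using assms by (simp add: normal_density_def)
  have pos: "sqrt (2 * pi * v) > 0" using assms by simp
  have *: "exp (- x\<^sup>2 / (2 * v)) = sqrt (2 * pi * v) * normal_density 0 (sqrt v) x" for x
    using pos assms unfolding nd by simp
  have m: "has_bochner_integral lborel (\<lambda>x. normal_density 0 (sqrt v) x * (x - 0) ^ (2 * k))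
      (fact (2 * k) / ((2 / (sqrt v)\<^sup>2) ^ k * fact k))" for k
    by (rule normal_moment_even) (use assms in simp)
  have "has_bochner_integral lborel (\<lambda>x. sqrt (2 * pi * v) * normal_density 0 (sqrt v) x) (sqrt (2 * pi * v))"
    using has_bochner_integral_mult_right[OF m[of 0], of "sqrt (2 * pi * v)"] by simp
  then show "(\<integral>\<^sup>+ (x::real). ennreal (exp (- x\<^sup>2 / (2 * v))) \<partial>lborel) = ennreal (sqrt (2 * pi * v))"
    unfolding * by (subst nn_integral_eq_integral) (use pos in \<open>auto simp: has_bochner_integral_iff\<close>)
  have "has_bochner_integral lborel (\<lambda>x. x\<^sup>2 * (sqrt (2 * pi * v) * normal_density 0 (sqrt v) x)) (v * sqrt (2 * pi * v))"
    using has_bochner_integral_mult_right[OF m[of 1], of "sqrt (2 * pi * v)"] assms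
    by (simp add: fact_2 mult_ac)
  then show "(\<integral>\<^sup>+ (x::real). ennreal (x\<^sup>2 * exp (- x\<^sup>2 / (2 * v))) \<partial>lborel) = ennreal (v * sqrt (2 * pi * v))"
    unfolding * by (subst nn_integral_eq_integral) (use pos in \<open>auto simp: has_bochner_integral_iff\<close>)
qed

lemma power2_norm_Basis: "(norm (x :: 'a::euclidean_space))\<^sup>2 = (\<Sum>b\<in>Basis. (x \<bullet> b)\<^sup>2)"
  unfolding power2_norm_eq_inner by (subst euclidean_inner) (simp add: power2_eq_square)

lemma exp_norm_prod: "exp (- (norm (x :: 'a::euclidean_space))\<^sup>2 / (2 * v)) = (\<Prod>b\<in>Basis. exp (- (x \<bullet> b)\<^sup>2 / (2 * v)))"
  unfolding power2_norm_Basis by (simp add: sum_divide_distrib flip: exp_sum sum_negf)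

lemma nn_integral_gaussian:
  assumes "v > 0"
  shows "(\<integral>\<^sup>+ (x::'a::euclidean_space). ennreal (exp (- (norm x)\<^sup>2 / (2 * v))) \<partial>lborel)
     = ennreal (sqrt (2 * pi * v) ^ DIM('a))"
proof -
  have "(\<integral>\<^sup>+ (x::'a). ennreal (exp (- (norm x)\<^sup>2 / (2 * v))) \<partial>lborel)
     = (\<integral>\<^sup>+ (x::'a). (\<Prod>b\<in>Basis. ennreal (exp (- (x \<bullet> b)\<^sup>2 / (2 * v)))) \<partial>lborel)"
    by (simp only: exp_norm_prod prod_ennreal exp_ge_zero)
  also have "\<dots> = (\<Prod>b\<in>(Basis :: 'a set). (\<integral>\<^sup>+ x. ennreal (exp (- x\<^sup>2 / (2 * v))) \<partial>lborel))"
    by (rule nn_integral_lborel_prod) auto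
  finally show ?thesis using assms by (simp only: nn_integral_gaussian_real(1)[OF assms]) (simp add: ennreal_power)
qed

lemma nn_integral_gaussian_coord:
  fixes b :: "'a::euclidean_space"
  assumes "v > 0" and b: "b \<in> Basis"
  shows "(\<integral>\<^sup>+ (x::'a). ennreal ((x \<bullet> b)\<^sup>2 * exp (- (norm x)\<^sup>2 / (2 * v))) \<partial>lborel)
     = ennreal (v * sqrt (2 * pi * v) ^ DIM('a))"
proof -
  define f :: "'a \<Rightarrow> real \<Rightarrow> real" where
    "f b' x = (if b' = b then x\<^sup>2 else 1) * exp (- x\<^sup>2 / (2 * v))" for b' x
  have nn: "0 \<le> f b' x" for b' x by (auto simp: f_def)
  have [measurable]: "f b' \<in> borel_measurable borel" for b' by (cases "b' = b") (simp_all add: f_def [abs_def])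
  have "(x \<bullet> b)\<^sup>2 * exp (- (norm x)\<^sup>2 / (2 * v)) = (\<Prod>b'\<in>Basis. f b' (x \<bullet> b'))" for x
    unfolding f_def exp_norm_prod prod.distrib using b by (simp add: prod.If_cases[of Basis "\<lambda>b'. b' = b"] Int_absorb1 Collect_conv_if)
  then have "(\<integral>\<^sup>+ (x::'a). ennreal ((x \<bullet> b)\<^sup>2 * exp (- (norm x)\<^sup>2 / (2 * v))) \<partial>lborel)
     = (\<integral>\<^sup>+ (x::'a). (\<Prod>b'\<in>Basis. ennreal (f b' (x \<bullet> b'))) \<partial>lborel)"
    by (simp add: prod_ennreal nn)
  also have "\<dots> = (\<Prod>b'\<in>(Basis :: 'a set). (\<integral>\<^sup>+ x. ennreal (f b' x) \<partial>lborel))"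
    by (rule nn_integral_lborel_prod) auto
  also have "\<dots> = (\<Prod>b'\<in>(Basis :: 'a set). ennreal ((if b' = b then v else 1) * sqrt (2 * pi * v)))"
    using nn_integral_gaussian_real[OF assms(1)] by (intro prod.cong refl) (auto simp: f_def)
  also have "\<dots> = ennreal (v * sqrt (2 * pi * v) ^ DIM('a))"
    using b assms by (subst prod_ennreal) (auto simp: prod.distrib)
  finally show ?thesis .
qed

lemma sets_isotropic_gaussian [simp, measurable_cong]: "sets (isotropic_gaussian \<mu> v) = sets borel"
  and space_isotropic_gaussian [simp]: "space (isotropic_gaussian \<mu> v) = UNIV"
  by (simp_all add: isotropic_gaussian_def)

lemma nn_integral_isotropic_gaussian:
  fixes f :: "'a::euclidean_space \<Rightarrow> ennreal"
  assumes "f \<in> borel_measurable borel"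
  shows "(\<integral>\<^sup>+ x. f x \<partial>isotropic_gaussian \<mu> v)
     = (\<integral>\<^sup>+ x. ennreal (1 / sqrt (2 * pi * v) ^ DIM('a) * exp (- (norm (x - \<mu>))\<^sup>2 / (2 * v))) * f x \<partial>lborel)"
  unfolding isotropic_gaussian_def using assms by (subst nn_integral_density) auto

lemma distr_isotropic_gaussian_affine:
  fixes a :: "'a::euclidean_space"
  assumes "c \<noteq> 0"
  shows "distr (isotropic_gaussian \<mu> v) borel (\<lambda>w. a + c *\<^sub>R w) = isotropic_gaussian (a + c *\<^sub>R \<mu>) (c\<^sup>2 * v)"
proof -
  let ?T = "\<lambda>w::'a. a + c *\<^sub>R w"
  let ?F = "\<lambda>y. ennreal (1 / sqrt (2 * pi * (c\<^sup>2 * v)) ^ DIM('a) * exp (- (norm (y - (a + c *\<^sub>R \<mu>)))\<^sup>2 / (2 * (c\<^sup>2 * v))))"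
  have "isotropic_gaussian (a + c *\<^sub>R \<mu>) (c\<^sup>2 * v) = density (density (distr lborel borel ?T) (\<lambda>_. ennreal (\<bar>c\<bar> ^ DIM('a)))) ?F"
    unfolding isotropic_gaussian_def using lborel_affine[OF assms, of a] by (simp add: ennreal_power)
  also have "\<dots> = density (distr lborel borel ?T) (\<lambda>y. ennreal (\<bar>c\<bar> ^ DIM('a)) * ?F y)"
    by (rule density_density_eq) auto
  also have "\<dots> = distr (density lborel (\<lambda>x. ennreal (\<bar>c\<bar> ^ DIM('a)) * ?F (?T x))) borel ?T"
    by (rule density_distr) auto
  also have "(\<lambda>x. ennreal (\<bar>c\<bar> ^ DIM('a)) * ?F (?T x)) = (\<lambda>y. ennreal (1 / sqrt (2 * pi * v) ^ DIM('a) * exp (- (norm (y - \<mu>))\<^sup>2 / (2 * v))))"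
  proof
    fix x
    have 1: "?T x - (a + c *\<^sub>R \<mu>) = c *\<^sub>R (x - \<mu>)" by (simp add: algebra_simps)
    have 2: "sqrt (2 * pi * (c\<^sup>2 * v)) = \<bar>c\<bar> * sqrt (2 * pi * v)" by (simp add: real_sqrt_mult)
    have 3: "\<bar>c\<bar> ^ DIM('a) * (1 / sqrt (2 * pi * (c\<^sup>2 * v)) ^ DIM('a)) = 1 / sqrt (2 * pi * v) ^ DIM('a)"
      unfolding 2 power_mult_distrib using assms by simp
    have 4: "(norm (?T x - (a + c *\<^sub>R \<mu>)))\<^sup>2 / (2 * (c\<^sup>2 * v)) = (norm (x - \<mu>))\<^sup>2 / (2 * v)"
      unfolding 1 using assms by (simp add: power_mult_distrib)
    show "ennreal (\<bar>c\<bar> ^ DIM('a)) * ?F (?T x) = ennreal (1 / sqrt (2 * pi * v) ^ DIM('a) * exp (- (norm (x - \<mu>))\<^sup>2 / (2 * v)))"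
      unfolding minus_divide_left[symmetric] 4 3[symmetric] by (simp add: mult.assoc flip: ennreal_mult')
  qed
  finally show ?thesis by (simp add: isotropic_gaussian_def)
qed

lemma prob_space_isotropic_gaussian:
  assumes "v > 0" shows "prob_space (isotropic_gaussian (\<mu> :: 'a::euclidean_space) v)"
proof -
  have 0: "prob_space (isotropic_gaussian (0 :: 'a) v)"
  proof
    have "emeasure (isotropic_gaussian (0 :: 'a) v) UNIV = (\<integral>\<^sup>+ (x::'a). 1 \<partial>isotropic_gaussian 0 v)" by simp
    also have "\<dots> = (\<integral>\<^sup>+ (x::'a). ennreal (1 / sqrt (2 * pi * v) ^ DIM('a)) * ennreal (exp (- (norm x)\<^sup>2 / (2 * v))) \<partial>lborel)"
      by (subst nn_integral_isotropic_gaussian) (use assms in \<open>auto simp flip: ennreal_mult\<close>)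
    also have "\<dots> = ennreal (1 / sqrt (2 * pi * v) ^ DIM('a)) * ennreal (sqrt (2 * pi * v) ^ DIM('a))"
      by (subst nn_integral_cmult) (auto simp only: nn_integral_gaussian[OF assms], measurable)
    also have "\<dots> = 1" using assms by (simp flip: ennreal_mult)
    finally show "emeasure (isotropic_gaussian (0 :: 'a) v) (space (isotropic_gaussian 0 v)) = 1" by simp
  qed
  then have "prob_space (distr (isotropic_gaussian (0 :: 'a) v) borel (\<lambda>w. \<mu> + 1 *\<^sub>R w))"
    by (rule prob_space.prob_space_distr) auto
  then show ?thesis by (subst (asm) distr_isotropic_gaussian_affine) auto
qed

lemma isotropic_gaussian_second_moment:
  assumes "v > 0"
  shows "(\<integral>\<^sup>+ (x::'a::euclidean_space). ennreal ((norm x)\<^sup>2) \<partial>isotropic_gaussian 0 v) = ennreal (real DIM('a) * v)"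
proof -
  let ?k = "1 / sqrt (2 * pi * v) ^ DIM('a)"
  have "(\<integral>\<^sup>+ (x::'a). ennreal ((norm x)\<^sup>2) \<partial>isotropic_gaussian 0 v)
     = (\<integral>\<^sup>+ (x::'a). (\<Sum>b\<in>Basis. ennreal ?k * ennreal ((x \<bullet> b)\<^sup>2 * exp (- (norm x)\<^sup>2 / (2 * v)))) \<partial>lborel)"
    using assms by (subst nn_integral_isotropic_gaussian)
      (auto simp: power2_norm_Basis[of x for x] sum_distrib_left sum_distrib_right mult_ac simp flip: ennreal_mult sum_ennreal intro!: nn_integral_cong)
  also have "\<dots> = (\<Sum>b\<in>(Basis::'a set). ennreal ?k * (\<integral>\<^sup>+ x. ennreal ((x \<bullet> b)\<^sup>2 * exp (- (norm x)\<^sup>2 / (2 * v))) \<partial>lborel))"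
    by (simp add: nn_integral_sum nn_integral_cmult)
  also have "\<dots> = (\<Sum>b\<in>(Basis::'a set). ennreal v)"
    using assms by (intro sum.cong refl, subst nn_integral_gaussian_coord) (auto simp flip: ennreal_mult)
  also have "\<dots> = ennreal (real DIM('a) * v)" using assms by (simp add: ennreal_mult ennreal_of_nat_eq_real_of_nat)
  finally show ?thesis .
qed

lemma isotropic_gaussian_convolution:
  fixes f :: "'a::euclidean_space \<Rightarrow> ennreal"
  assumes [simp]: "a > 0" "b > 0" and [measurable]: "f \<in> borel_measurable borel"
  shows "(\<integral>\<^sup>+ s. \<integral>\<^sup>+ w. f (s + w) \<partial>isotropic_gaussian 0 a \<partial>isotropic_gaussian 0 b) = (\<integral>\<^sup>+ x. f x \<partial>isotropic_gaussian 0 (a + b))"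
proof -
  define \<phi> :: "real \<Rightarrow> 'a \<Rightarrow> real" where
    "\<phi> v x = 1 / sqrt (2 * pi * v) ^ DIM('a) * exp (- (norm x)\<^sup>2 / (2 * v))" for v x
  have [measurable]: "\<phi> v \<in> borel_measurable borel" for v by (simp add: \<phi>_def [abs_def])
  have nn: "v > 0 \<Longrightarrow> 0 \<le> \<phi> v x" for v x by (simp add: \<phi>_def)
  \<comment> \<open>The square is completed in s: given x = s + w, the summand s is Gaussian with
    mean b / (a + b) x and variance a b / (a + b).\<close>
  define c where "c = a * b / (a + b)"
  have c: "c > 0" by (simp add: c_def add_pos_pos)
  have split: "\<phi> b s * \<phi> a (x - s) = \<phi> (a + b) x * \<phi> c (s - (b / (a + b)) *\<^sub>R x)" for x s
  proof -
    have ab: "a + b > 0" by (simp add: add_pos_pos)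
    have "(norm s)\<^sup>2 / (2 * b) + (norm (x - s))\<^sup>2 / (2 * a)
        = (norm x)\<^sup>2 / (2 * (a + b)) + (norm (s - (b / (a + b)) *\<^sub>R x))\<^sup>2 / (2 * c)"
    proof -
      have x: "(norm (x - s))\<^sup>2 = (norm x)\<^sup>2 - 2 * (x \<bullet> s) + (norm s)\<^sup>2"
        unfolding power2_norm_eq_inner by (simp add: inner_diff_left inner_diff_right inner_commute)
      have y: "(norm (s - (b / (a + b)) *\<^sub>R x))\<^sup>2 = (norm s)\<^sup>2 - 2 * (b / (a + b)) * (x \<bullet> s) + (b / (a + b))\<^sup>2 * (norm x)\<^sup>2"
        unfolding power2_norm_eq_inner
        by (simp add: inner_diff_left inner_diff_right inner_commute power2_eq_square)
      have "(S / (2 * b) + (X - 2 * I + S) / (2 * a))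
        = X / (2 * (a + b)) + (S - 2 * (b / (a + b)) * I + (b / (a + b))\<^sup>2 * X) / (2 * c)" for S X I
        proof -
        have "a \<noteq> 0" "b \<noteq> 0" "a + b \<noteq> 0" using ab assms(1,2) by linarith+
        then show ?thesis unfolding c_def by (simp add: divide_simps power2_eq_square) algebra
      qed
      then show ?thesis unfolding x y .
    qed
    then have e: "exp (- (norm s)\<^sup>2 / (2 * b)) * exp (- (norm (x - s))\<^sup>2 / (2 * a))
        = exp (- (norm x)\<^sup>2 / (2 * (a + b))) * exp (- (norm (s - (b / (a + b)) *\<^sub>R x))\<^sup>2 / (2 * c))"
      by (simp flip: exp_add)
    have s: "sqrt (2 * pi * b) * sqrt (2 * pi * a) = sqrt (2 * pi * (a + b)) * sqrt (2 * pi * c)"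
      unfolding real_sqrt_mult[symmetric] c_def using ab by simp
    have s: "sqrt (2 * pi * b) ^ DIM('a) * sqrt (2 * pi * a) ^ DIM('a) = sqrt (2 * pi * (a + b)) ^ DIM('a) * sqrt (2 * pi * c) ^ DIM('a)"
      unfolding power_mult_distrib[symmetric] s ..
    have "\<phi> b s * \<phi> a (x - s) = 1 / (sqrt (2 * pi * b) ^ DIM('a) * sqrt (2 * pi * a) ^ DIM('a)) * (exp (- (norm s)\<^sup>2 / (2 * b)) * exp (- (norm (x - s))\<^sup>2 / (2 * a)))"
      by (simp add: \<phi>_def)
    also have "\<dots> = \<phi> (a + b) x * \<phi> c (s - (b / (a + b)) *\<^sub>R x)"
      unfolding s e by (simp add: \<phi>_def)
    finally show ?thesis .
  qed
  have shift: "(\<integral>\<^sup>+ w. f (s + w) \<partial>isotropic_gaussian 0 a) = (\<integral>\<^sup>+ x. ennreal (\<phi> a (x - s)) * f x \<partial>lborel)" for s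
  proof -
    have "(\<integral>\<^sup>+ w. f (s + w) \<partial>isotropic_gaussian 0 a) = (\<integral>\<^sup>+ x. f x \<partial>distr (isotropic_gaussian 0 a) borel (\<lambda>w. s + 1 *\<^sub>R w))"
      by (subst nn_integral_distr) auto
    also have "\<dots> = (\<integral>\<^sup>+ x. f x \<partial>isotropic_gaussian s a)"
      by (subst distr_isotropic_gaussian_affine) auto
    finally show ?thesis by (simp add: nn_integral_isotropic_gaussian \<phi>_def)
  qed
  have mass: "(\<integral>\<^sup>+ s. ennreal (\<phi> c (s - \<mu>)) \<partial>lborel) = 1" for \<mu>
  proof -
    interpret prob_space "isotropic_gaussian \<mu> c" by (rule prob_space_isotropic_gaussian[OF c])
    show ?thesis using emeasure_space_1 nn_integral_isotropic_gaussian[of "\<lambda>_. 1" \<mu> c] by (simp add: \<phi>_def)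
  qed
  have "(\<integral>\<^sup>+ s. \<integral>\<^sup>+ w. f (s + w) \<partial>isotropic_gaussian 0 a \<partial>isotropic_gaussian 0 b)
      = (\<integral>\<^sup>+ s. ennreal (\<phi> b s) * (\<integral>\<^sup>+ x. ennreal (\<phi> a (x - s)) * f x \<partial>lborel) \<partial>lborel)"
    unfolding shift by (subst nn_integral_isotropic_gaussian) (auto simp: \<phi>_def)
  also have "\<dots> = (\<integral>\<^sup>+ s. (\<integral>\<^sup>+ x. ennreal (\<phi> b s) * (ennreal (\<phi> a (x - s)) * f x) \<partial>lborel) \<partial>lborel)"
    by (subst nn_integral_cmult) auto
  also have "\<dots> = (\<integral>\<^sup>+ x. (\<integral>\<^sup>+ s. ennreal (\<phi> b s) * (ennreal (\<phi> a (x - s)) * f x) \<partial>lborel) \<partial>lborel)"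
    by (rule lborel_pair.Fubini') auto
  also have "\<dots> = (\<integral>\<^sup>+ x. (\<integral>\<^sup>+ s. (ennreal (\<phi> (a + b) x) * f x) * ennreal (\<phi> c (s - (b / (a + b)) *\<^sub>R x)) \<partial>lborel) \<partial>lborel)"
  proof (intro nn_integral_cong)
    fix x s
    have "ennreal (\<phi> b s) * ennreal (\<phi> a (x - s)) = ennreal (\<phi> (a + b) x) * ennreal (\<phi> c (s - (b / (a + b)) *\<^sub>R x))"
      using c by (simp add: split nn add_pos_pos flip: ennreal_mult)
    from arg_cong[OF this, of "\<lambda>u. u * f x"]
    show "ennreal (\<phi> b s) * (ennreal (\<phi> a (x - s)) * f x) = (ennreal (\<phi> (a + b) x) * f x) * ennreal (\<phi> c (s - (b / (a + b)) *\<^sub>R x))"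
      by (simp only: mult_ac)
  qed
  also have "\<dots> = (\<integral>\<^sup>+ x. ennreal (\<phi> (a + b) x) * f x \<partial>lborel)"
    by (subst nn_integral_cmult) (auto simp: mass)
  also have "\<dots> = (\<integral>\<^sup>+ x. f x \<partial>isotropic_gaussian 0 (a + b))"
    by (simp add: nn_integral_isotropic_gaussian \<phi>_def)
  finally show ?thesis .
qed

text \<open>Spends half of a Gaussian exponent: a factor exp(c |x|) costs a constant and a doubling
  of the variance.\<close>

lemma linear_le_quadratic: "v > 0 \<Longrightarrow> c * r \<le> c\<^sup>2 * v + r\<^sup>2 / (4 * v)" for c r v :: real
proof -
  assume v: "v > 0"
  have "0 \<le> (2 * c * v - r)\<^sup>2 / (4 * v)" using v by simp
  also have "\<dots> = c\<^sup>2 * v + r\<^sup>2 / (4 * v) - c * r" using v by (simp add: power2_eq_square field_simps)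
  finally show ?thesis by simp
qed

lemma nn_integral_exp_norm_gaussian:
  assumes "v > 0"
  shows "(\<integral>\<^sup>+ (x::'a::euclidean_space). ennreal (exp (c * norm x) * exp (- (norm x)\<^sup>2 / (2 * v))) \<partial>lborel) < \<infinity>"
proof -
  have "(\<integral>\<^sup>+ (x::'a). ennreal (exp (c * norm x) * exp (- (norm x)\<^sup>2 / (2 * v))) \<partial>lborel)
     \<le> (\<integral>\<^sup>+ (x::'a). ennreal (exp (c\<^sup>2 * v)) * ennreal (exp (- (norm x)\<^sup>2 / (2 * (2 * v)))) \<partial>lborel)"
  proof (intro nn_integral_mono)
    fix x :: 'a
    have "c * norm x + - (norm x)\<^sup>2 / (2 * v) \<le> c\<^sup>2 * v + - (norm x)\<^sup>2 / (2 * (2 * v))"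
      using linear_le_quadratic[OF assms, of c "norm x"] by simp
    then show "ennreal (exp (c * norm x) * exp (- (norm x)\<^sup>2 / (2 * v))) \<le> ennreal (exp (c\<^sup>2 * v)) * ennreal (exp (- (norm x)\<^sup>2 / (2 * (2 * v))))"
      by (simp flip: exp_add ennreal_mult)
  qed
  also have "\<dots> = ennreal (exp (c\<^sup>2 * v)) * ennreal (sqrt (2 * pi * (2 * v)) ^ DIM('a))"
    using nn_integral_gaussian[of "2 * v", where 'a='a] assms by (subst nn_integral_cmult) (auto simp del: mult_2 mult_2_right mult_numeral_left minus_divide_left[symmetric] divide_minus_left)
  also have "\<dots> < \<infinity>" by (simp add: ennreal_mult_less_top)
  finally show ?thesis .
qed

lemma isotropic_gaussian_exp_moment:
  assumes "v > 0"
  shows "(\<integral>\<^sup>+ (x::'a::euclidean_space). ennreal (exp (c * norm x)) \<partial>isotropic_gaussian 0 v) < \<infinity>"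
proof -
  have "(\<integral>\<^sup>+ (x::'a). ennreal (exp (c * norm x)) \<partial>isotropic_gaussian 0 v)
     = (\<integral>\<^sup>+ (x::'a). ennreal (1 / sqrt (2 * pi * v) ^ DIM('a)) * ennreal (exp (c * norm x) * exp (- (norm x)\<^sup>2 / (2 * v))) \<partial>lborel)"
    by (subst nn_integral_isotropic_gaussian) (use assms in \<open>auto simp: mult_ac simp flip: ennreal_mult\<close>)
  also have "\<dots> < \<infinity>"
    using nn_integral_exp_norm_gaussian[OF assms, of c, where 'a='a]
    by (subst nn_integral_cmult) (auto simp: ennreal_mult_less_top)
  finally show ?thesis .
qed

definition uniform01 :: "real measure" where "uniform01 = uniform_measure lborel {0..1}"

lemma sets_uniform01 [simp, measurable_cong]: "sets uniform01 = sets borel"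
  and space_uniform01 [simp]: "space uniform01 = UNIV"
  by (simp_all add: uniform01_def)

lemma prob_space_uniform01: "prob_space uniform01"
  unfolding uniform01_def by (rule prob_space_uniform_measure) auto

lemma nn_integral_uniform01_if:
  assumes "0 \<le> \<alpha>" "\<alpha> \<le> 1"
  shows "(\<integral>\<^sup>+ u. (if u < \<alpha> then A else B) \<partial>uniform01) = ennreal \<alpha> * A + ennreal (1 - \<alpha>) * B"
proof -
  have "(\<integral>\<^sup>+ u. (if u < \<alpha> then A else B) \<partial>uniform01) = (\<integral>\<^sup>+ u. (if u < \<alpha> then A else B) * indicator {0..1} u \<partial>lborel)"
    unfolding uniform01_def by (subst nn_integral_uniform_measure) (auto simp: divide_ennreal_def)
  also have "\<dots> = (\<integral>\<^sup>+ u. A * indicator {0..<\<alpha>} u + B * indicator {\<alpha>..1} u \<partial>lborel)"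
    using assms by (intro nn_integral_cong) (auto simp: indicator_def)
  also have "\<dots> = A * ennreal \<alpha> + B * ennreal (1 - \<alpha>)"
    using assms by (subst nn_integral_add) (auto simp: nn_integral_cmult)
  finally show ?thesis by (simp add: mult.commute)
qed

section \<open>Moments of the Gibbs measure\<close>

lemma nn_integral_lborel_shift:
  fixes c :: "'a::euclidean_space"
  assumes [measurable]: "f \<in> borel_measurable borel"
  shows "(\<integral>\<^sup>+ y. f (c + y) \<partial>lborel) = (\<integral>\<^sup>+ y. f y \<partial>lborel)"
  by (subst (2) lborel_distr_plus[of c, symmetric], subst nn_integral_distr) auto

context strongly_convex_potential
begin

lemma continuous_U: "continuous_on A U"
  using deriv_U by (meson continuous_at_imp_continuous_on has_derivative_continuous)

lemma continuous_g: "continuous_on A g"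
  using deriv_g by (meson continuous_at_imp_continuous_on has_derivative_continuous)

lemma borel_measurable_U [measurable]: "U \<in> borel_measurable borel"
  by (rule borel_measurable_continuous_onI[OF continuous_U])

lemma borel_measurable_g [measurable]: "g \<in> borel_measurable borel"
  by (rule borel_measurable_continuous_onI[OF continuous_g])

definition Z :: ennreal where "Z = (\<integral>\<^sup>+ y. ennreal (exp (- U y)) \<partial>lborel)"

text \<open>Strong convexity at 0 bounds exp(- U), up to a constant, by exp(|g 0| |y|) times a
  centred Gaussian weight of variance 1 / m.\<close>

lemma exp_moment_unnormalized:
  "(\<integral>\<^sup>+ y. ennreal (exp (c * norm y)) * ennreal (exp (- U y)) \<partial>lborel) < \<infinity>"
proof -
  have v: "1 / m > 0" using m_pos by simp
  have "(\<integral>\<^sup>+ y. ennreal (exp (c * norm y)) * ennreal (exp (- U y)) \<partial>lborel)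
    \<le> (\<integral>\<^sup>+ (y::'a). ennreal (exp (- U 0)) * ennreal (exp ((c + norm (g 0)) * norm y) * exp (- (norm y)\<^sup>2 / (2 * (1 / m)))) \<partial>lborel)"
  proof (intro nn_integral_mono)
    fix y
    have "- (g 0 \<bullet> y) \<le> norm (g 0) * norm y"
      using Cauchy_Schwarz_ineq2[of "g 0" y] by simp
    then have "c * norm y - U y \<le> - U 0 + ((c + norm (g 0)) * norm y + - (norm y)\<^sup>2 / (2 * (1 / m)))"
      using convex[of 0 y] by (simp add: algebra_simps)
    then show "ennreal (exp (c * norm y)) * ennreal (exp (- U y))
      \<le> ennreal (exp (- U 0)) * ennreal (exp ((c + norm (g 0)) * norm y) * exp (- (norm y)\<^sup>2 / (2 * (1 / m))))"
      by (simp flip: ennreal_mult exp_add)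
  qed
  also have "\<dots> = ennreal (exp (- U 0)) * (\<integral>\<^sup>+ (y::'a). ennreal (exp ((c + norm (g 0)) * norm y) * exp (- (norm y)\<^sup>2 / (2 * (1 / m)))) \<partial>lborel)"
    by (subst nn_integral_cmult) auto
  also have "\<dots> < \<infinity>"
    using nn_integral_exp_norm_gaussian[OF v, of "c + norm (g 0)", where 'a='a]
    by (simp only: ennreal_mult_less_top infinity_ennreal_def) simp
  finally show ?thesis .
qed

lemma Z_finite: "Z < \<infinity>"
  using exp_moment_unnormalized[of 0] by (simp add: Z_def)

lemma Z_pos: "Z > 0"
proof -
  have "Z \<noteq> 0"
  proof
    assume "Z = 0"
    then have "AE y in lborel. ennreal (exp (- U (y::'a))) = 0"
      unfolding Z_def by (subst (asm) nn_integral_0_iff_AE) auto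
    then have "AE y in (lborel :: 'a measure). False" by simp
    then show False by (subst (asm) AE_iff_measurable[OF _ refl]) auto
  qed
  then show ?thesis by (simp add: zero_less_iff_neq_zero)
qed

lemma sets_gibbs [simp, measurable_cong]: "sets (gibbs U) = sets borel"
  and space_gibbs [simp]: "space (gibbs U) = UNIV"
  by (simp_all add: gibbs_def)

lemma nn_integral_gibbs:
  assumes [measurable]: "f \<in> borel_measurable borel"
  shows "(\<integral>\<^sup>+ y. f y \<partial>gibbs U) = (\<integral>\<^sup>+ y. ennreal (exp (- U y)) * f y \<partial>lborel) / Z"
proof -
  have "(\<integral>\<^sup>+ y. f y \<partial>gibbs U) = (\<integral>\<^sup>+ y. ennreal (exp (- U y)) / Z * f y \<partial>lborel)"
    unfolding gibbs_def Z_def[symmetric] by (subst nn_integral_density) auto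
  also have "\<dots> = (\<integral>\<^sup>+ y. inverse Z * (ennreal (exp (- U y)) * f y) \<partial>lborel)"
    by (simp add: divide_ennreal_def mult_ac)
  also have "\<dots> = inverse Z * (\<integral>\<^sup>+ y. ennreal (exp (- U y)) * f y \<partial>lborel)"
    by (subst nn_integral_cmult) auto
  finally show ?thesis by (simp add: divide_ennreal_def mult.commute)
qed

lemma prob_space_gibbs: "prob_space (gibbs U)"
proof
  have "emeasure (gibbs U) (space (gibbs U)) = (\<integral>\<^sup>+ y. 1 \<partial>gibbs U)" by simp
  also have "\<dots> = Z / Z" by (subst nn_integral_gibbs) (auto simp: Z_def)
  also have "\<dots> = 1" using Z_pos Z_finite by (intro ennreal_divide_self) auto
  finally show "emeasure (gibbs U) (space (gibbs U)) = 1" .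
qed

lemma gibbs_exp_moment: "(\<integral>\<^sup>+ y. ennreal (exp (c * norm y)) \<partial>gibbs U) < \<infinity>"
  using exp_moment_unnormalized[of c] Z_pos
  by (subst nn_integral_gibbs) (auto simp: mult.commute divide_ennreal_def less_top[symmetric] ennreal_mult_eq_top_iff)

lemma gibbs_exp_gradient: "(\<integral>\<^sup>+ y. ennreal (exp (norm (g y))) \<partial>gibbs U) < \<infinity>"
proof -
  have "(\<integral>\<^sup>+ y. ennreal (exp (norm (g y))) \<partial>gibbs U)
      \<le> (\<integral>\<^sup>+ y. ennreal (exp (norm (g 0))) * ennreal (exp (L * norm y)) \<partial>gibbs U)"
  proof (intro nn_integral_mono)
    fix y
    have "norm (g y) \<le> norm (g 0) + L * norm y"
      using Lipschitz[of y 0] norm_triangle_ineq2[of "g y" "g 0"] by simp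
    then show "ennreal (exp (norm (g y))) \<le> ennreal (exp (norm (g 0))) * ennreal (exp (L * norm y))"
      by (simp flip: ennreal_mult exp_add)
  qed
  also have "\<dots> < \<infinity>"
    using gibbs_exp_moment[of L] by (subst nn_integral_cmult) (auto simp: ennreal_mult_less_top)
  finally show ?thesis .
qed

lemma gibbs_second_moment: "(\<integral>\<^sup>+ y. ennreal ((norm y)\<^sup>2) \<partial>gibbs U) < \<infinity>"
proof -
  have "(\<integral>\<^sup>+ y. ennreal ((norm y)\<^sup>2) \<partial>gibbs U) \<le> (\<integral>\<^sup>+ y. 2 * ennreal (exp (1 * norm y)) \<partial>gibbs U)"
  proof (intro nn_integral_mono)
    fix y :: 'a
    have "(norm y)\<^sup>2 \<le> 2 * exp (norm y)"
      using exp_lower_Taylor_quadratic[of "norm y"] norm_ge_zero[of y] by linarith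
    then have "ennreal ((norm y)\<^sup>2) \<le> ennreal (2 * exp (norm y))" by (rule ennreal_leI)
    then show "ennreal ((norm y)\<^sup>2) \<le> 2 * ennreal (exp (1 * norm y))" by (simp add: ennreal_mult)
  qed
  also have "\<dots> < \<infinity>"
    using gibbs_exp_moment[of 1] by (subst nn_integral_cmult) (auto simp: ennreal_mult_less_top)
  finally show ?thesis .
qed

text \<open>Translating Lebesgue measure by \<open>s b\<close> replaces the integration by parts
  \<open>E |\<nabla>U|\<^sup>2 = E \<Delta>U\<close>.\<close>

lemma gibbs_exp_gradient_coord:
  assumes "b \<in> Basis"
  shows "(\<integral>\<^sup>+ y. ennreal (exp (- (s * (g y \<bullet> b)))) \<partial>gibbs U) \<le> ennreal (exp (L * s\<^sup>2 / 2))"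
proof -
  have "(\<integral>\<^sup>+ y. ennreal (exp (- U y)) * ennreal (exp (- (s * (g y \<bullet> b)))) \<partial>lborel)
     \<le> (\<integral>\<^sup>+ y. ennreal (exp (L * s\<^sup>2 / 2)) * ennreal (exp (- U (s *\<^sub>R b + y))) \<partial>lborel)"
  proof (intro nn_integral_mono)
    fix y
    have "U (s *\<^sub>R b + y) \<le> U y + s * (g y \<bullet> b) + L * s\<^sup>2 / 2"
      using U_upper[of "s *\<^sub>R b + y" y] assms by simp
    then show "ennreal (exp (- U y)) * ennreal (exp (- (s * (g y \<bullet> b))))
       \<le> ennreal (exp (L * s\<^sup>2 / 2)) * ennreal (exp (- U (s *\<^sub>R b + y)))"
      by (simp flip: ennreal_mult exp_add)
  qed
  also have "\<dots> = ennreal (exp (L * s\<^sup>2 / 2)) * (\<integral>\<^sup>+ y. ennreal (exp (- U (s *\<^sub>R b + y))) \<partial>lborel)"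
    by (subst nn_integral_cmult) auto
  also have "(\<integral>\<^sup>+ y. ennreal (exp (- U (s *\<^sub>R b + y))) \<partial>lborel) = Z"
    unfolding Z_def by (rule nn_integral_lborel_shift) auto
  finally have "(\<integral>\<^sup>+ y. ennreal (exp (- (s * (g y \<bullet> b)))) \<partial>gibbs U) \<le> ennreal (exp (L * s\<^sup>2 / 2)) * Z / Z"
    by (subst nn_integral_gibbs) (auto intro: divide_right_mono_ennreal)
  also have "\<dots> = ennreal (exp (L * s\<^sup>2 / 2))"
    using Z_pos Z_finite by (simp add: ennreal_mult_divide_eq less_top)
  finally show ?thesis .
qed

text \<open>Adding the exponential bounds for t and - t and using 2 + a^2 <= 2 cosh a gives 2 + t^2
  E <= 2 exp(L t^2 / 2); letting t tend to 0 leaves E <= L.\<close>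

lemma gibbs_gradient_coord_second_moment:
  assumes b: "b \<in> Basis"
  shows "(\<integral>\<^sup>+ y. ennreal ((g y \<bullet> b)\<^sup>2) \<partial>gibbs U) \<le> ennreal L"
proof -
  interpret prob_space "gibbs U" by (rule prob_space_gibbs)
  let ?E = "\<integral>\<^sup>+ y. ennreal ((g y \<bullet> b)\<^sup>2) \<partial>gibbs U"
  \<comment> \<open>2 cosh a - 2 is the square of 2 sinh(a / 2), whose absolute value is at least
    |a|.\<close>
  have cosh: "2 + a\<^sup>2 \<le> exp (- a) + exp a" for a :: real
  proof -
    have "0 \<le> (exp (a / 2) - exp (- a / 2) - a) * (exp (a / 2) - exp (- a / 2) + a)"
    proof -
      have *: "x \<le> exp (x / 2) - exp (- x / 2)" if "0 \<le> x" for x :: real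
      proof -
        let ?f = "\<lambda>x::real. exp (x / 2) - exp (- x / 2) - x"
        have "?f 0 \<le> ?f x"
        proof (rule DERIV_nonneg_imp_nondecreasing[OF that])
          fix t :: real
          have "(?f has_real_derivative (exp (t / 2) + exp (- t / 2)) / 2 - 1) (at t)"
            by (auto intro!: derivative_eq_intros simp: field_simps)
          moreover have "exp (t / 2) + exp (- t / 2) \<ge> 2"
            using exp_ge_add_one_self[of "t / 2"] exp_ge_add_one_self[of "- t / 2"] by linarith
          ultimately show "\<exists>y. (?f has_real_derivative y) (at t) \<and> 0 \<le> y" by force
        qed
        then show ?thesis by simp
      qed
      show ?thesis
      proof (cases "0 \<le> a")
        case True then show ?thesis using *[of a] by (intro mult_nonneg_nonneg) auto
      next
        case False then show ?thesis using *[of "- a"] by (intro mult_nonpos_nonpos) auto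
      qed
    qed
    also have "\<dots> = (exp (a / 2))\<^sup>2 + (exp (- a / 2))\<^sup>2 - 2 * (exp (a / 2) * exp (- a / 2)) - a\<^sup>2"
      by (simp add: power2_eq_square algebra_simps)
    also have "\<dots> = exp a + exp (- a) - 2 - a\<^sup>2"
      by (simp add: power2_eq_square flip: exp_add)
    finally show ?thesis by simp
  qed
  have bd: "?E \<le> ennreal (L * (1 + x))" if x: "0 < x" "x \<le> 1" for x
  proof -
    \<comment> \<open>Makes the exponent L t^2 / 2 equal to x; then exp x <= 1 + x + x^2 produces
      the factor 1 + x.\<close>
    define t where "t = sqrt (2 * x / L)"
    have t: "t > 0" "L * t\<^sup>2 / 2 = x" "t\<^sup>2 = 2 * x / L" using x L_pos by (auto simp: t_def)
    have "2 + ennreal (t\<^sup>2) * ?E = (\<integral>\<^sup>+ y. ennreal 2 + ennreal (t\<^sup>2) * ennreal ((g y \<bullet> b)\<^sup>2) \<partial>gibbs U)"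
      by (subst nn_integral_add) (auto simp: nn_integral_cmult emeasure_space_1[simplified])
    also have "\<dots> \<le> (\<integral>\<^sup>+ y. ennreal (exp (- (t * (g y \<bullet> b)))) + ennreal (exp (- (- t * (g y \<bullet> b)))) \<partial>gibbs U)"
    proof (intro nn_integral_mono)
      fix y
    have "ennreal (2 + (t * (g y \<bullet> b))\<^sup>2) \<le> ennreal (exp (- (t * (g y \<bullet> b))) + exp (t * (g y \<bullet> b)))"
      using cosh by (rule ennreal_leI)
    then show "ennreal 2 + ennreal (t\<^sup>2) * ennreal ((g y \<bullet> b)\<^sup>2) \<le> ennreal (exp (- (t * (g y \<bullet> b)))) + ennreal (exp (- (- t * (g y \<bullet> b))))"
        by (simp add: power_mult_distrib ennreal_mult)
    qed
    also have "\<dots> = (\<integral>\<^sup>+ y. ennreal (exp (- (t * (g y \<bullet> b)))) \<partial>gibbs U) + (\<integral>\<^sup>+ y. ennreal (exp (- (- t * (g y \<bullet> b)))) \<partial>gibbs U)"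
      by (subst nn_integral_add) auto
    also have "\<dots> \<le> ennreal (exp x) + ennreal (exp x)"
      using gibbs_exp_gradient_coord[OF b, of t] gibbs_exp_gradient_coord[OF b, of "- t"] t(2)
      by (intro add_mono) auto
    also have "\<dots> \<le> 2 + ennreal (2 * (x + x\<^sup>2))"
    proof -
      have "exp x + exp x \<le> 2 + 2 * (x + x\<^sup>2)" using exp_bound[of x] x by simp
      then show ?thesis using x by (simp flip: ennreal_plus ennreal_numeral)
    qed
    finally have "ennreal (t\<^sup>2) * ?E \<le> ennreal (2 * (x + x\<^sup>2))"
      by (rule ennreal_add_left_cancel_le[THEN iffD1, THEN disjE]) auto
    then have "ennreal (t\<^sup>2) * ?E \<le> ennreal (t\<^sup>2) * ennreal (L * (1 + x))"
      using x L_pos t by (simp add: power2_eq_square algebra_simps flip: ennreal_mult)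
    then show ?thesis using t(1) by (subst (asm) ennreal_mult_le_mult_iff) auto
  qed
  show ?thesis
  proof (rule ennreal_le_epsilon)
    fix e :: real assume e: "0 < e"
    define x where "x = min 1 (e / L)"
    have "L * (1 + x) \<le> L + e" using L_pos e by (auto simp: x_def min_def field_simps)
    moreover have "0 < x" "x \<le> 1" using e L_pos by (auto simp: x_def)
    ultimately have "?E \<le> ennreal (L + e)" using bd by (meson ennreal_leI order_trans)
    then show "?E \<le> ennreal L + ennreal e" using L_pos e by simp
  qed
qed

lemma l2_bound_gibbs_gradient: "l2_bound (gibbs U) g (sqrt (real DIM('a) * L))"
proof -
  have "(\<integral>\<^sup>+ y. ennreal ((norm (g y))\<^sup>2) \<partial>gibbs U) = (\<integral>\<^sup>+ y. (\<Sum>b\<in>Basis. ennreal ((g y \<bullet> b)\<^sup>2)) \<partial>gibbs U)"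
    by (simp add: power2_norm_Basis)
  also have "\<dots> = (\<Sum>b\<in>Basis. \<integral>\<^sup>+ y. ennreal ((g y \<bullet> b)\<^sup>2) \<partial>gibbs U)"
    by (subst nn_integral_sum) auto
  also have "\<dots> \<le> (\<Sum>b\<in>(Basis::'a set). ennreal L)"
    by (intro sum_mono gibbs_gradient_coord_second_moment)
  also have "\<dots> = ennreal (real DIM('a) * L)"
    using L_pos by (simp add: ennreal_mult ennreal_of_nat_eq_real_of_nat)
  finally show ?thesis using L_pos by (auto simp: l2_bound_def)
qed

end

section \<open>The Metropolis-adjusted step\<close>

text \<open>Variance 2, so that \<open>sqrt h\<close> times the first component has covariance 2 h
  I; the second component decides acceptance.\<close>

definition noise :: "('a::euclidean_space \<times> real) measure" where
  "noise = isotropic_gaussian 0 2 \<Otimes>\<^sub>M uniform01"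

lemma prob_space_noise: "prob_space (noise :: ('a::euclidean_space \<times> real) measure)"
proof -
  interpret N: prob_space "isotropic_gaussian (0::'a) 2" by (rule prob_space_isotropic_gaussian) simp
  interpret u: prob_space uniform01 by (rule prob_space_uniform01)
  interpret pair_prob_space "isotropic_gaussian (0::'a) 2" uniform01 ..
  show ?thesis unfolding noise_def by (rule prob_space_axioms)
qed

lemma sets_noise [simp, measurable_cong]: "sets noise = sets borel"
  unfolding noise_def borel_prod[symmetric] by (intro sets_pair_measure_cong) auto

lemma space_noise [simp]: "space noise = UNIV"
  by (simp add: noise_def space_pair_measure)

lemma nn_integral_noise:
  assumes [measurable]: "f \<in> borel_measurable borel"
  shows "(\<integral>\<^sup>+ n. f n \<partial>noise) = (\<integral>\<^sup>+ w. \<integral>\<^sup>+ u. f (w, u) \<partial>uniform01 \<partial>isotropic_gaussian 0 2)"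
proof -
  interpret u: prob_space uniform01 by (rule prob_space_uniform01)
  have "f \<in> borel_measurable (isotropic_gaussian 0 2 \<Otimes>\<^sub>M uniform01)"
    using assms sets_noise unfolding noise_def by (metis measurable_cong_sets)
  then show ?thesis unfolding noise_def by (rule u.nn_integral_fst[symmetric])
qed

lemma power_le_exp:
  assumes "0 \<le> x" "0 < n" shows "x ^ n \<le> real n ^ n * exp x"
proof -
  have "(x / real n) ^ n \<le> (1 + x / real n) ^ n" using assms by (intro power_mono) auto
  also have "\<dots> \<le> exp x" using assms by (intro exp_ge_one_plus_x_over_n_power_n) auto
  finally show ?thesis using assms by (simp add: power_divide field_simps)
qed

lemma measurable_uncurry:
  assumes F: "(\<lambda>p. F (fst p) (snd p)) \<in> borel_measurable (A \<Otimes>\<^sub>M B)"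
    and [measurable]: "f \<in> measurable M A" "k \<in> measurable M B"
  shows "(\<lambda>x. F (f x) (k x)) \<in> borel_measurable M"
  using measurable_compose[OF _ F, of "\<lambda>x. (f x, k x)" M] by simp

context strongly_convex_potential
begin

definition proposal :: "real \<Rightarrow> 'a \<Rightarrow> 'a \<Rightarrow> 'a" where
  "proposal h y w = y - h *\<^sub>R g y + sqrt h *\<^sub>R w"

text \<open>Minus the logarithm of the unnormalised joint density of the current point and the
  proposal, when the current point has law \<open>gibbs U\<close>.\<close>

definition act :: "real \<Rightarrow> 'a \<Rightarrow> 'a \<Rightarrow> real" where
  "act h y z = U y + (norm (z - y + h *\<^sub>R g y))\<^sup>2 / (4 * h)"

text \<open>The Metropolis-Hastings ratio: the normalising constants of the Gibbs measure and of the
  two proposal densities cancel.\<close>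

definition accept :: "real \<Rightarrow> 'a \<Rightarrow> 'a \<Rightarrow> real" where
  "accept h y z = min 1 (exp (act h y z - act h z y))"

definition mala :: "real \<Rightarrow> 'a \<Rightarrow> 'a \<times> real \<Rightarrow> 'a" where
  "mala h y n = (if snd n < accept h y (proposal h y (fst n)) then proposal h y (fst n) else y)"

lemma measurable_act [measurable (raw)]:
  assumes [measurable]: "f \<in> borel_measurable M" "k \<in> borel_measurable M"
  shows "(\<lambda>x. act h (f x) (k x)) \<in> borel_measurable M"
  unfolding act_def by measurable

lemma measurable_accept [measurable (raw)]:
  assumes [measurable]: "f \<in> borel_measurable M" "k \<in> borel_measurable M"
  shows "(\<lambda>x. accept h (f x) (k x)) \<in> borel_measurable M"
  unfolding accept_def by measurable

lemma measurable_proposal [measurable (raw)]: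
  assumes [measurable]: "f \<in> borel_measurable M" "k \<in> borel_measurable M"
  shows "(\<lambda>x. proposal h (f x) (k x)) \<in> borel_measurable M"
  unfolding proposal_def by measurable

lemma measurable_mala [measurable (raw)]:
  assumes [measurable]: "f \<in> borel_measurable M" and k: "k \<in> borel_measurable M"
  shows "(\<lambda>x. mala h (f x) (k x)) \<in> borel_measurable M"
proof -
  have [measurable]: "k \<in> measurable M (borel \<Otimes>\<^sub>M borel)" using k by (simp add: borel_prod)
  show ?thesis unfolding mala_def by measurable
qed

lemma accept_bounds: "0 \<le> accept h y z" "accept h y z \<le> 1"
  by (auto simp: accept_def)

text \<open>Each side is the minimum of exp(- act h y z) and exp(- act h z y).\<close>

lemma detailed_balance: "exp (- act h y z) * accept h y z = exp (- act h z y) * accept h z y"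
proof -
  have "exp (- act h y z) * accept h y z = min (exp (- act h y z)) (exp (- act h z y))" for y z
    by (simp add: accept_def min_mult_distrib_left flip: exp_add)
  then show ?thesis by (simp add: min.commute)
qed

section \<open>Invariance of the Gibbs measure under the Metropolis step\<close>

lemma nn_integral_proposal:
  assumes h: "h > 0" and [measurable]: "f \<in> borel_measurable borel"
  shows "(\<integral>\<^sup>+ w. f (proposal h y w) \<partial>isotropic_gaussian 0 2)
    = (\<integral>\<^sup>+ z. ennreal (1 / sqrt (4 * pi * h) ^ DIM('a) * exp (- (norm (z - y + h *\<^sub>R g y))\<^sup>2 / (4 * h))) * f z \<partial>lborel)"
proof -
  have "(\<integral>\<^sup>+ w. f (proposal h y w) \<partial>isotropic_gaussian 0 2)
     = (\<integral>\<^sup>+ z. f z \<partial>distr (isotropic_gaussian 0 2) borel (\<lambda>w. (y - h *\<^sub>R g y) + sqrt h *\<^sub>R w))"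
    unfolding proposal_def by (subst nn_integral_distr) auto
  also have "\<dots> = (\<integral>\<^sup>+ z. f z \<partial>isotropic_gaussian (y - h *\<^sub>R g y) (2 * h))"
    using h by (subst distr_isotropic_gaussian_affine) (auto simp: mult.commute)
  also have "\<dots> = (\<integral>\<^sup>+ z. ennreal (1 / sqrt (4 * pi * h) ^ DIM('a) * exp (- (norm (z - y + h *\<^sub>R g y))\<^sup>2 / (4 * h))) * f z \<partial>lborel)"
    by (subst nn_integral_isotropic_gaussian) (auto simp: algebra_simps)
  finally show ?thesis .
qed

text \<open>Exhibits the Lebesgue density of accepted moves (y, z), symmetric by
  \<open>detailed_balance\<close>. \<open>F\<close> keeps both arguments so that functions of the
  source and of the target can be integrated against the same density.\<close>

lemma nn_integral_accepted_proposal: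
  assumes h: "h > 0" and F: "(\<lambda>p. F (fst p) (snd p)) \<in> borel_measurable (borel \<Otimes>\<^sub>M borel)"
  shows "(\<integral>\<^sup>+ y. \<integral>\<^sup>+ w. ennreal (accept h y (proposal h y w)) * F y (proposal h y w) \<partial>isotropic_gaussian 0 2 \<partial>gibbs U)
    = (\<integral>\<^sup>+ y. \<integral>\<^sup>+ z. ennreal (1 / sqrt (4 * pi * h) ^ DIM('a) * (exp (- act h y z) * accept h y z)) * F y z \<partial>lborel \<partial>lborel) / Z"
proof -
  let ?k = "1 / sqrt (4 * pi * h) ^ DIM('a)"
  note [measurable (raw)] = measurable_uncurry[OF F]
  let ?e = "\<lambda>y z. exp (- (norm (z - y + h *\<^sub>R g y))\<^sup>2 / (4 * h))"
  have k: "?k \<ge> 0" using h by simp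
  have "(\<integral>\<^sup>+ y. \<integral>\<^sup>+ w. ennreal (accept h y (proposal h y w)) * F y (proposal h y w) \<partial>isotropic_gaussian 0 2 \<partial>gibbs U)
     = (\<integral>\<^sup>+ y. \<integral>\<^sup>+ z. ennreal (?k * ?e y z) * (ennreal (accept h y z) * F y z) \<partial>lborel \<partial>gibbs U)"
    by (intro nn_integral_cong nn_integral_proposal h) measurable
  also have "\<dots> = (\<integral>\<^sup>+ y. ennreal (exp (- U y)) * (\<integral>\<^sup>+ z. ennreal (?k * ?e y z) * (ennreal (accept h y z) * F y z) \<partial>lborel) \<partial>lborel) / Z"
    by (rule nn_integral_gibbs) measurable
  also have "(\<integral>\<^sup>+ y. ennreal (exp (- U y)) * (\<integral>\<^sup>+ z. ennreal (?k * ?e y z) * (ennreal (accept h y z) * F y z) \<partial>lborel) \<partial>lborel)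
     = (\<integral>\<^sup>+ y. \<integral>\<^sup>+ z. ennreal (exp (- U y)) * (ennreal (?k * ?e y z) * (ennreal (accept h y z) * F y z)) \<partial>lborel \<partial>lborel)"
    by (intro nn_integral_cong nn_integral_cmult[symmetric]) measurable
  also have "\<dots> = (\<integral>\<^sup>+ y. \<integral>\<^sup>+ z. ennreal (?k * (exp (- act h y z) * accept h y z)) * F y z \<partial>lborel \<partial>lborel)"
  proof (intro nn_integral_cong)
    fix y z
    have "exp (- U y) * ?e y z = exp (- act h y z)"
      by (simp add: act_def mult_exp_exp)
    from arg_cong[OF this, of "\<lambda>u. u * ?k * accept h y z"]
    have "exp (- U y) * (?k * ?e y z) * accept h y z = ?k * (exp (- act h y z) * accept h y z)"
      by (simp only: mult_ac)
    then have "ennreal (exp (- U y)) * ennreal (?k * ?e y z) * ennreal (accept h y z) = ennreal (?k * (exp (- act h y z) * accept h y z))"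
      using k accept_bounds[of h y z] by (simp flip: ennreal_mult)
    then show "ennreal (exp (- U y)) * (ennreal (?k * ?e y z) * (ennreal (accept h y z) * F y z)) = ennreal (?k * (exp (- act h y z) * accept h y z)) * F y z"
      by (simp only: mult.assoc[symmetric])
  qed
  finally show ?thesis .
qed

text \<open>The uniform variable is integrated out. \<open>F\<close> also receives the proposal:
  invariance ignores it, the one-step error compares it with the new point.\<close>

lemma nn_integral_mala:
  assumes F: "(\<lambda>p. F (fst p) (snd p)) \<in> borel_measurable (borel \<Otimes>\<^sub>M borel)"
  shows "(\<integral>\<^sup>+ n. F (mala h y n) (proposal h y (fst n)) \<partial>noise)
     = (\<integral>\<^sup>+ w. ennreal (accept h y (proposal h y w)) * F (proposal h y w) (proposal h y w)
         + ennreal (1 - accept h y (proposal h y w)) * F y (proposal h y w) \<partial>isotropic_gaussian 0 2)"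
proof -
  note [measurable (raw)] = measurable_uncurry[OF F]
  have [measurable]: "fst \<in> borel_measurable (borel :: ('a \<times> real) measure)"
    unfolding borel_prod[symmetric] by measurable
  have m: "(\<lambda>n. F (mala h y n) (proposal h y (fst n))) \<in> borel_measurable borel"
    by measurable
  have "(\<integral>\<^sup>+ n. F (mala h y n) (proposal h y (fst n)) \<partial>noise)
     = (\<integral>\<^sup>+ w. \<integral>\<^sup>+ u. (if u < accept h y (proposal h y w) then F (proposal h y w) (proposal h y w) else F y (proposal h y w)) \<partial>uniform01 \<partial>isotropic_gaussian 0 2)"
    by (subst nn_integral_noise[OF m]) (intro nn_integral_cong, simp add: mala_def)
  also have "\<dots> = (\<integral>\<^sup>+ w. ennreal (accept h y (proposal h y w)) * F (proposal h y w) (proposal h y w)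
         + ennreal (1 - accept h y (proposal h y w)) * F y (proposal h y w) \<partial>isotropic_gaussian 0 2)"
    by (intro nn_integral_cong nn_integral_uniform01_if accept_bounds)
  finally show ?thesis .
qed

text \<open>Exchanging y and z under the symmetric density moves the accepted mass from the target
  back to the source, where the rejected mass completes it to the full mass.\<close>

lemma mala_preserves_gibbs:
  assumes h: "h > 0" and [measurable]: "f \<in> borel_measurable borel"
  shows "(\<integral>\<^sup>+ y. \<integral>\<^sup>+ n. f (mala h y n) \<partial>noise \<partial>gibbs U) = (\<integral>\<^sup>+ y. f y \<partial>gibbs U)"
proof -
  interpret N: prob_space "isotropic_gaussian (0::'a) 2" by (rule prob_space_isotropic_gaussian) simp
  let ?N = "isotropic_gaussian (0::'a) 2"
  let ?k = "1 / sqrt (4 * pi * h) ^ DIM('a)"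
  let ?a = "\<lambda>y w. accept h y (proposal h y w)"
  have "(\<integral>\<^sup>+ y. \<integral>\<^sup>+ w. ennreal (?a y w) * f (proposal h y w) \<partial>?N \<partial>gibbs U)
     = (\<integral>\<^sup>+ y. \<integral>\<^sup>+ z. ennreal (?k * (exp (- act h y z) * accept h y z)) * f z \<partial>lborel \<partial>lborel) / Z"
    by (rule nn_integral_accepted_proposal[OF h, of "\<lambda>y z. f z"]) measurable
  also have "(\<integral>\<^sup>+ y. \<integral>\<^sup>+ z. ennreal (?k * (exp (- act h y z) * accept h y z)) * f z \<partial>lborel \<partial>lborel)
     = (\<integral>\<^sup>+ z. \<integral>\<^sup>+ y. ennreal (?k * (exp (- act h y z) * accept h y z)) * f z \<partial>lborel \<partial>lborel)"
    by (rule lborel_pair.Fubini') measurable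
  also have "\<dots> = (\<integral>\<^sup>+ z. \<integral>\<^sup>+ y. ennreal (?k * (exp (- act h z y) * accept h z y)) * f z \<partial>lborel \<partial>lborel)"
    by (subst detailed_balance) rule
  also have "\<dots> / Z = (\<integral>\<^sup>+ y. \<integral>\<^sup>+ w. ennreal (?a y w) * f y \<partial>?N \<partial>gibbs U)"
    by (rule nn_integral_accepted_proposal[OF h, of "\<lambda>y z. f y", symmetric]) measurable
  finally have swap: "(\<integral>\<^sup>+ y. \<integral>\<^sup>+ w. ennreal (?a y w) * f (proposal h y w) \<partial>?N \<partial>gibbs U)
     = (\<integral>\<^sup>+ y. \<integral>\<^sup>+ w. ennreal (?a y w) * f y \<partial>?N \<partial>gibbs U)" .
  have "(\<integral>\<^sup>+ y. \<integral>\<^sup>+ n. f (mala h y n) \<partial>noise \<partial>gibbs U)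
    = (\<integral>\<^sup>+ y. \<integral>\<^sup>+ w. ennreal (?a y w) * f (proposal h y w) + ennreal (1 - ?a y w) * f y \<partial>?N \<partial>gibbs U)"
    using nn_integral_mala[of "\<lambda>z _. f z"] by (intro nn_integral_cong) simp
  also have "\<dots> = (\<integral>\<^sup>+ y. (\<integral>\<^sup>+ w. ennreal (?a y w) * f (proposal h y w) \<partial>?N) + (\<integral>\<^sup>+ w. ennreal (1 - ?a y w) * f y \<partial>?N) \<partial>gibbs U)"
    by (intro nn_integral_cong nn_integral_add) measurable
  also have "\<dots> = (\<integral>\<^sup>+ y. \<integral>\<^sup>+ w. ennreal (?a y w) * f y \<partial>?N \<partial>gibbs U) + (\<integral>\<^sup>+ y. \<integral>\<^sup>+ w. ennreal (1 - ?a y w) * f y \<partial>?N \<partial>gibbs U)"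
    unfolding swap[symmetric] by (intro nn_integral_add) measurable
  also have "\<dots> = (\<integral>\<^sup>+ y. (\<integral>\<^sup>+ w. ennreal (?a y w) * f y \<partial>?N) + (\<integral>\<^sup>+ w. ennreal (1 - ?a y w) * f y \<partial>?N) \<partial>gibbs U)"
    by (intro nn_integral_add[symmetric]) measurable
  also have "\<dots> = (\<integral>\<^sup>+ y. \<integral>\<^sup>+ w. ennreal (?a y w) * f y + ennreal (1 - ?a y w) * f y \<partial>?N \<partial>gibbs U)"
    by (intro nn_integral_cong nn_integral_add[symmetric]) measurable
  also have "\<dots> = (\<integral>\<^sup>+ y. \<integral>\<^sup>+ w. f y \<partial>?N \<partial>gibbs U)"
    using accept_bounds by (intro nn_integral_cong) (simp flip: distrib_right ennreal_plus)
  also have "\<dots> = (\<integral>\<^sup>+ y. f y \<partial>gibbs U)"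
    using N.emeasure_space_1 by simp
  finally show ?thesis .
qed

section \<open>Rejection probability and one-step error\<close>

text \<open>When the squares are expanded, the terms |z - y|^2 / (4 h) cancel; there remain the
  trapezoidal error and h / 4 times the difference of the squared gradient norms.\<close>

lemma act_diff:
  assumes h: "h > 0"
  shows "\<bar>act h y z - act h z y\<bar> \<le> Lt / 2 * norm (z - y) ^ 3 + h / 4 * (L * norm (z - y) * (2 * norm (g y) + L * norm (z - y)))"
proof -
  have sq: "(norm (v + h *\<^sub>R a))\<^sup>2 = (norm v)\<^sup>2 + 2 * h * (v \<bullet> a) + h\<^sup>2 * (norm a)\<^sup>2" for v a
    unfolding power2_norm_eq_inner by (simp add: inner_add_left inner_add_right inner_commute power2_eq_square)
  have "act h z y - act h y z = (U z - U y - (z - y) \<bullet> (g z + g y) / 2) + h / 4 * ((norm (g z))\<^sup>2 - (norm (g y))\<^sup>2)"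
    unfolding act_def sq using h
    by (simp add: norm_minus_commute[of y z] inner_diff_left inner_add_right add_divide_distrib diff_divide_distrib power2_eq_square algebra_simps)
  moreover have "\<bar>(norm (g z))\<^sup>2 - (norm (g y))\<^sup>2\<bar> \<le> L * norm (z - y) * (2 * norm (g y) + L * norm (z - y))"
  proof -
    have 1: "\<bar>norm (g z) - norm (g y)\<bar> \<le> L * norm (z - y)"
      using norm_triangle_ineq3[of "g z" "g y"] Lipschitz[of z y] by linarith
    then have 2: "norm (g z) + norm (g y) \<le> 2 * norm (g y) + L * norm (z - y)" by linarith
    have "\<bar>(norm (g z))\<^sup>2 - (norm (g y))\<^sup>2\<bar> = \<bar>norm (g z) - norm (g y)\<bar> * (norm (g z) + norm (g y))"
      using abs_mult[of "norm (g z) - norm (g y)" "norm (g z) + norm (g y)"]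
      by (simp add: power2_eq_square square_diff_square_factored mult.commute)
    also have "\<dots> \<le> L * norm (z - y) * (2 * norm (g y) + L * norm (z - y))"
      using 1 2 L_pos by (intro mult_mono) auto
    finally show ?thesis .
  qed
  then have "\<bar>h / 4 * ((norm (g z))\<^sup>2 - (norm (g y))\<^sup>2)\<bar> \<le> h / 4 * (L * norm (z - y) * (2 * norm (g y) + L * norm (z - y)))"
    using h by (simp only: abs_mult) (intro mult_mono, auto)
  ultimately show ?thesis using trapezoid[of z y] by linarith
qed

lemma reject_bound: "1 - accept h y z \<le> \<bar>act h y z - act h z y\<bar>"
  using exp_ge_add_one_self[of "act h y z - act h z y"] unfolding accept_def by linarith

text \<open>A rejection, of probability O(h^(3/2)), costs |z - y|^2, of order h. Powers of Q = |g y|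
  + |w| are traded for exp Q, whose expectation factorises because y and w are independent.\<close>

lemma mala_error_pointwise:
  fixes y w :: 'a
  assumes h: "0 < h" "h \<le> 1"
  defines "z \<equiv> proposal h y w"
  shows "(1 - accept h y z) * (norm (y - z))\<^sup>2 \<le> h\<^sup>2 * sqrt h * ((1563 * Lt + 256 * (L / 2 + L\<^sup>2 / 4)) * exp (norm (g y) + norm w))"
proof -
  define Q where "Q = norm (g y) + norm w"
  define s where "s = sqrt h"
  have s: "0 < s" "s \<le> 1" "h = s * s" using h by (auto simp: s_def)
  have Q: "0 \<le> Q" "norm (g y) \<le> Q" by (auto simp: Q_def)
  have "norm (z - y) \<le> h * norm (g y) + s * norm w"
    using norm_triangle_ineq4[of "s *\<^sub>R w" "h *\<^sub>R g y"] h s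
    by (simp add: z_def proposal_def s_def[symmetric] algebra_simps)
  also have "\<dots> \<le> s * Q" unfolding Q_def s(3) using s by (simp add: distrib_left mult_left_le mult_right_mono)
  finally have q: "norm (z - y) \<le> s * Q" .
  have "\<bar>act h y z - act h z y\<bar> \<le> Lt / 2 * (s * Q) ^ 3 + h / 4 * (L * (s * Q) * (2 * Q + L * Q))"
  proof (rule order_trans[OF act_diff[OF h(1)]])
    have "s * Q \<le> Q" using s Q by (simp add: mult_left_le_one_le)
    then have "L * norm (z - y) \<le> L * Q" using q L_pos by (intro mult_left_mono) auto
    then show "Lt / 2 * norm (z - y) ^ 3 + h / 4 * (L * norm (z - y) * (2 * norm (g y) + L * norm (z - y)))
      \<le> Lt / 2 * (s * Q) ^ 3 + h / 4 * (L * (s * Q) * (2 * Q + L * Q))"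
      using Lt_nonneg L_pos h q Q s by (intro add_mono mult_mono power_mono mult_nonneg_nonneg add_nonneg_nonneg) auto
  qed
  with reject_bound[of h y z] have "1 - accept h y z \<le> Lt / 2 * (s * Q) ^ 3 + h / 4 * (L * (s * Q) * (2 * Q + L * Q))" by linarith
  moreover have "(norm (y - z))\<^sup>2 \<le> (s * Q)\<^sup>2" using q by (intro power_mono) (auto simp: norm_minus_commute)
  ultimately have "(1 - accept h y z) * (norm (y - z))\<^sup>2 \<le> (Lt / 2 * (s * Q) ^ 3 + h / 4 * (L * (s * Q) * (2 * Q + L * Q))) * (s * Q)\<^sup>2"
    using accept_bounds(2)[of h y z] Lt_nonneg L_pos h Q s by (intro mult_mono) auto
  also have "\<dots> = s ^ 5 * (Lt / 2 * Q ^ 5 + (L / 2 + L\<^sup>2 / 4) * Q ^ 4)"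
    unfolding s(3) by (simp add: power2_eq_square power3_eq_cube eval_nat_numeral field_simps)
  \<comment> \<open>By x^n <= n^n exp x, with 3125 = 5^5 and 256 = 4^4; below, 1563 rounds up 3125 /
    2.\<close>
  also have "\<dots> \<le> s ^ 5 * (Lt / 2 * (3125 * exp Q) + (L / 2 + L\<^sup>2 / 4) * (256 * exp Q))"
    using power_le_exp[OF Q(1), of 5] power_le_exp[OF Q(1), of 4] Lt_nonneg L_pos s
    by (intro mult_left_mono add_mono) auto
  also have "\<dots> \<le> s ^ 5 * ((1563 * Lt + 256 * (L / 2 + L\<^sup>2 / 4)) * exp Q)"
    using Lt_nonneg s by (intro mult_left_mono) (auto simp: algebra_simps)
  also have "s ^ 5 = h\<^sup>2 * sqrt h" unfolding s_def[symmetric] s(3) using s(1) by (simp add: eval_nat_numeral)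
  finally show ?thesis by (simp add: Q_def)
qed

lemma mala_error_rate:
  obtains K where "K \<ge> 0" "\<And>h. 0 < h \<Longrightarrow> h \<le> 1 \<Longrightarrow>
    (\<integral>\<^sup>+ y. \<integral>\<^sup>+ n. ennreal ((norm (mala h y n - proposal h y (fst n)))\<^sup>2) \<partial>noise \<partial>gibbs U) \<le> ennreal (K * (h\<^sup>2 * sqrt h))"
proof -
  let ?N = "isotropic_gaussian (0::'a) 2"
  define C where "C = 1563 * Lt + 256 * (L / 2 + L\<^sup>2 / 4)"
  have C: "C \<ge> 0" using Lt_nonneg L_pos by (simp add: C_def)
  define E where "E = (\<integral>\<^sup>+ y. ennreal (exp (norm (g y))) \<partial>gibbs U) * (\<integral>\<^sup>+ w. ennreal (exp (1 * norm w)) \<partial>?N)"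
  have E: "E < \<infinity>"
    unfolding E_def using gibbs_exp_gradient isotropic_gaussian_exp_moment[of 2 1, where 'a='a]
    by (simp add: ennreal_mult_less_top)
  have "(\<integral>\<^sup>+ y. \<integral>\<^sup>+ n. ennreal ((norm (mala h y n - proposal h y (fst n)))\<^sup>2) \<partial>noise \<partial>gibbs U)
      \<le> ennreal (C * enn2real E * (h\<^sup>2 * sqrt h))" if h: "0 < h" "h \<le> 1" for h
  proof -
    have "(\<integral>\<^sup>+ y. \<integral>\<^sup>+ n. ennreal ((norm (mala h y n - proposal h y (fst n)))\<^sup>2) \<partial>noise \<partial>gibbs U)
      = (\<integral>\<^sup>+ y. \<integral>\<^sup>+ w. ennreal (1 - accept h y (proposal h y w)) * ennreal ((norm (y - proposal h y w))\<^sup>2) \<partial>?N \<partial>gibbs U)"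
      by (intro nn_integral_cong, subst nn_integral_mala[of "\<lambda>z z'. ennreal ((norm (z - z'))\<^sup>2)"]) auto
    also have "\<dots> \<le> (\<integral>\<^sup>+ y. \<integral>\<^sup>+ w. ennreal (h\<^sup>2 * sqrt h * C) * ennreal (exp (norm (g y))) * ennreal (exp (1 * norm w)) \<partial>?N \<partial>gibbs U)"
    proof (intro nn_integral_mono)
      fix y w
      show "ennreal (1 - accept h y (proposal h y w)) * ennreal ((norm (y - proposal h y w))\<^sup>2)
        \<le> ennreal (h\<^sup>2 * sqrt h * C) * ennreal (exp (norm (g y))) * ennreal (exp (1 * norm w))"
        using mala_error_pointwise[OF h, of y w] accept_bounds(2)[of h y "proposal h y w"] C h unfolding C_def[symmetric]
        by (simp add: exp_add mult_ac flip: ennreal_mult)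
    qed
    also have "\<dots> = ennreal (h\<^sup>2 * sqrt h * C) * E"
      unfolding E_def by (simp add: nn_integral_cmult nn_integral_multc mult.assoc)
    also have "\<dots> = ennreal (C * enn2real E * (h\<^sup>2 * sqrt h))"
    proof -
      obtain e where "E = ennreal e" "0 \<le> e" using E by (cases E) auto
      then show ?thesis using C h by (simp add: mult_ac flip: ennreal_mult)
    qed
    finally show ?thesis .
  qed
  then show thesis using C by (intro that[of "C * enn2real E"]) auto
qed

text \<open>Puts the rate h^(5/2) for the mean square into the form \<eta> h for the L2 norm, which
  adds up to \<eta> \<gamma> over \<gamma> / h steps.\<close>

lemma mala_error:
  assumes "\<eta> > 0"
  obtains h0 where "h0 > 0" "\<And>h. 0 < h \<Longrightarrow> h \<le> h0 \<Longrightarrow>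
    (\<integral>\<^sup>+ y. \<integral>\<^sup>+ n. ennreal ((norm (mala h y n - proposal h y (fst n)))\<^sup>2) \<partial>noise \<partial>gibbs U) \<le> ennreal ((\<eta> * h)\<^sup>2)"
proof -
  obtain K where K: "K \<ge> 0" "\<And>h. 0 < h \<Longrightarrow> h \<le> 1 \<Longrightarrow>
    (\<integral>\<^sup>+ y. \<integral>\<^sup>+ n. ennreal ((norm (mala h y n - proposal h y (fst n)))\<^sup>2) \<partial>noise \<partial>gibbs U) \<le> ennreal (K * (h\<^sup>2 * sqrt h))"
    using mala_error_rate by blast
  \<comment> \<open>Ensures K sqrt h <= \<eta>^2, with K + 1 in place of K to avoid a division by 0,
    and h <= 1, where the rate holds.\<close>
  define h0 where "h0 = min 1 ((\<eta>\<^sup>2 / (K + 1))\<^sup>2)"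
  show thesis
  proof (rule that)
    show "h0 > 0" using assms K by (simp add: h0_def)
    fix h assume h: "0 < h" "h \<le> h0"
    have "sqrt h \<le> \<eta>\<^sup>2 / (K + 1)" using h K unfolding h0_def by (intro real_le_lsqrt) auto
    then have "(K + 1) * sqrt h \<le> \<eta>\<^sup>2" using K by (simp add: field_simps)
    moreover have "0 \<le> sqrt h" using h by simp
    ultimately have "K * sqrt h \<le> \<eta>\<^sup>2" unfolding distrib_right by linarith
    then have "h\<^sup>2 * (K * sqrt h) \<le> h\<^sup>2 * \<eta>\<^sup>2" by (intro mult_left_mono) auto
    then have "K * (h\<^sup>2 * sqrt h) \<le> (\<eta> * h)\<^sup>2" by (simp add: power_mult_distrib mult_ac)
    then have "ennreal (K * (h\<^sup>2 * sqrt h)) \<le> ennreal ((\<eta> * h)\<^sup>2)" by (rule ennreal_leI)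
    moreover have "h \<le> 1" using h by (simp add: h0_def)
    ultimately show "(\<integral>\<^sup>+ y. \<integral>\<^sup>+ n. ennreal ((norm (mala h y n - proposal h y (fst n)))\<^sup>2) \<partial>noise \<partial>gibbs U) \<le> ennreal ((\<eta> * h)\<^sup>2)"
      using K(2) h by (meson order_trans)
  qed
qed

end

section \<open>The coupled chain\<close>

lemma borel_measurable_fst_comp [measurable (raw)]:
  fixes f :: "'s \<Rightarrow> 'a::second_countable_topology \<times> 'b::second_countable_topology"
  shows "f \<in> borel_measurable M \<Longrightarrow> (\<lambda>x. fst (f x)) \<in> borel_measurable M"
  unfolding borel_prod[symmetric] by (rule measurable_compose[OF _ measurable_fst])

lemma borel_measurable_snd_comp [measurable (raw)]:
  fixes f :: "'s \<Rightarrow> 'a::second_countable_topology \<times> 'b::second_countable_topology"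
  shows "f \<in> borel_measurable M \<Longrightarrow> (\<lambda>x. snd (f x)) \<in> borel_measurable M"
  unfolding borel_prod[symmetric] by (rule measurable_compose[OF _ measurable_snd])

lemma nn_integral_noise_norm:
  "(\<integral>\<^sup>+ n. ennreal ((norm (fst n))\<^sup>2) \<partial>(noise :: ('a::euclidean_space \<times> real) measure)) = ennreal (2 * real DIM('a))"
proof -
  interpret u: prob_space uniform01 by (rule prob_space_uniform01)
  show ?thesis using isotropic_gaussian_second_moment[of 2, where 'a='a]
    by (subst nn_integral_noise) (auto simp: u.emeasure_space_1[simplified] mult.commute)
qed

lemma distr_noise_reflect:
  "distr noise noise (\<lambda>n. (- fst n, snd n)) = (noise :: ('a::euclidean_space \<times> real) measure)"
proof -
  let ?N = "isotropic_gaussian (0::'a) 2"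
  interpret u: prob_space uniform01 by (rule prob_space_uniform01)
  have N: "distr ?N ?N uminus = ?N"
  proof -
    have "distr ?N ?N uminus = distr ?N borel (\<lambda>w. 0 + (-1) *\<^sub>R w)"
      by (rule distr_cong) auto
    also have "\<dots> = ?N" by (subst distr_isotropic_gaussian_affine) auto
    finally show ?thesis .
  qed
  have "distr ?N ?N uminus \<Otimes>\<^sub>M distr uniform01 uniform01 (\<lambda>u. u)
      = distr (?N \<Otimes>\<^sub>M uniform01) (?N \<Otimes>\<^sub>M uniform01) (\<lambda>(w, u). (- w, u))"
    by (rule pair_measure_distr) (auto simp: distr_id2 u.sigma_finite_measure_axioms)
  then show ?thesis
    unfolding N noise_def by (simp add: distr_id2 case_prod_unfold)
qed

lemma integral_noise_reflect:
  fixes f :: "_ \<Rightarrow> real"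
  assumes [measurable]: "f \<in> borel_measurable (M \<Otimes>\<^sub>M noise)"
  shows "(\<integral>z. f (fst z, (- fst (snd z), snd (snd z))) \<partial>(M \<Otimes>\<^sub>M noise)) = (\<integral>z. f z \<partial>(M \<Otimes>\<^sub>M noise))"
    and "integrable (M \<Otimes>\<^sub>M noise) f \<Longrightarrow> integrable (M \<Otimes>\<^sub>M noise) (\<lambda>z. f (fst z, (- fst (snd z), snd (snd z))))"
proof -
  let ?R = "\<lambda>z. (fst z, (- fst (snd z), snd (snd z)))"
  interpret n: prob_space noise by (rule prob_space_noise)
  have R[measurable]: "?R \<in> measurable (M \<Otimes>\<^sub>M noise) (M \<Otimes>\<^sub>M noise)" by measurable
  have "distr M M (\<lambda>x. x) \<Otimes>\<^sub>M distr noise noise (\<lambda>n. (- fst n, snd n)) = distr (M \<Otimes>\<^sub>M noise) (M \<Otimes>\<^sub>M noise) (\<lambda>(x, n). (x, (- fst n, snd n)))"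
    by (rule pair_measure_distr) (auto simp: distr_noise_reflect n.sigma_finite_measure_axioms)
  then have D: "M \<Otimes>\<^sub>M noise = distr (M \<Otimes>\<^sub>M noise) (M \<Otimes>\<^sub>M noise) ?R"
    by (simp add: distr_noise_reflect distr_id2 case_prod_unfold)
  show "(\<integral>z. f (?R z) \<partial>(M \<Otimes>\<^sub>M noise)) = (\<integral>z. f z \<partial>(M \<Otimes>\<^sub>M noise))"
    by (subst (2) D, subst integral_distr) auto
  show "integrable (M \<Otimes>\<^sub>M noise) (\<lambda>z. f (?R z))" if "integrable (M \<Otimes>\<^sub>M noise) f"
    using that by (subst (asm) D) (simp add: integrable_distr_eq)
qed

lemma integral_pair_fst:
  fixes f :: "_ \<Rightarrow> real"
  assumes "prob_space N" "f \<in> borel_measurable M"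
  shows "(\<integral>z. f (fst z) \<partial>(M \<Otimes>\<^sub>M N)) = (\<integral>x. f x \<partial>M)"
  using integral_distr[of fst "M \<Otimes>\<^sub>M N" M f] assms by (simp add: prob_space.distr_pair_fst)

text \<open>One step of the comparison of a left Riemann sum of the square root with its integral.
  With a = sqrt t and b = sqrt(t + h) the gap is (b - a)^2 (2 b + a) / 3.\<close>

lemma integral_sqrt_step:
  fixes t h :: real
  assumes "0 \<le> t" "0 < h"
  shows "2 / 3 * (t * sqrt t) + h * sqrt t \<le> 2 / 3 * ((t + h) * sqrt (t + h))"
proof -
  define a b where "a = sqrt t" and "b = sqrt (t + h)"
  have ab: "0 \<le> a" "a \<le> b" "t = a\<^sup>2" "t + h = b\<^sup>2" using assms by (auto simp: a_def b_def)
  then have h: "h = b\<^sup>2 - a\<^sup>2" by simp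
  have "0 \<le> (b - a)\<^sup>2 * (2 * b + a)" using ab by auto
  then have "2 / 3 * (a\<^sup>2 * a) + h * a \<le> 2 / 3 * (b\<^sup>2 * b)"
    unfolding h by (simp add: power2_eq_square algebra_simps)
  moreover have "a\<^sup>2 * a = t * sqrt t" "b\<^sup>2 * b = (t + h) * sqrt (t + h)"
    unfolding ab(3)[symmetric] ab(4)[symmetric] by (simp_all add: a_def b_def)
  ultimately show ?thesis unfolding a_def[symmetric] by simp
qed

context strongly_convex_potential
begin

text \<open>A state \<open>(p, y, s)\<close> records the initial pair \<open>p = (y\<^sub>0, x\<^sub>0)\<close>, the current point \<open>y\<close> of the
  Metropolis-adjusted chain started at \<open>y\<^sub>0\<close>, and the sum \<open>s\<close> of the Gaussian increments used so
  far, which also drives the Euler step from \<open>x\<^sub>0\<close>.\<close>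

definition chain_step :: "real \<Rightarrow> (('a \<times> 'a) \<times> ('a \<times> 'a)) \<times> ('a \<times> real) \<Rightarrow> ('a \<times> 'a) \<times> ('a \<times> 'a)" where
  "chain_step h z = (fst (fst z), (mala h (fst (snd (fst z))) (snd z), snd (snd (fst z)) + sqrt h *\<^sub>R fst (snd z)))"

text \<open>Only laws matter, so the chain is a sequence of measures; the product with
  \<open>noise\<close> makes each increment independent of the whole current state, including the
  initial pair.\<close>

primrec chain :: "real \<Rightarrow> ('a \<times> 'a) measure \<Rightarrow> nat \<Rightarrow> (('a \<times> 'a) \<times> ('a \<times> 'a)) measure" where
  "chain h \<zeta> 0 = distr \<zeta> borel (\<lambda>p. (p, (fst p, 0)))"
| "chain h \<zeta> (Suc j) = distr (chain h \<zeta> j \<Otimes>\<^sub>M noise) borel (chain_step h)"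

lemma sets_chain [simp, measurable_cong]: "sets (chain h \<zeta> j) = sets borel"
  by (cases j) auto

lemma space_chain [simp]: "space (chain h \<zeta> j) = UNIV"
  by (cases j) auto

lemma measurable_chain_step [measurable]: "chain_step h \<in> borel_measurable (chain h \<zeta> j \<Otimes>\<^sub>M noise)"
  unfolding chain_step_def by measurable

text \<open>The bound of \<open>l2_bound_gibbs_gradient\<close>, valid at every time of the chain by
  invariance.\<close>

definition G :: real where "G = sqrt (real DIM('a) * L)"

lemma G_nonneg: "G \<ge> 0" using L_pos by (simp add: G_def)

context
  fixes h :: real and \<zeta> :: "('a \<times> 'a) measure"
  assumes h_pos: "h > 0" and prob_\<zeta>: "prob_space \<zeta>" and sets_\<zeta> [simp, measurable_cong]: "sets \<zeta> = sets borel"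
    and marginal: "distr \<zeta> borel fst = gibbs U"
begin

lemma space_\<zeta> [simp]: "space \<zeta> = UNIV"
  using sets_eq_imp_space_eq[OF sets_\<zeta>] by simp

lemma prob_space_chain: "prob_space (chain h \<zeta> j)"
proof (induction j)
  case 0
  show ?case by (simp, rule prob_space.prob_space_distr[OF prob_\<zeta>]) measurable
next
  case (Suc j)
  interpret c: prob_space "chain h \<zeta> j" by fact
  interpret n: prob_space noise by (rule prob_space_noise)
  interpret pair_prob_space "chain h \<zeta> j" noise ..
  show ?case by (simp, rule prob_space_distr) measurable
qed

section \<open>Laws of the components of the chain\<close>

lemma chain_law_initial:
  assumes [measurable]: "f \<in> borel_measurable borel"
  shows "(\<integral>\<^sup>+ x. f (fst x) \<partial>chain h \<zeta> j) = (\<integral>\<^sup>+ p. f p \<partial>\<zeta>)"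
proof (induction j)
  case 0 show ?case by (simp add: nn_integral_distr)
next
  case (Suc j)
  have "(\<integral>\<^sup>+ x. f (fst x) \<partial>chain h \<zeta> (Suc j)) = (\<integral>\<^sup>+ z. f (fst (fst z)) \<partial>(chain h \<zeta> j \<Otimes>\<^sub>M (noise :: ('a \<times> real) measure)))"
    by (simp add: nn_integral_distr) (simp add: chain_step_def)
  also have "\<dots> = (\<integral>\<^sup>+ x. f (fst x) \<partial>chain h \<zeta> j)"
    by (rule nn_integral_pair_fst[OF prob_space_noise, of "\<lambda>x. f (fst x)"]) measurable
  finally show ?case using Suc by simp
qed

lemma nn_integral_chain_noise:
  assumes [measurable]: "f \<in> borel_measurable (borel \<Otimes>\<^sub>M borel)"
  shows "(\<integral>\<^sup>+ z. f z \<partial>(chain h \<zeta> j \<Otimes>\<^sub>M noise)) = (\<integral>\<^sup>+ x. \<integral>\<^sup>+ n. f (x, n) \<partial>noise \<partial>chain h \<zeta> j)"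
proof -
  interpret n: prob_space noise by (rule prob_space_noise)
  show ?thesis by (rule n.nn_integral_fst[symmetric]) measurable
qed

lemma chain_stationary:
  assumes [measurable]: "f \<in> borel_measurable borel"
  shows "(\<integral>\<^sup>+ x. f (fst (snd x)) \<partial>chain h \<zeta> j) = (\<integral>\<^sup>+ y. f y \<partial>gibbs U)"
  using assms
proof (induction j arbitrary: f)
  case (0 f)
  note [measurable] = 0
  show ?case by (simp add: nn_integral_distr flip: marginal)
next
  case (Suc j f)
  note [measurable] = Suc.prems
  have "(\<integral>\<^sup>+ x. f (fst (snd x)) \<partial>chain h \<zeta> (Suc j)) = (\<integral>\<^sup>+ z. f (mala h (fst (snd (fst z))) (snd z)) \<partial>(chain h \<zeta> j \<Otimes>\<^sub>M noise))"
    by (simp add: nn_integral_distr) (simp add: chain_step_def)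
  also have "\<dots> = (\<integral>\<^sup>+ x. \<integral>\<^sup>+ n. f (mala h (fst (snd x)) n) \<partial>noise \<partial>chain h \<zeta> j)"
    by (subst nn_integral_chain_noise) auto
  also have "\<dots> = (\<integral>\<^sup>+ y. \<integral>\<^sup>+ n. f (mala h y n) \<partial>noise \<partial>gibbs U)"
  proof (rule Suc.IH[of "\<lambda>y. \<integral>\<^sup>+ n. f (mala h y n) \<partial>noise"])
    interpret n: prob_space noise by (rule prob_space_noise)
    show "(\<lambda>y. \<integral>\<^sup>+ n. f (mala h y n) \<partial>noise) \<in> borel_measurable borel" by measurable
  qed
  also have "\<dots> = (\<integral>\<^sup>+ y. f y \<partial>gibbs U)"
    by (rule mala_preserves_gibbs[OF h_pos]) measurable
  finally show ?case .
qed

text \<open>Stated jointly with the initial pair, since the Euler step from x_0 needs an increment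
  independent of x_0. It starts at the first step because \<open>isotropic_gaussian 0 0\<close> is
  the null measure, not a point mass.\<close>

lemma chain_law_increments:
  assumes [measurable]: "F \<in> borel_measurable (borel \<Otimes>\<^sub>M borel)"
  shows "(\<integral>\<^sup>+ x. F (fst x, snd (snd x)) \<partial>chain h \<zeta> (Suc j))
    = (\<integral>\<^sup>+ p. \<integral>\<^sup>+ s. F (p, s) \<partial>isotropic_gaussian 0 (2 * (h * real (Suc j))) \<partial>\<zeta>)"
  using assms
proof (induction j arbitrary: F)
  case (0 F)
  note [measurable] = 0
  interpret n: prob_space noise by (rule prob_space_noise)
  interpret u: prob_space uniform01 by (rule prob_space_uniform01)
  have "(\<integral>\<^sup>+ x. F (fst x, snd (snd x)) \<partial>chain h \<zeta> (Suc 0))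
      = (\<integral>\<^sup>+ z. F (fst (fst z), snd (snd (fst z)) + sqrt h *\<^sub>R fst (snd z)) \<partial>(chain h \<zeta> 0 \<Otimes>\<^sub>M noise))"
    by (subst chain.simps(2), subst nn_integral_distr) (auto simp: chain_step_def simp del: chain.simps)
  also have "\<dots> = (\<integral>\<^sup>+ x. \<integral>\<^sup>+ n. F (fst x, snd (snd x) + sqrt h *\<^sub>R fst n) \<partial>noise \<partial>chain h \<zeta> 0)"
    by (subst nn_integral_chain_noise) auto
  also have "\<dots> = (\<integral>\<^sup>+ p. \<integral>\<^sup>+ n. F (p, sqrt h *\<^sub>R fst n) \<partial>noise \<partial>\<zeta>)"
    by (simp add: nn_integral_distr)
  also have "\<dots> = (\<integral>\<^sup>+ p. \<integral>\<^sup>+ w. F (p, sqrt h *\<^sub>R w) \<partial>isotropic_gaussian 0 2 \<partial>\<zeta>)"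
    by (intro nn_integral_cong) (simp add: nn_integral_noise u.emeasure_space_1[simplified])
  also have "\<dots> = (\<integral>\<^sup>+ p. \<integral>\<^sup>+ s. F (p, s) \<partial>distr (isotropic_gaussian 0 2) borel (\<lambda>w. 0 + sqrt h *\<^sub>R w) \<partial>\<zeta>)"
    by (intro nn_integral_cong) (simp add: nn_integral_distr)
  also have "\<dots> = (\<integral>\<^sup>+ p. \<integral>\<^sup>+ s. F (p, s) \<partial>isotropic_gaussian 0 (2 * (h * real (Suc 0))) \<partial>\<zeta>)"
    using h_pos by (subst distr_isotropic_gaussian_affine) (auto simp: mult.commute)
  finally show ?case .
next
  case (Suc j F)
  note [measurable] = Suc.prems
  interpret n: prob_space noise by (rule prob_space_noise)
  interpret N: prob_space "isotropic_gaussian (0::'a) 2" by (rule prob_space_isotropic_gaussian) simp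
  interpret u: prob_space uniform01 by (rule prob_space_uniform01)
  let ?t = "h * real (Suc j)"
  have t: "?t > 0" using h_pos by simp
  have "(\<integral>\<^sup>+ x. F (fst x, snd (snd x)) \<partial>chain h \<zeta> (Suc (Suc j)))
      = (\<integral>\<^sup>+ z. F (fst (fst z), snd (snd (fst z)) + sqrt h *\<^sub>R fst (snd z)) \<partial>(chain h \<zeta> (Suc j) \<Otimes>\<^sub>M noise))"
    by (subst chain.simps(2), subst nn_integral_distr) (auto simp: chain_step_def simp del: chain.simps)
  also have "\<dots> = (\<integral>\<^sup>+ x. \<integral>\<^sup>+ n. F (fst x, snd (snd x) + sqrt h *\<^sub>R fst n) \<partial>noise \<partial>chain h \<zeta> (Suc j))"
    by (subst nn_integral_chain_noise) auto
  also have "\<dots> = (\<integral>\<^sup>+ x. \<integral>\<^sup>+ w. F (fst x, snd (snd x) + sqrt h *\<^sub>R w) \<partial>isotropic_gaussian 0 2 \<partial>chain h \<zeta> (Suc j))"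
    by (intro nn_integral_cong) (simp add: nn_integral_noise u.emeasure_space_1[simplified] del: chain.simps)
  also have "\<dots> = (\<integral>\<^sup>+ p. \<integral>\<^sup>+ s. \<integral>\<^sup>+ w. F (p, s + sqrt h *\<^sub>R w) \<partial>isotropic_gaussian 0 2 \<partial>isotropic_gaussian 0 (2 * ?t) \<partial>\<zeta>)"
    using Suc.IH[of "\<lambda>q. \<integral>\<^sup>+ w. F (fst q, snd q + sqrt h *\<^sub>R w) \<partial>isotropic_gaussian 0 2"]
    by simp
  also have "\<dots> = (\<integral>\<^sup>+ p. \<integral>\<^sup>+ s. \<integral>\<^sup>+ w. F (p, s + w) \<partial>isotropic_gaussian 0 (2 * h) \<partial>isotropic_gaussian 0 (2 * ?t) \<partial>\<zeta>)"
  proof -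
    have "distr (isotropic_gaussian (0::'a) 2) borel (\<lambda>w. 0 + sqrt h *\<^sub>R w) = isotropic_gaussian 0 (2 * h)"
      using h_pos by (subst distr_isotropic_gaussian_affine) (auto simp: mult.commute)
    then show ?thesis
      by (intro nn_integral_cong) (simp add: nn_integral_distr flip: \<open>distr _ _ _ = isotropic_gaussian _ (2 * h)\<close>)
  qed
  also have "\<dots> = (\<integral>\<^sup>+ p. \<integral>\<^sup>+ s. F (p, s) \<partial>isotropic_gaussian 0 (2 * h + 2 * ?t) \<partial>\<zeta>)"
    using t h_pos by (intro nn_integral_cong isotropic_gaussian_convolution) auto
  also have "2 * h + 2 * ?t = 2 * (h * real (Suc (Suc j)))" by (simp add: algebra_simps)
  finally show ?case .
qed

section \<open>Mean square bounds along the chain\<close>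

lemma l2_bound_chain_Suc:
  assumes [measurable]: "f \<in> borel_measurable borel"
  shows "l2_bound (chain h \<zeta> (Suc j)) f a \<longleftrightarrow> l2_bound (chain h \<zeta> j \<Otimes>\<^sub>M noise) (\<lambda>z. f (chain_step h z)) a"
  by (simp add: l2_bound_distr)

lemma l2_bound_initial:
  assumes A: "l2_bound \<zeta> A a"
  shows "l2_bound (chain h \<zeta> j) (\<lambda>x. A (fst x)) a"
proof -
  have [measurable]: "A \<in> borel_measurable borel" using l2_boundD(1)[OF A] by simp
  show ?thesis using A unfolding l2_bound_def
    by (simp add: chain_law_initial[of "\<lambda>p. ennreal ((norm (A p))\<^sup>2)"])
qed

lemma l2_bound_increments:
  "l2_bound (chain h \<zeta> j) (\<lambda>x. snd (snd x)) (sqrt (2 * real DIM('a)) * sqrt (real j * h))"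
proof (cases j)
  case 0
  then show ?thesis by (simp add: l2_bound_def nn_integral_distr)
next
  case (Suc i)
  interpret z: prob_space \<zeta> by (rule prob_\<zeta>)
  have "(\<integral>\<^sup>+ x. ennreal ((norm (snd (snd x)))\<^sup>2) \<partial>chain h \<zeta> (Suc i))
     = (\<integral>\<^sup>+ p. \<integral>\<^sup>+ s. ennreal ((norm s)\<^sup>2) \<partial>isotropic_gaussian (0::'a) (2 * (h * real (Suc i))) \<partial>\<zeta>)"
    using chain_law_increments[of "\<lambda>q. ennreal ((norm (snd q))\<^sup>2)" i] by (simp del: chain.simps)
  also have "\<dots> = ennreal (real DIM('a) * (2 * (h * real (Suc i))))"
    using h_pos by (subst isotropic_gaussian_second_moment) (auto simp: z.emeasure_space_1[simplified])
  finally show ?thesis using h_pos unfolding Suc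
    by (auto simp: l2_bound_def power_mult_distrib mult_ac simp del: chain.simps)
qed

lemma l2_bound_gradient: "l2_bound (chain h \<zeta> j) (\<lambda>x. g (fst (snd x))) (sqrt (real DIM('a) * L))"
  unfolding l2_bound_def chain_stationary[of "\<lambda>y. ennreal ((norm (g y))\<^sup>2)", simplified]
  using l2_boundD(2,3)[OF l2_bound_gibbs_gradient] by simp

text \<open>Besides invariance, the estimates below use the Metropolis step only through this bound
  on its distance from the proposal.\<close>

context
  fixes \<eta> :: real
  assumes \<eta>_pos: "\<eta> > 0"
    and mala_close: "(\<integral>\<^sup>+ y. \<integral>\<^sup>+ n. ennreal ((norm (mala h y n - proposal h y (fst n)))\<^sup>2) \<partial>noise \<partial>gibbs U) \<le> ennreal ((\<eta> * h)\<^sup>2)"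
begin

text \<open>The current point has law \<open>gibbs U\<close> at every step, so the one-step
  hypothesis applies at all times.\<close>

lemma l2_bound_error:
  "l2_bound (chain h \<zeta> j \<Otimes>\<^sub>M noise) (\<lambda>z. mala h (fst (snd (fst z))) (snd z) - proposal h (fst (snd (fst z))) (fst (snd z))) (h * \<eta>)"
proof -
  interpret n: prob_space noise by (rule prob_space_noise)
  have "(\<integral>\<^sup>+ z. ennreal ((norm (mala h (fst (snd (fst z))) (snd z) - proposal h (fst (snd (fst z))) (fst (snd z))))\<^sup>2) \<partial>(chain h \<zeta> j \<Otimes>\<^sub>M noise))
     = (\<integral>\<^sup>+ x. \<integral>\<^sup>+ n. ennreal ((norm (mala h (fst (snd x)) n - proposal h (fst (snd x)) (fst n)))\<^sup>2) \<partial>noise \<partial>chain h \<zeta> j)"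
    by (subst nn_integral_chain_noise) auto
  also have "\<dots> = (\<integral>\<^sup>+ y. \<integral>\<^sup>+ n. ennreal ((norm (mala h y n - proposal h y (fst n)))\<^sup>2) \<partial>noise \<partial>gibbs U)"
    by (rule chain_stationary) measurable
  also note mala_close
  finally show ?thesis using h_pos \<eta>_pos by (auto simp: l2_bound_def mult.commute)
qed

text \<open>After the noise is subtracted, the displacement is a sum of terms - h g(Y_i) and
  one-step errors, together at most h (G + \<eta>) in L2 per step.\<close>

lemma l2_bound_drift:
  "l2_bound (chain h \<zeta> j) (\<lambda>x. fst (snd x) - fst (fst x) - snd (snd x)) (real j * h * (G + \<eta>))"
proof (induction j)
  case 0 show ?case by (simp add: l2_bound_def nn_integral_distr)
next
  case (Suc j)
  let ?M = "chain h \<zeta> j \<Otimes>\<^sub>M noise"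
  let ?e = "\<lambda>z. mala h (fst (snd (fst z))) (snd z) - proposal h (fst (snd (fst z))) (fst (snd z))"
  have "l2_bound ?M (\<lambda>z. (fst (snd (fst z)) - fst (fst (fst z)) - snd (snd (fst z))) - h *\<^sub>R g (fst (snd (fst z))) + ?e z)
      (real j * h * (G + \<eta>) + \<bar>h\<bar> * G + h * \<eta>)"
    using Suc by (intro l2_bound_add l2_bound_diff l2_bound_scaleR l2_bound_error
      l2_bound_pair_fst[OF prob_space_noise, of _ "\<lambda>x. fst (snd x) - fst (fst x) - snd (snd x)"]
      l2_bound_pair_fst[OF prob_space_noise, of _ "\<lambda>x. g (fst (snd x))"] l2_bound_gradient[folded G_def])
  then show ?case using h_pos
    by (subst l2_bound_chain_Suc) (auto simp: chain_step_def proposal_def algebra_simps)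
qed

lemma l2_bound_displacement:
  "l2_bound (chain h \<zeta> j) (\<lambda>x. fst (snd x) - fst (fst x))
     (real j * h * (G + \<eta>) + sqrt (2 * real DIM('a)) * sqrt (real j * h))"
  using l2_bound_add[OF l2_bound_drift l2_bound_increments, of j] by simp

lemma l2_bound_gradient_increment:
  "l2_bound (chain h \<zeta> j) (\<lambda>x. g (fst (snd x)) - g (fst (fst x)))
     (L * (real j * h * (G + \<eta>) + sqrt (2 * real DIM('a)) * sqrt (real j * h)))"
  by (rule l2_bound_norm_le[OF l2_bound_displacement]) (use Lipschitz L_pos in auto)

text \<open>The error D_j of freezing the gradient satisfies D_(j+1) = D_j - h (g(Y_j) - g(Y_0)) +
  e_j with e_j the Metropolis error. Summing norms compares Riemann sums of t and sqrt t with t^2 /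
  2 and 2/3 t^(3/2).\<close>

lemma l2_bound_discretization:
  defines "t \<equiv> \<lambda>j. real j * h"
  shows "l2_bound (chain h \<zeta> j) (\<lambda>x. fst (snd x) - fst (fst x) + t j *\<^sub>R g (fst (fst x)) - snd (snd x))
     (L * ((t j)\<^sup>2 / 2 * (G + \<eta>) + sqrt (2 * real DIM('a)) * (2 / 3 * (t j * sqrt (t j)))) + t j * \<eta>)"
proof (induction j)
  case 0 show ?case by (simp add: l2_bound_def nn_integral_distr t_def)
next
  case (Suc j)
  let ?M = "chain h \<zeta> j \<Otimes>\<^sub>M noise"
  let ?e = "\<lambda>z. mala h (fst (snd (fst z))) (snd z) - proposal h (fst (snd (fst z))) (fst (snd z))"
  let ?c = "sqrt (2 * real DIM('a))"
  have t: "t j \<ge> 0" "t (Suc j) = t j + h" using h_pos by (auto simp: t_def algebra_simps)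
  have "l2_bound ?M (\<lambda>z. (fst (snd (fst z)) - fst (fst (fst z)) + t j *\<^sub>R g (fst (fst (fst z))) - snd (snd (fst z))) - h *\<^sub>R (g (fst (snd (fst z))) - g (fst (fst (fst z)))) + ?e z)
      (L * ((t j)\<^sup>2 / 2 * (G + \<eta>) + ?c * (2 / 3 * (t j * sqrt (t j)))) + t j * \<eta> + \<bar>h\<bar> * (L * (t j * (G + \<eta>) + ?c * sqrt (t j))) + h * \<eta>)"
    using l2_bound_add[OF l2_bound_diff[OF
      l2_bound_pair_fst[OF prob_space_noise Suc] l2_bound_scaleR[of _ _ _ h, OF
      l2_bound_pair_fst[OF prob_space_noise l2_bound_gradient_increment]]] l2_bound_error]
    by (simp only: t_def)
  then have "l2_bound (chain h \<zeta> (Suc j)) (\<lambda>x. fst (snd x) - fst (fst x) + t (Suc j) *\<^sub>R g (fst (fst x)) - snd (snd x))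
      (L * ((t j)\<^sup>2 / 2 * (G + \<eta>) + ?c * (2 / 3 * (t j * sqrt (t j)))) + t j * \<eta> + \<bar>h\<bar> * (L * (t j * (G + \<eta>) + ?c * sqrt (t j))) + h * \<eta>)"
    unfolding t by (subst l2_bound_chain_Suc) (auto simp: chain_step_def proposal_def algebra_simps)
  then show ?case
  proof (rule l2_bound_mono)
    have 1: "(t j)\<^sup>2 / 2 * (G + \<eta>) + h * (t j * (G + \<eta>)) \<le> (t j + h)\<^sup>2 / 2 * (G + \<eta>)"
    proof -
      have "((t j)\<^sup>2 / 2 + h * t j) * (G + \<eta>) \<le> ((t j + h)\<^sup>2 / 2) * (G + \<eta>)"
        using G_nonneg \<eta>_pos by (intro mult_right_mono) (auto simp: power2_eq_square algebra_simps add_divide_distrib)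
      then show ?thesis by (simp add: algebra_simps)
    qed
    have "?c * (2 / 3 * (t j * sqrt (t j)) + h * sqrt (t j)) \<le> ?c * (2 / 3 * ((t j + h) * sqrt (t j + h)))"
      using integral_sqrt_step[OF t(1) h_pos] by (intro mult_left_mono) auto
    then have "?c * (2 / 3 * (t j * sqrt (t j))) + h * (?c * sqrt (t j)) \<le> ?c * (2 / 3 * ((t j + h) * sqrt (t j + h)))"
      by (simp add: algebra_simps)
    with 1 have "L * (((t j)\<^sup>2 / 2 * (G + \<eta>) + h * (t j * (G + \<eta>))) + (?c * (2 / 3 * (t j * sqrt (t j))) + h * (?c * sqrt (t j))))
      \<le> L * ((t j + h)\<^sup>2 / 2 * (G + \<eta>) + ?c * (2 / 3 * ((t j + h) * sqrt (t j + h))))"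
      using L_pos by (intro mult_left_mono add_mono) auto
    moreover have "L * ((t j)\<^sup>2 / 2 * (G + \<eta>) + ?c * (2 / 3 * (t j * sqrt (t j)))) + t j * \<eta> + \<bar>h\<bar> * (L * (t j * (G + \<eta>) + ?c * sqrt (t j))) + h * \<eta>
      = L * (((t j)\<^sup>2 / 2 * (G + \<eta>) + h * (t j * (G + \<eta>))) + (?c * (2 / 3 * (t j * sqrt (t j))) + h * (?c * sqrt (t j)))) + (t j + h) * \<eta>"
      using h_pos by (simp add: algebra_simps)
    ultimately show "L * ((t j)\<^sup>2 / 2 * (G + \<eta>) + ?c * (2 / 3 * (t j * sqrt (t j)))) + t j * \<eta> + \<bar>h\<bar> * (L * (t j * (G + \<eta>) + ?c * sqrt (t j))) + h * \<eta>
       \<le> L * ((t (Suc j))\<^sup>2 / 2 * (G + \<eta>) + ?c * (2 / 3 * (t (Suc j) * sqrt (t (Suc j))))) + t (Suc j) * \<eta>"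
      unfolding t(2) by linarith
  qed
qed

section \<open>Inner products with functions of the initial pair\<close>

text \<open>Reflecting the new increment w preserves the law and fixes the current state; adding
  both integrands gives a second difference, at most Lt h |w|^2. As w is independent of the initial
  pair and E |w|^2 = 2 d, half of the sum gives h d Lt.\<close>

lemma noise_increment_inner:
  assumes A: "l2_bound \<zeta> A a"
  defines "f \<equiv> \<lambda>z. A (fst (fst z)) \<bullet> (g (fst (snd (fst z)) + sqrt h *\<^sub>R fst (snd z)) - g (fst (snd (fst z))))"
  shows "integrable (chain h \<zeta> j \<Otimes>\<^sub>M noise) f"
    and "\<bar>\<integral>z. f z \<partial>(chain h \<zeta> j \<Otimes>\<^sub>M noise)\<bar> \<le> a * (h * (real DIM('a) * Lt))"
proof -
  let ?M = "chain h \<zeta> j \<Otimes>\<^sub>M (noise :: ('a \<times> real) measure)"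
  interpret c: prob_space "chain h \<zeta> j" by (rule prob_space_chain)
  have [measurable]: "A \<in> borel_measurable borel" using l2_boundD(1)[OF A] by simp
  have Am: "l2_bound ?M (\<lambda>z. A (fst (fst z))) a"
    by (rule l2_bound_pair_fst[OF prob_space_noise, of _ "\<lambda>x. A (fst x)"]) (rule l2_bound_initial[OF A])
  have w: "l2_bound ?M (\<lambda>z. fst (snd z)) (sqrt (2 * real DIM('a)))"
    unfolding l2_bound_def by (simp add: nn_integral_chain_noise nn_integral_noise_norm c.emeasure_space_1[simplified])
  have "l2_bound ?M (\<lambda>z. g (fst (snd (fst z)) + sqrt h *\<^sub>R fst (snd z)) - g (fst (snd (fst z)))) (L * sqrt h * sqrt (2 * real DIM('a)))"
  proof (rule l2_bound_norm_le[OF w])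
    fix z :: "(('a \<times> 'a) \<times> ('a \<times> 'a)) \<times> ('a \<times> real)"
    show "norm (g (fst (snd (fst z)) + sqrt h *\<^sub>R fst (snd z)) - g (fst (snd (fst z)))) \<le> L * sqrt h * norm (fst (snd z))"
      using Lipschitz[of "fst (snd (fst z)) + sqrt h *\<^sub>R fst (snd z)" "fst (snd (fst z))"] h_pos by simp
  qed (use L_pos h_pos in auto)
  from l2_bound_inner(1)[OF Am this] show int: "integrable ?M f" unfolding f_def .
  let ?R = "\<lambda>z. (fst z, (- fst (snd z), snd (snd z)))"
  have [measurable]: "f \<in> borel_measurable ?M" using int by (rule borel_measurable_integrable)
  note intR = integral_noise_reflect(2)[OF _ int]
  have sum: "integrable ?M (\<lambda>z. f z + f (?R z))" using int intR by (rule Bochner_Integration.integrable_add) auto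
  have "2 * (\<integral>z. f z \<partial>?M) = (\<integral>z. f z + f (?R z) \<partial>?M)"
    using int intR by (subst Bochner_Integration.integral_add) (auto simp: integral_noise_reflect(1))
  then have "2 * \<bar>\<integral>z. f z \<partial>?M\<bar> = \<bar>\<integral>z. f z + f (?R z) \<partial>?M\<bar>" by linarith
  then have "ennreal (2 * \<bar>\<integral>z. f z \<partial>?M\<bar>) \<le> (\<integral>\<^sup>+ z. ennreal \<bar>f z + f (?R z)\<bar> \<partial>?M)"
    using integral_norm_bound_ennreal[OF sum] by simp
  also have "\<dots> \<le> (\<integral>\<^sup>+ z. ennreal (Lt * h) * (ennreal (norm (A (fst (fst z)))) * ennreal ((norm (fst (snd z)))\<^sup>2)) \<partial>?M)"
  proof (intro nn_integral_mono)
    fix z :: "(('a \<times> 'a) \<times> ('a \<times> 'a)) \<times> ('a \<times> real)"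
    define v where "v = sqrt h *\<^sub>R fst (snd z)"
    define y where "y = fst (snd (fst z))"
    have "\<bar>f z + f (?R z)\<bar> = \<bar>A (fst (fst z)) \<bullet> (g (y + v) + g (y - v) - 2 *\<^sub>R g y)\<bar>"
      by (simp add: f_def y_def v_def inner_add_right inner_diff_right)
    also have "\<dots> \<le> norm (A (fst (fst z))) * norm (g (y + v) + g (y - v) - 2 *\<^sub>R g y)"
      by (rule Cauchy_Schwarz_ineq2)
    also have "\<dots> \<le> norm (A (fst (fst z))) * (Lt * (norm v)\<^sup>2)"
      by (intro mult_left_mono second_difference) auto
    also have "\<dots> = Lt * h * (norm (A (fst (fst z))) * (norm (fst (snd z)))\<^sup>2)"
      using h_pos by (simp add: v_def power_mult_distrib)
    finally show "ennreal \<bar>f z + f (?R z)\<bar> \<le> ennreal (Lt * h) * (ennreal (norm (A (fst (fst z)))) * ennreal ((norm (fst (snd z)))\<^sup>2))"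
      using Lt_nonneg h_pos by (simp flip: ennreal_mult)
  qed
  also have "\<dots> = ennreal (Lt * h) * (\<integral>\<^sup>+ z. ennreal (norm (A (fst (fst z)))) * ennreal ((norm (fst (snd z)))\<^sup>2) \<partial>?M)"
    by (subst nn_integral_cmult) auto
  also have "\<dots> \<le> ennreal (Lt * h) * ennreal (a * (2 * real DIM('a)))"
    using l2_bound_initial[OF A] by (intro mult_left_mono l2_bound_indep_prod[OF prob_space_noise, of _ "\<lambda>x. A (fst x)"])
      (auto simp: nn_integral_noise_norm prob_space_chain)
  also have "\<dots> = ennreal (2 * (a * (h * (real DIM('a) * Lt))))"
    using Lt_nonneg h_pos l2_boundD(2)[OF A] by (simp add: mult_ac flip: ennreal_mult)
  finally show "\<bar>\<integral>z. f z \<partial>?M\<bar> \<le> a * (h * (real DIM('a) * Lt))"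
    using Lt_nonneg h_pos l2_boundD(2)[OF A] by (subst (asm) ennreal_le_iff) auto
qed

text \<open>Each increment of g is split at the point Y_j + sqrt h w. Drift and Metropolis error
  contribute order h by the Lipschitz bound, and the symmetric noise part order h by
  \<open>noise_increment_inner\<close>. The total is of order t, where Cauchy-Schwarz would give
  sqrt t.\<close>

lemma gradient_increment_inner:
  assumes A: "l2_bound \<zeta> A a"
  shows "\<bar>\<integral>x. A (fst x) \<bullet> (g (fst (snd x)) - g (fst (fst x))) \<partial>chain h \<zeta> j\<bar>
     \<le> a * (real j * h * (L * G + real DIM('a) * Lt + L * \<eta>))"
proof (induction j)
  case 0
  have [measurable]: "A \<in> borel_measurable borel" using l2_boundD(1)[OF A] by simp
  show ?case by (simp add: integral_distr)
next
  case (Suc j)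
  let ?M = "chain h \<zeta> j \<Otimes>\<^sub>M (noise :: ('a \<times> real) measure)"
  have [measurable]: "A \<in> borel_measurable borel" using l2_boundD(1)[OF A] by simp
  let ?e = "\<lambda>z. mala h (fst (snd (fst z))) (snd z) - proposal h (fst (snd (fst z))) (fst (snd z))"
  let ?f0 = "\<lambda>x. A (fst x) \<bullet> (g (fst (snd x)) - g (fst (fst x)))"
  let ?f1 = "\<lambda>z. ?f0 (fst z)"
  let ?f2 = "\<lambda>z. A (fst (fst z)) \<bullet> (g (mala h (fst (snd (fst z))) (snd z)) - g (fst (snd (fst z)) + sqrt h *\<^sub>R fst (snd z)))"
  let ?f3 = "\<lambda>z. A (fst (fst z)) \<bullet> (g (fst (snd (fst z)) + sqrt h *\<^sub>R fst (snd z)) - g (fst (snd (fst z))))"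
  have Am: "l2_bound ?M (\<lambda>z. A (fst (fst z))) a"
    by (rule l2_bound_pair_fst[OF prob_space_noise, of _ "\<lambda>x. A (fst x)"]) (rule l2_bound_initial[OF A])
  have i1: "integrable ?M ?f1"
    by (rule l2_bound_inner(1)[OF Am l2_bound_pair_fst[OF prob_space_noise, of _ "\<lambda>x. g (fst (snd x)) - g (fst (fst x))", OF l2_bound_gradient_increment]])
  have b1: "(\<integral>z. ?f1 z \<partial>?M) = (\<integral>x. ?f0 x \<partial>chain h \<zeta> j)"
    by (rule integral_pair_fst[OF prob_space_noise, of ?f0]) measurable
  have "l2_bound ?M (\<lambda>z. ?e z - h *\<^sub>R g (fst (snd (fst z)))) (h * \<eta> + \<bar>h\<bar> * G)"
    by (intro l2_bound_diff l2_bound_scaleR l2_bound_error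
      l2_bound_pair_fst[OF prob_space_noise, of _ "\<lambda>x. g (fst (snd x))"] l2_bound_gradient[folded G_def])
  then have "l2_bound ?M (\<lambda>z. g (mala h (fst (snd (fst z))) (snd z)) - g (fst (snd (fst z)) + sqrt h *\<^sub>R fst (snd z))) (L * (h * \<eta> + \<bar>h\<bar> * G))"
  proof (rule l2_bound_norm_le)
    fix z :: "(('a \<times> 'a) \<times> ('a \<times> 'a)) \<times> ('a \<times> real)"
    show "norm (g (mala h (fst (snd (fst z))) (snd z)) - g (fst (snd (fst z)) + sqrt h *\<^sub>R fst (snd z)))
      \<le> L * norm (?e z - h *\<^sub>R g (fst (snd (fst z))))"
      using Lipschitz[of "mala h (fst (snd (fst z))) (snd z)" "fst (snd (fst z)) + sqrt h *\<^sub>R fst (snd z)"]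
      by (simp add: proposal_def algebra_simps)
  qed (use L_pos in auto)
  note b2 = l2_bound_inner[OF Am this]
  note b3 = noise_increment_inner[OF A, of j]
  have "(\<integral>x. ?f0 x \<partial>chain h \<zeta> (Suc j)) = (\<integral>z. ?f1 z + ?f2 z + ?f3 z \<partial>?M)"
    by (simp add: integral_distr) (simp add: chain_step_def inner_diff_right)
  also have "\<dots> = (\<integral>z. ?f1 z \<partial>?M) + (\<integral>z. ?f2 z \<partial>?M) + (\<integral>z. ?f3 z \<partial>?M)"
    using i1 b2(1) b3(1) by simp
  finally have "\<bar>\<integral>x. ?f0 x \<partial>chain h \<zeta> (Suc j)\<bar> \<le> a * (real j * h * (L * G + real DIM('a) * Lt + L * \<eta>)) + a * (L * (h * \<eta> + \<bar>h\<bar> * G)) + a * (h * (real DIM('a) * Lt))"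
    using b1 b2(2) b3(2) Suc by linarith
  also have "\<dots> = a * (real (Suc j) * h * (L * G + real DIM('a) * Lt + L * \<eta>))"
    using h_pos by (simp add: algebra_simps)
  finally show ?case .
qed

text \<open>The recursion of \<open>l2_bound_discretization\<close> tested against \<open>A\<close>:
  gradient increments of order t now sum to t^2 / 2.\<close>

lemma discretization_inner:
  assumes A: "l2_bound \<zeta> A a"
  defines "t \<equiv> \<lambda>j. real j * h"
  shows "\<bar>\<integral>x. A (fst x) \<bullet> (fst (snd x) - fst (fst x) + t j *\<^sub>R g (fst (fst x)) - snd (snd x)) \<partial>chain h \<zeta> j\<bar>
     \<le> a * ((t j)\<^sup>2 / 2 * (L * G + real DIM('a) * Lt + L * \<eta>) + t j * \<eta>)"
proof (induction j)
  case 0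
  have [measurable]: "A \<in> borel_measurable borel" using l2_boundD(1)[OF A] by simp
  show ?case by (simp add: integral_distr t_def)
next
  case (Suc j)
  let ?M = "chain h \<zeta> j \<Otimes>\<^sub>M (noise :: ('a \<times> real) measure)"
  let ?K = "L * G + real DIM('a) * Lt + L * \<eta>"
  have a: "a \<ge> 0" using l2_boundD(2)[OF A] .
  have t: "t j \<ge> 0" "t (Suc j) = t j + h" using h_pos by (auto simp: t_def algebra_simps)
  have K: "?K \<ge> 0" using L_pos Lt_nonneg G_nonneg \<eta>_pos by simp
  have [measurable]: "A \<in> borel_measurable borel" using l2_boundD(1)[OF A] by simp
  let ?e = "\<lambda>z. mala h (fst (snd (fst z))) (snd z) - proposal h (fst (snd (fst z))) (fst (snd z))"
  let ?D = "\<lambda>j x. fst (snd x) - fst (fst x) + t j *\<^sub>R g (fst (fst x)) - snd (snd x)"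
  let ?f0 = "\<lambda>x. A (fst x) \<bullet> ?D j x"
  let ?f1 = "\<lambda>x. A (fst x) \<bullet> (g (fst (snd x)) - g (fst (fst x)))"
  let ?f2 = "\<lambda>z. A (fst (fst z)) \<bullet> ?e z"
  have Am: "l2_bound ?M (\<lambda>z. A (fst (fst z))) a"
    by (rule l2_bound_pair_fst[OF prob_space_noise, of _ "\<lambda>x. A (fst x)"]) (rule l2_bound_initial[OF A])
  have i0: "integrable ?M (\<lambda>z. ?f0 (fst z))"
    unfolding t_def by (rule l2_bound_inner(1)[OF Am l2_bound_pair_fst[OF prob_space_noise l2_bound_discretization]])
  have i1: "integrable ?M (\<lambda>z. ?f1 (fst z))"
    by (rule l2_bound_inner(1)[OF Am l2_bound_pair_fst[OF prob_space_noise, of _ "\<lambda>x. g (fst (snd x)) - g (fst (fst x))", OF l2_bound_gradient_increment]])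
  note b2 = l2_bound_inner[OF Am l2_bound_error]
  have b0: "(\<integral>z. ?f0 (fst z) \<partial>?M) = (\<integral>x. ?f0 x \<partial>chain h \<zeta> j)"
    by (rule integral_pair_fst[OF prob_space_noise, of ?f0]) measurable
  have b1: "(\<integral>z. ?f1 (fst z) \<partial>?M) = (\<integral>x. ?f1 x \<partial>chain h \<zeta> j)"
    by (rule integral_pair_fst[OF prob_space_noise, of ?f1]) measurable
  have b1': "\<bar>h * (\<integral>x. ?f1 x \<partial>chain h \<zeta> j)\<bar> \<le> h * (a * (t j * ?K))"
    using gradient_increment_inner[OF A, of j] h_pos by (simp add: abs_mult t_def)
  have "(\<integral>x. A (fst x) \<bullet> ?D (Suc j) x \<partial>chain h \<zeta> (Suc j)) = (\<integral>z. ?f0 (fst z) - h * ?f1 (fst z) + ?f2 z \<partial>?M)"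
    unfolding t by (simp add: integral_distr)
      (simp add: chain_step_def proposal_def inner_diff_right inner_add_right algebra_simps)
  also have "\<dots> = (\<integral>z. ?f0 (fst z) \<partial>?M) - h * (\<integral>z. ?f1 (fst z) \<partial>?M) + (\<integral>z. ?f2 z \<partial>?M)"
    using i0 i1 b2(1) by simp
  finally have eq: "(\<integral>x. A (fst x) \<bullet> ?D (Suc j) x \<partial>chain h \<zeta> (Suc j))
      = (\<integral>x. ?f0 x \<partial>chain h \<zeta> j) - h * (\<integral>x. ?f1 x \<partial>chain h \<zeta> j) + (\<integral>z. ?f2 z \<partial>?M)"
    unfolding b0 b1 .
  have "\<bar>\<integral>x. A (fst x) \<bullet> ?D (Suc j) x \<partial>chain h \<zeta> (Suc j)\<bar>
      \<le> a * ((t j)\<^sup>2 / 2 * ?K + t j * \<eta>) + h * (a * (t j * ?K)) + a * (h * \<eta>)"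
    unfolding eq using b1' b2(2) Suc by linarith
  also have "\<dots> = a * (((t j)\<^sup>2 / 2 + h * t j) * ?K + (t j + h) * \<eta>)" by (simp add: algebra_simps)
  also have "\<dots> \<le> a * ((t j + h)\<^sup>2 / 2 * ?K + (t j + h) * \<eta>)"
    using a K t(1) h_pos \<eta>_pos by (intro mult_left_mono add_mono mult_right_mono) (auto simp: power2_eq_square algebra_simps add_divide_distrib)
  finally show ?case unfolding t(2) .
qed

end

end

end

section \<open>Contraction of the transport cost\<close>

lemma l2_bound_integral_square:
  assumes "l2_bound M f a" shows "integrable M (\<lambda>x. (norm (f x))\<^sup>2)" "(\<integral>x. (norm (f x))\<^sup>2 \<partial>M) \<le> a\<^sup>2"
  unfolding power2_norm_eq_inner power2_eq_square[of a] using l2_bound_inner[OF assms assms] by simp_all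

text \<open>Keeps the inner product as a separate quantity: in the application \<open>c\<close> is
  of order \<gamma>^2, whereas a b would be of order \<gamma>^(3/2).\<close>

lemma l2_bound_add_inner:
  assumes f: "l2_bound M f a" and g: "l2_bound M g b" and c: "\<bar>\<integral>x. f x \<bullet> g x \<partial>M\<bar> \<le> c"
  shows "(\<integral>\<^sup>+ x. ennreal ((norm (f x + g x))\<^sup>2) \<partial>M) \<le> ennreal (a\<^sup>2 + 2 * c + b\<^sup>2)"
proof -
  note i = l2_bound_integral_square[OF f] l2_bound_integral_square[OF g] l2_bound_inner(1)[OF f g]
  have e: "(norm (f x + g x))\<^sup>2 = (norm (f x))\<^sup>2 + 2 * (f x \<bullet> g x) + (norm (g x))\<^sup>2" for x
    unfolding power2_norm_eq_inner by (simp add: inner_add_left inner_add_right inner_commute)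
  have int: "integrable M (\<lambda>x. (norm (f x + g x))\<^sup>2)" unfolding e using i by simp
  have "(\<integral>x. (norm (f x + g x))\<^sup>2 \<partial>M) = (\<integral>x. (norm (f x))\<^sup>2 \<partial>M) + 2 * (\<integral>x. f x \<bullet> g x \<partial>M) + (\<integral>x. (norm (g x))\<^sup>2 \<partial>M)"
    unfolding e using i by simp
  also have "\<dots> \<le> a\<^sup>2 + 2 * c + b\<^sup>2" using i(2,4) c by linarith
  finally show ?thesis using int by (subst nn_integral_eq_integral) (auto intro: ennreal_leI)
qed

lemma norm_add_sq_le:
  fixes u v :: "'a::real_inner"
  assumes "s > 0" shows "(norm (u + v))\<^sup>2 \<le> (1 + s) * (norm u)\<^sup>2 + (1 + 1 / s) * (norm v)\<^sup>2"
proof -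
  have "0 \<le> (norm (s *\<^sub>R u - v))\<^sup>2 / s" using assms by simp
  also have "(norm (s *\<^sub>R u - v))\<^sup>2 / s = s * (norm u)\<^sup>2 - 2 * (u \<bullet> v) + (norm v)\<^sup>2 / s"
    using assms unfolding power2_norm_eq_inner
    by (simp add: inner_diff_left inner_diff_right inner_commute field_simps)
  finally have "2 * (u \<bullet> v) \<le> s * (norm u)\<^sup>2 + (norm v)\<^sup>2 / s" by simp
  then show ?thesis unfolding power2_norm_eq_inner
    by (simp add: inner_add_left inner_add_right inner_commute algebra_simps)
qed

context strongly_convex_potential
begin

context
  fixes \<gamma> :: real and \<mu> :: "'a measure"
  assumes \<gamma>: "0 < \<gamma>" "\<gamma> \<le> 1 / (m + L)"
    and stationary: "stationary_distribution (\<lambda>x. isotropic_gaussian (x - \<gamma> *\<^sub>R g x) (2 * \<gamma>)) \<mu>"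
begin

section \<open>The stationary law of the Euler scheme\<close>

lemma prob_\<mu>: "prob_space \<mu>" and sets_\<mu> [simp, measurable_cong]: "sets \<mu> = sets borel"
  using stationary by (auto simp: stationary_distribution_def)

lemma space_\<mu> [simp]: "space \<mu> = UNIV"
  using sets_eq_imp_space_eq[OF sets_\<mu>] by simp

lemma emeasure_euler_kernel:
  assumes [measurable]: "A \<in> sets borel"
  shows "emeasure (isotropic_gaussian (x - \<gamma> *\<^sub>R g x) (2 * \<gamma>)) A
    = (\<integral>\<^sup>+ w. indicator A (x - \<gamma> *\<^sub>R g x + w) \<partial>isotropic_gaussian 0 (2 * \<gamma>))"
proof -
  have "isotropic_gaussian (x - \<gamma> *\<^sub>R g x) (2 * \<gamma>) = distr (isotropic_gaussian 0 (2 * \<gamma>)) borel (\<lambda>w. (x - \<gamma> *\<^sub>R g x) + 1 *\<^sub>R w)"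
    by (subst distr_isotropic_gaussian_affine) auto
  then have "emeasure (isotropic_gaussian (x - \<gamma> *\<^sub>R g x) (2 * \<gamma>)) A
     = (\<integral>\<^sup>+ z. indicator A z \<partial>distr (isotropic_gaussian 0 (2 * \<gamma>)) borel (\<lambda>w. (x - \<gamma> *\<^sub>R g x) + 1 *\<^sub>R w))"
    by simp
  also have "\<dots> = (\<integral>\<^sup>+ w. indicator A (x - \<gamma> *\<^sub>R g x + w) \<partial>isotropic_gaussian 0 (2 * \<gamma>))"
    by (subst nn_integral_distr) auto
  finally show ?thesis .
qed

lemma stationary_emeasure:
  assumes A: "A \<in> sets borel"
  shows "(\<integral>\<^sup>+ x. \<integral>\<^sup>+ w. indicator A (x - \<gamma> *\<^sub>R g x + w) \<partial>isotropic_gaussian 0 (2 * \<gamma>) \<partial>\<mu>) = emeasure \<mu> A"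
  using stationary A unfolding stationary_distribution_def by (simp add: emeasure_euler_kernel)

lemma stationary_nn_integral:
  assumes [measurable]: "f \<in> borel_measurable borel"
  shows "(\<integral>\<^sup>+ x. \<integral>\<^sup>+ w. f (x - \<gamma> *\<^sub>R g x + w) \<partial>isotropic_gaussian 0 (2 * \<gamma>) \<partial>\<mu>) = (\<integral>\<^sup>+ x. f x \<partial>\<mu>)"
proof -
  let ?N = "isotropic_gaussian (0::'a) (2 * \<gamma>)"
  let ?T = "\<lambda>z. fst z - \<gamma> *\<^sub>R g (fst z) + snd z"
  interpret N: prob_space ?N by (rule prob_space_isotropic_gaussian) (use \<gamma> in simp)
  have D: "distr (\<mu> \<Otimes>\<^sub>M ?N) borel ?T = \<mu>"
  proof (rule measure_eqI)
    fix A assume "A \<in> sets (distr (\<mu> \<Otimes>\<^sub>M ?N) borel ?T)"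
    then have A[measurable]: "A \<in> sets borel" by simp
    have "emeasure (distr (\<mu> \<Otimes>\<^sub>M ?N) borel ?T) A = (\<integral>\<^sup>+ z. indicator A (?T z) \<partial>(\<mu> \<Otimes>\<^sub>M ?N))"
      using nn_integral_distr[of ?T "\<mu> \<Otimes>\<^sub>M ?N" borel "indicator A"] by simp
    also have "\<dots> = (\<integral>\<^sup>+ x. \<integral>\<^sup>+ w. indicator A (x - \<gamma> *\<^sub>R g x + w) \<partial>?N \<partial>\<mu>)"
      by (subst N.nn_integral_fst[symmetric]) auto
    finally show "emeasure (distr (\<mu> \<Otimes>\<^sub>M ?N) borel ?T) A = emeasure \<mu> A"
      using stationary_emeasure[OF A] by simp
  qed simp
  have "(\<integral>\<^sup>+ x. f x \<partial>\<mu>) = (\<integral>\<^sup>+ z. f (?T z) \<partial>(\<mu> \<Otimes>\<^sub>M ?N))"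
    by (subst D[symmetric], subst nn_integral_distr) auto
  also have "\<dots> = (\<integral>\<^sup>+ x. \<integral>\<^sup>+ w. f (x - \<gamma> *\<^sub>R g x + w) \<partial>?N \<partial>\<mu>)"
    by (subst N.nn_integral_fst[symmetric]) auto
  finally show ?thesis by simp
qed

text \<open>The gradient step contracts by 1 - \<open>kappa\<close> \<gamma> = 1 - 4 s. Splitting
  off the vector \<gamma> g(0) and then the noise costs a factor 1 + s each, and (1 + s)^2 (1 - 4 s)
  is still below 1.\<close>

lemma euler_lyapunov:
  obtains \<rho> b where "0 \<le> \<rho>" "\<rho> < 1" "0 \<le> b"
    "\<And>x. (\<integral>\<^sup>+ w. ennreal ((norm (x - \<gamma> *\<^sub>R g x + w))\<^sup>2) \<partial>isotropic_gaussian 0 (2 * \<gamma>)) \<le> ennreal (\<rho> * (norm x)\<^sup>2 + b)"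
proof -
  let ?N = "isotropic_gaussian (0::'a) (2 * \<gamma>)"
  interpret N: prob_space ?N by (rule prob_space_isotropic_gaussian) (use \<gamma> in simp)
  define s where "s = kappa m L * \<gamma> / 4"
  have "0 < kappa m L * \<gamma>" using kappa_pos \<gamma>(1) by simp
  then have s: "s > 0" "s \<le> 1 / 8" using kappa_step_le[OF \<gamma>] unfolding s_def by linarith+
  define \<rho> where "\<rho> = (1 + s)\<^sup>2 * (1 - 4 * s)"
  define b where "b = (1 + s) * (1 + 1 / s) * (\<gamma>\<^sup>2 * (norm (g 0))\<^sup>2) + (1 + 1 / s) * (real DIM('a) * (2 * \<gamma>))"
  have "\<rho> = 1 - (2 * s + 7 * s\<^sup>2 + 4 * s ^ 3)"
    by (simp add: \<rho>_def power2_eq_square power3_eq_cube algebra_simps)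
  moreover have "0 \<le> s\<^sup>2" "0 \<le> s ^ 3" using s by simp_all
  ultimately have l: "\<rho> < 1" using s by linarith
  have l0: "0 \<le> \<rho>" using s by (simp add: \<rho>_def)
  have pw: "(norm (x - \<gamma> *\<^sub>R g x + w))\<^sup>2 \<le> (\<rho> * (norm x)\<^sup>2 + (1 + s) * (1 + 1 / s) * (\<gamma>\<^sup>2 * (norm (g 0))\<^sup>2)) + (1 + 1 / s) * (norm w)\<^sup>2" for x w
  proof -
    let ?u = "x - 0 - \<gamma> *\<^sub>R (g x - g 0)"
    have "(norm (x - \<gamma> *\<^sub>R g x))\<^sup>2 = (norm (?u + - (\<gamma> *\<^sub>R g 0)))\<^sup>2" by (simp add: algebra_simps)
    also have "\<dots> \<le> (1 + s) * (norm ?u)\<^sup>2 + (1 + 1 / s) * (norm (- (\<gamma> *\<^sub>R g 0)))\<^sup>2"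
      by (rule norm_add_sq_le[OF s(1)])
    also have "(norm ?u)\<^sup>2 \<le> (1 - 4 * s) * (norm x)\<^sup>2"
      using gradient_step_contraction[OF \<gamma>, of x 0] by (simp add: s_def)
    finally have 1: "(norm (x - \<gamma> *\<^sub>R g x))\<^sup>2 \<le> (1 + s) * ((1 - 4 * s) * (norm x)\<^sup>2) + (1 + 1 / s) * (\<gamma>\<^sup>2 * (norm (g 0))\<^sup>2)"
      using s by (simp add: power_mult_distrib)
    have "(norm (x - \<gamma> *\<^sub>R g x + w))\<^sup>2 \<le> (1 + s) * (norm (x - \<gamma> *\<^sub>R g x))\<^sup>2 + (1 + 1 / s) * (norm w)\<^sup>2"
      by (rule norm_add_sq_le[OF s(1)])
    also have "(1 + s) * (norm (x - \<gamma> *\<^sub>R g x))\<^sup>2 \<le> (1 + s) * ((1 + s) * ((1 - 4 * s) * (norm x)\<^sup>2) + (1 + 1 / s) * (\<gamma>\<^sup>2 * (norm (g 0))\<^sup>2))"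
      using 1 s by (intro mult_left_mono) auto
    finally show ?thesis by (simp add: \<rho>_def power2_eq_square algebra_simps)
  qed
  have "(\<integral>\<^sup>+ w. ennreal ((norm (x - \<gamma> *\<^sub>R g x + w))\<^sup>2) \<partial>?N) \<le> ennreal (\<rho> * (norm x)\<^sup>2 + b)" for x
  proof -
    let ?k = "\<rho> * (norm x)\<^sup>2 + (1 + s) * (1 + 1 / s) * (\<gamma>\<^sup>2 * (norm (g 0))\<^sup>2)"
    have k: "?k \<ge> 0" using l0 s by simp
    have "(\<integral>\<^sup>+ w. ennreal ((norm (x - \<gamma> *\<^sub>R g x + w))\<^sup>2) \<partial>?N) \<le> (\<integral>\<^sup>+ w. ennreal ?k + ennreal (1 + 1 / s) * ennreal ((norm w)\<^sup>2) \<partial>?N)"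
      using pw k s by (intro nn_integral_mono) (simp flip: ennreal_mult ennreal_plus)
    also have "\<dots> = ennreal ?k + ennreal (1 + 1 / s) * ennreal (real DIM('a) * (2 * \<gamma>))"
      using \<gamma> by (subst nn_integral_add) (auto simp: nn_integral_cmult isotropic_gaussian_second_moment N.emeasure_space_1[simplified])
    also have "\<dots> = ennreal (\<rho> * (norm x)\<^sup>2 + b)"
      using k s \<gamma> by (simp add: b_def add.assoc flip: ennreal_mult ennreal_plus)
    finally show ?thesis .
  qed
  moreover have "0 \<le> b" using s \<gamma> by (simp add: b_def)
  ultimately show thesis using l l0 that by blast
qed

text \<open>The truncations \<open>min |x|\<^sup>2 n\<close> are integrable, so the drift inequality may be integrated
  before letting \<open>n\<close> tend to infinity.\<close>

lemma stationary_second_moment: "(\<integral>\<^sup>+ x. ennreal ((norm x)\<^sup>2) \<partial>\<mu>) < \<infinity>"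
proof -
  interpret prob_space \<mu> by (rule prob_\<mu>)
  let ?N = "isotropic_gaussian (0::'a) (2 * \<gamma>)"
  interpret N: prob_space ?N by (rule prob_space_isotropic_gaussian) (use \<gamma> in simp)
  obtain \<rho> b where lb: "0 \<le> \<rho>" "\<rho> < 1" "0 \<le> b"
    and drift: "\<And>x. (\<integral>\<^sup>+ w. ennreal ((norm (x - \<gamma> *\<^sub>R g x + w))\<^sup>2) \<partial>?N) \<le> ennreal (\<rho> * (norm x)\<^sup>2 + b)"
    using euler_lyapunov by blast
  define V where "V n x = min ((norm x)\<^sup>2) (real n)" for n :: nat and x :: 'a
  define W where "W n x = min (\<rho> * (norm x)\<^sup>2 + b) (real n)" for n :: nat and x :: 'a
  have [measurable]: "V n \<in> borel_measurable borel" "W n \<in> borel_measurable borel" for n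
    by (simp_all add: V_def [abs_def] W_def [abs_def])
  have VW: "0 \<le> V n x" "V n x \<le> real n" "0 \<le> W n x" "W n x \<le> real n" for n x
    using lb by (auto simp: V_def W_def)
  have iV: "integrable \<mu> (V n)" for n
    by (rule integrable_const_bound[of _ "real n"]) (use VW in auto)
  have iW: "integrable \<mu> (W n)" for n
    by (rule integrable_const_bound[of _ "real n"]) (use VW in auto)
  have le: "(\<integral>x. V n x \<partial>\<mu>) \<le> (\<integral>x. W n x \<partial>\<mu>)" for n
  proof -
    have "(\<integral>\<^sup>+ x. ennreal (V n x) \<partial>\<mu>) = (\<integral>\<^sup>+ x. \<integral>\<^sup>+ w. ennreal (V n (x - \<gamma> *\<^sub>R g x + w)) \<partial>?N \<partial>\<mu>)"
      by (rule stationary_nn_integral[symmetric]) measurable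
    also have "\<dots> \<le> (\<integral>\<^sup>+ x. ennreal (W n x) \<partial>\<mu>)"
    proof (intro nn_integral_mono)
      fix x
      have "(\<integral>\<^sup>+ w. ennreal (V n (x - \<gamma> *\<^sub>R g x + w)) \<partial>?N) \<le> (\<integral>\<^sup>+ w. ennreal ((norm (x - \<gamma> *\<^sub>R g x + w))\<^sup>2) \<partial>?N)"
        by (intro nn_integral_mono ennreal_leI) (auto simp: V_def)
      also note drift
      finally have 1: "(\<integral>\<^sup>+ w. ennreal (V n (x - \<gamma> *\<^sub>R g x + w)) \<partial>?N) \<le> ennreal (\<rho> * (norm x)\<^sup>2 + b)" .
      have "(\<integral>\<^sup>+ w. ennreal (V n (x - \<gamma> *\<^sub>R g x + w)) \<partial>?N) \<le> (\<integral>\<^sup>+ w. ennreal (real n) \<partial>?N)"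
        by (intro nn_integral_mono ennreal_leI VW)
      then have "(\<integral>\<^sup>+ w. ennreal (V n (x - \<gamma> *\<^sub>R g x + w)) \<partial>?N) \<le> ennreal (real n)"
        by (simp add: N.emeasure_space_1[simplified])
      with 1 show "(\<integral>\<^sup>+ w. ennreal (V n (x - \<gamma> *\<^sub>R g x + w)) \<partial>?N) \<le> ennreal (W n x)"
        by (auto simp: W_def min_def)
    qed
    finally have "ennreal (\<integral>x. V n x \<partial>\<mu>) \<le> ennreal (\<integral>x. W n x \<partial>\<mu>)"
      using iV iW VW by (simp add: nn_integral_eq_integral)
    then show ?thesis using VW by (subst (asm) ennreal_le_iff) (auto intro: integral_nonneg_AE)
  qed
  have nn: "0 \<le> V n x - W n x + b" for n x
  proof -
    have "\<rho> * (norm x)\<^sup>2 \<le> (norm x)\<^sup>2" using lb by (simp add: mult_left_le_one_le)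
    then show ?thesis using lb by (auto simp: V_def W_def min_def)
  qed
  \<comment> \<open>Fatou's lemma: for large n the integrand equals (1 - \<rho>) |x|^2, while its
    integral is at most b by \<open>le\<close>. The summand b is what makes it nonnegative.\<close>
  have "(\<integral>\<^sup>+ x. ennreal ((1 - \<rho>) * (norm x)\<^sup>2) \<partial>\<mu>) \<le> (\<integral>\<^sup>+ x. liminf (\<lambda>n. ennreal (V n x - W n x + b)) \<partial>\<mu>)"
  proof (intro nn_integral_mono)
    fix x
    have "eventually (\<lambda>n. ennreal (V n x - W n x + b) = ennreal ((1 - \<rho>) * (norm x)\<^sup>2)) sequentially"
    proof -
      obtain n0 :: nat where "max ((norm x)\<^sup>2) (\<rho> * (norm x)\<^sup>2 + b) \<le> real n0" using real_arch_simple by blast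
      then show ?thesis
        by (intro eventually_sequentiallyI[of n0]) (auto simp: V_def W_def min_def algebra_simps)
    qed
    then have "liminf (\<lambda>n. ennreal (V n x - W n x + b)) = ennreal ((1 - \<rho>) * (norm x)\<^sup>2)"
      by (intro lim_imp_Liminf tendsto_eventually) auto
    then show "ennreal ((1 - \<rho>) * (norm x)\<^sup>2) \<le> liminf (\<lambda>n. ennreal (V n x - W n x + b))" by simp
  qed
  also have "\<dots> \<le> liminf (\<lambda>n. \<integral>\<^sup>+ x. ennreal (V n x - W n x + b) \<partial>\<mu>)"
    by (rule nn_integral_liminf) measurable
  also have "\<dots> \<le> liminf (\<lambda>n::nat. ennreal b)"
  proof (intro Liminf_mono always_eventually allI)
    fix n
    have "(\<integral>\<^sup>+ x. ennreal (V n x - W n x + b) \<partial>\<mu>) = ennreal (\<integral>x. V n x - W n x + b \<partial>\<mu>)"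
      using iV iW nn by (intro nn_integral_eq_integral) auto
    also have "(\<integral>x. V n x - W n x + b \<partial>\<mu>) = (\<integral>x. V n x \<partial>\<mu>) - (\<integral>x. W n x \<partial>\<mu>) + b"
      using iV iW by (simp add: prob_space[simplified])
    also have "ennreal \<dots> \<le> ennreal b" using le[of n] by (intro ennreal_leI) simp
    finally show "(\<integral>\<^sup>+ x. ennreal (V n x - W n x + b) \<partial>\<mu>) \<le> ennreal b" .
  qed
  also have "\<dots> = ennreal b" by (intro lim_imp_Liminf) auto
  finally have fin: "(\<integral>\<^sup>+ x. ennreal ((1 - \<rho>) * (norm x)\<^sup>2) \<partial>\<mu>) \<le> ennreal b" .
  have "(\<integral>\<^sup>+ x. ennreal ((norm x)\<^sup>2) \<partial>\<mu>) = (\<integral>\<^sup>+ x. ennreal (1 / (1 - \<rho>)) * ennreal ((1 - \<rho>) * (norm x)\<^sup>2) \<partial>\<mu>)"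
    using lb by (intro nn_integral_cong) (simp flip: ennreal_mult)
  also have "\<dots> = ennreal (1 / (1 - \<rho>)) * (\<integral>\<^sup>+ x. ennreal ((1 - \<rho>) * (norm x)\<^sup>2) \<partial>\<mu>)"
    by (rule nn_integral_cmult) measurable
  also have "\<dots> \<le> ennreal (1 / (1 - \<rho>)) * ennreal b" using fin by (rule mult_left_mono) simp
  also have "\<dots> < \<infinity>" by (simp add: ennreal_mult_less_top)
  finally show ?thesis .
qed

section \<open>Improving a coupling\<close>

lemma couplingsD:
  assumes "\<zeta> \<in> couplings (gibbs U) \<mu>"
  shows "prob_space \<zeta>" "sets \<zeta> = sets borel" "distr \<zeta> borel fst = gibbs U" "distr \<zeta> borel snd = \<mu>"
  using assms by (auto simp: couplings_def)

text \<open>The product coupling, by the second moments. Finiteness is essential: the contraction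
  inequality carries no information when the infimum is infinite.\<close>

lemma finite_cost_coupling:
  obtains \<zeta> where "\<zeta> \<in> couplings (gibbs U) \<mu>" "(\<integral>\<^sup>+ z. ennreal ((dist (fst z) (snd z))\<^sup>2) \<partial>\<zeta>) < \<infinity>"
proof
  interpret p: prob_space "gibbs U" by (rule prob_space_gibbs)
  interpret q: prob_space \<mu> by (rule prob_\<mu>)
  interpret pq: pair_prob_space "gibbs U" \<mu> ..
  let ?P = "gibbs U \<Otimes>\<^sub>M \<mu>"
  have "distr ?P (gibbs U) fst = gibbs U" by (rule q.distr_pair_fst)
  moreover have "distr ?P \<mu> snd = \<mu>" 
  proof (rule measure_eqI)
    fix A assume "A \<in> sets (distr ?P \<mu> snd)"
    then have [measurable]: "A \<in> sets \<mu>" and A: "A \<in> sets borel" by simp_all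
    have "emeasure (distr ?P \<mu> snd) A = emeasure ?P (UNIV \<times> A)"
      using A by (subst emeasure_distr) (auto simp: space_pair_measure intro!: arg_cong2[where f=emeasure])
    also have "\<dots> = emeasure \<mu> A"
      using A p.emeasure_space_1 by (subst q.emeasure_pair_measure_Times) auto
    finally show "emeasure (distr ?P \<mu> snd) A = emeasure \<mu> A" .
  qed simp
  moreover have "distr ?P borel fst = distr ?P (gibbs U) fst" "distr ?P borel snd = distr ?P \<mu> snd"
    by (auto intro!: distr_cong)
  moreover have "sets ?P = sets borel"
    unfolding borel_prod[symmetric] by (intro sets_pair_measure_cong) auto
  ultimately show "?P \<in> couplings (gibbs U) \<mu>"
    using pq.prob_space_axioms by (auto simp: couplings_def)
  have "(\<integral>\<^sup>+ z. ennreal ((dist (fst z) (snd z))\<^sup>2) \<partial>?P) \<le> (\<integral>\<^sup>+ z. 2 * ennreal ((norm (fst z))\<^sup>2) + 2 * ennreal ((norm (snd z))\<^sup>2) \<partial>?P)"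
  proof (intro nn_integral_mono)
    fix z :: "'a \<times> 'a"
    have "(dist (fst z) (snd z))\<^sup>2 \<le> 2 * (norm (fst z))\<^sup>2 + 2 * (norm (snd z))\<^sup>2"
      using norm_add_sq_le[of 1 "fst z" "- snd z"] by (simp add: dist_norm)
    then have "ennreal ((dist (fst z) (snd z))\<^sup>2) \<le> ennreal (2 * (norm (fst z))\<^sup>2 + 2 * (norm (snd z))\<^sup>2)"
      by (rule ennreal_leI)
    then show "ennreal ((dist (fst z) (snd z))\<^sup>2) \<le> 2 * ennreal ((norm (fst z))\<^sup>2) + 2 * ennreal ((norm (snd z))\<^sup>2)"
      by (simp add: ennreal_mult)
  qed
  also have "\<dots> = 2 * (\<integral>\<^sup>+ y. ennreal ((norm y)\<^sup>2) \<partial>gibbs U) + 2 * (\<integral>\<^sup>+ x. ennreal ((norm x)\<^sup>2) \<partial>\<mu>)"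
    by (subst q.nn_integral_fst[symmetric])
      (auto simp: nn_integral_add nn_integral_cmult p.emeasure_space_1[simplified] q.emeasure_space_1[simplified])
  also have "\<dots> < \<infinity>"
    using gibbs_second_moment stationary_second_moment by (simp add: ennreal_mult_less_top)
  finally show "(\<integral>\<^sup>+ z. ennreal ((dist (fst z) (snd z))\<^sup>2) \<partial>?P) < \<infinity>" .
qed

text \<open>The new coupling is the law of (Y_N, X_1). The contracted difference, bounded by
  \<open>a\<close>, depends on the initial pair alone, so its inner product with the error falls
  under \<open>discretization_inner\<close>.\<close>

lemma improved_coupling:
  assumes \<zeta>: "\<zeta> \<in> couplings (gibbs U) \<mu>"
    and cost: "(\<integral>\<^sup>+ z. ennreal ((dist (fst z) (snd z))\<^sup>2) \<partial>\<zeta>) \<le> ennreal c" and c: "0 \<le> c" and \<eta>: "\<eta> > 0"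
  defines "a \<equiv> sqrt ((1 - kappa m L * \<gamma>) * c)"
  obtains \<zeta>' where "\<zeta>' \<in> couplings (gibbs U) \<mu>"
    "(\<integral>\<^sup>+ z. ennreal ((dist (fst z) (snd z))\<^sup>2) \<partial>\<zeta>')
      \<le> ennreal (a\<^sup>2 + 2 * (a * (\<gamma>\<^sup>2 / 2 * (L * G + real DIM('a) * Lt + L * \<eta>) + \<gamma> * \<eta>))
        + (L * (\<gamma>\<^sup>2 / 2 * (G + \<eta>) + sqrt (2 * real DIM('a)) * (2 / 3 * (\<gamma> * sqrt \<gamma>))) + \<gamma> * \<eta>)\<^sup>2)"
proof -
  note \<zeta>D = couplingsD[OF \<zeta>]
  note [simp, measurable_cong] = \<zeta>D(2)
  obtain h0 where h0: "h0 > 0" and close: "\<And>h. 0 < h \<Longrightarrow> h \<le> h0 \<Longrightarrow>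
    (\<integral>\<^sup>+ y. \<integral>\<^sup>+ n. ennreal ((norm (mala h y n - proposal h y (fst n)))\<^sup>2) \<partial>noise \<partial>gibbs U) \<le> ennreal ((\<eta> * h)\<^sup>2)"
    using mala_error[OF \<eta>] by blast
  \<comment> \<open>N = \<open>Suc j\<close> steps of length exactly \<gamma> / N, at most
    \<open>h0\<close>, so that the increments have total variance 2 \<gamma>, that of one Euler
    step.\<close>
  obtain j :: nat where j: "inverse (real (Suc j)) < h0 / \<gamma>"
    using reals_Archimedean[of "h0 / \<gamma>"] h0 \<gamma> by auto
  define h where "h = \<gamma> / real (Suc j)"
  have h: "h > 0" "h \<le> h0" "real (Suc j) * h = \<gamma>" "h * real (Suc j) = \<gamma>"
    using \<gamma> j by (auto simp: h_def field_simps)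
  note ctx = h(1) \<zeta>D(1-3) \<eta> close[OF h(1,2)]
  let ?M = "chain h \<zeta> (Suc j)"
  define A where "A p = fst p - snd p - \<gamma> *\<^sub>R (g (fst p) - g (snd p))" for p :: "'a \<times> 'a"
  define X1 where "X1 x = snd (fst x) - \<gamma> *\<^sub>R g (snd (fst x)) + snd (snd x)" for x :: "('a \<times> 'a) \<times> ('a \<times> 'a)"
  let ?D = "\<lambda>x. fst (snd x) - fst (fst x) + \<gamma> *\<^sub>R g (fst (fst x)) - snd (snd x)"
  have [measurable]: "A \<in> borel_measurable borel" "X1 \<in> borel_measurable borel"
    unfolding A_def X1_def by measurable
  have q: "0 \<le> 1 - kappa m L * \<gamma>" using kappa_step_le[OF \<gamma>] by simp
  have a: "a \<ge> 0" "a\<^sup>2 = (1 - kappa m L * \<gamma>) * c" using q c by (auto simp: a_def)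
  have A: "l2_bound \<zeta> A a"
  proof -
    have "(\<integral>\<^sup>+ p. ennreal ((norm (A p))\<^sup>2) \<partial>\<zeta>) \<le> (\<integral>\<^sup>+ p. ennreal (1 - kappa m L * \<gamma>) * ennreal ((dist (fst p) (snd p))\<^sup>2) \<partial>\<zeta>)"
      using q gradient_step_contraction[OF \<gamma>] 
      by (intro nn_integral_mono) (simp add: A_def dist_norm flip: ennreal_mult)
    also have "\<dots> = ennreal (1 - kappa m L * \<gamma>) * (\<integral>\<^sup>+ p. ennreal ((dist (fst p) (snd p))\<^sup>2) \<partial>\<zeta>)"
      by (rule nn_integral_cmult) measurable
    also have "\<dots> \<le> ennreal (1 - kappa m L * \<gamma>) * ennreal c" using cost by (rule mult_left_mono) simp
    also have "\<dots> = ennreal (a\<^sup>2)" using q c by (simp add: a ennreal_mult)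
    finally show ?thesis using a by (auto simp: l2_bound_def)
  qed
  have cost': "(\<integral>\<^sup>+ x. ennreal ((norm (A (fst x) + ?D x))\<^sup>2) \<partial>?M)
    \<le> ennreal (a\<^sup>2 + 2 * (a * (\<gamma>\<^sup>2 / 2 * (L * G + real DIM('a) * Lt + L * \<eta>) + \<gamma> * \<eta>))
        + (L * (\<gamma>\<^sup>2 / 2 * (G + \<eta>) + sqrt (2 * real DIM('a)) * (2 / 3 * (\<gamma> * sqrt \<gamma>))) + \<gamma> * \<eta>)\<^sup>2)"
    using l2_bound_add_inner[OF l2_bound_initial[OF ctx(1-4) A, of "Suc j"] l2_bound_discretization[OF ctx, of "Suc j", unfolded h(3)]
      discretization_inner[OF ctx A, of "Suc j", unfolded h(3)]] .
  have meas: "(\<lambda>x. (fst (snd x), X1 x)) \<in> borel_measurable ?M" by measurable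
  define \<zeta>' where "\<zeta>' = distr ?M borel (\<lambda>x. (fst (snd x), X1 x))"
  have [simp, measurable_cong]: "sets \<zeta>' = sets borel" by (simp add: \<zeta>'_def)
  have "prob_space \<zeta>'"
    unfolding \<zeta>'_def by (rule prob_space.prob_space_distr[OF prob_space_chain[OF ctx(1-4)] meas])
  moreover have "distr \<zeta>' borel fst = gibbs U"
  proof (rule measure_eqI)
    fix B assume "B \<in> sets (distr \<zeta>' borel fst)"
    then have [measurable]: "B \<in> sets borel" by simp
    have "emeasure (distr \<zeta>' borel fst) B = (\<integral>\<^sup>+ y. indicator B y \<partial>distr \<zeta>' borel fst)" by simp
    also have "\<dots> = (\<integral>\<^sup>+ z. indicator B (fst z) \<partial>\<zeta>')"
      by (rule nn_integral_distr) measurable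
    also have "\<dots> = (\<integral>\<^sup>+ x. indicator B (fst (snd x)) \<partial>?M)"
      unfolding \<zeta>'_def by (subst nn_integral_distr[OF meas]) (simp_all only: fst_conv snd_conv, measurable)
    also have "\<dots> = (\<integral>\<^sup>+ y. indicator B y \<partial>gibbs U)"
      by (rule chain_stationary[OF ctx(1-4)]) measurable
    finally show "emeasure (distr \<zeta>' borel fst) B = emeasure (gibbs U) B" by simp
  qed simp
  moreover have "distr \<zeta>' borel snd = \<mu>"
  proof (rule measure_eqI)
    fix B assume "B \<in> sets (distr \<zeta>' borel snd)"
    then have B[measurable]: "B \<in> sets borel" by simp
    have "emeasure (distr \<zeta>' borel snd) B = (\<integral>\<^sup>+ y. indicator B y \<partial>distr \<zeta>' borel snd)" by simp
    also have "\<dots> = (\<integral>\<^sup>+ z. indicator B (snd z) \<partial>\<zeta>')"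
      by (rule nn_integral_distr) measurable
    also have "\<dots> = (\<integral>\<^sup>+ x. indicator B (X1 x) \<partial>?M)"
      unfolding \<zeta>'_def by (subst nn_integral_distr[OF meas]) (simp_all only: fst_conv snd_conv, measurable)
    also have "\<dots> = (\<integral>\<^sup>+ p. \<integral>\<^sup>+ s. indicator B (snd p - \<gamma> *\<^sub>R g (snd p) + s) \<partial>isotropic_gaussian 0 (2 * \<gamma>) \<partial>\<zeta>)"
      using chain_law_increments[OF ctx(1-4), of "\<lambda>q. indicator B (snd (fst q) - \<gamma> *\<^sub>R g (snd (fst q)) + snd q)" j]
      unfolding h(4) X1_def by (simp del: chain.simps)
    also have "\<dots> = (\<integral>\<^sup>+ x. \<integral>\<^sup>+ s. indicator B (x - \<gamma> *\<^sub>R g x + s) \<partial>isotropic_gaussian 0 (2 * \<gamma>) \<partial>distr \<zeta> borel snd)"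
    proof -
      interpret N: prob_space "isotropic_gaussian (0::'a) (2 * \<gamma>)" by (rule prob_space_isotropic_gaussian) (use \<gamma> in simp)
      show ?thesis by (subst nn_integral_distr) auto
    qed
    also have "\<dots> = emeasure \<mu> B" unfolding \<zeta>D(4) by (rule stationary_emeasure[OF B])
    finally show "emeasure (distr \<zeta>' borel snd) B = emeasure \<mu> B" .
  qed simp
  ultimately have "\<zeta>' \<in> couplings (gibbs U) \<mu>" by (simp add: couplings_def \<zeta>'_def)
  \<comment> \<open>The terms \<gamma> g(y_0) in \<open>A\<close> and \<open>?D\<close> cancel,
    which leaves Y_N - X_1.\<close>
  moreover have "(\<integral>\<^sup>+ z. ennreal ((dist (fst z) (snd z))\<^sup>2) \<partial>\<zeta>') = (\<integral>\<^sup>+ x. ennreal ((norm (A (fst x) + ?D x))\<^sup>2) \<partial>?M)"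
    unfolding \<zeta>'_def using meas
    by (subst nn_integral_distr) (auto simp: dist_norm A_def X1_def algebra_simps intro!: nn_integral_cong)
  ultimately show thesis using that cost' by simp
qed

text \<open>\<open>B\<close> is the inner product bound per unit of \<open>a\<close> and
  \<open>C\<close> the L2 bound of the error, both at \<eta> = 0. Half of the contraction rate
  \<open>q\<close> pays for the cross term, and the other half solves the inequality for the
  infimum.\<close>

lemma wasserstein2_gibbs_stationary:
  defines "B \<equiv> \<gamma>\<^sup>2 / 2 * (L * G + real DIM('a) * Lt)"
    and "C \<equiv> L * (\<gamma>\<^sup>2 / 2 * G + sqrt (2 * real DIM('a)) * (2 / 3 * (\<gamma> * sqrt \<gamma>)))"
    and "q \<equiv> kappa m L * \<gamma>"
  shows "(wasserstein2 (gibbs U) \<mu>)\<^sup>2 \<le> ennreal (2 / q * (2 * B\<^sup>2 / q + C\<^sup>2))"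
proof -
  let ?cost = "\<lambda>\<zeta>. \<integral>\<^sup>+ z. ennreal ((dist (fst z) (snd z))\<^sup>2) \<partial>\<zeta>"
  define W where "W = (\<Sqinter>\<zeta>\<in>couplings (gibbs U) \<mu>. ?cost \<zeta>)"
  define K where "K = 2 * B\<^sup>2 / q + C\<^sup>2"
  have q: "0 < q" "q \<le> 1 / 2" using kappa_pos \<gamma>(1) kappa_step_le[OF \<gamma>] by (auto simp: q_def)
  have K: "0 \<le> K" using q by (simp add: K_def)
  \<comment> \<open>Stated for any upper bound c of the cost of any coupling, so that no minimising
    coupling is required.\<close>
  have key: "W \<le> ennreal ((1 - q / 2) * c + K)"
    if \<zeta>: "\<zeta> \<in> couplings (gibbs U) \<mu>" and cost: "?cost \<zeta> \<le> ennreal c" and c: "0 \<le> c" for \<zeta> c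
  proof -
    define a where "a = sqrt ((1 - q) * c)"
    define F where "F \<eta> = a\<^sup>2 + 2 * (a * (\<gamma>\<^sup>2 / 2 * (L * G + real DIM('a) * Lt + L * \<eta>) + \<gamma> * \<eta>))
        + (L * (\<gamma>\<^sup>2 / 2 * (G + \<eta>) + sqrt (2 * real DIM('a)) * (2 / 3 * (\<gamma> * sqrt \<gamma>))) + \<gamma> * \<eta>)\<^sup>2" for \<eta>
    have "W \<le> ennreal (F \<eta>)" if \<eta>: "\<eta> > 0" for \<eta>
    proof -
      obtain \<zeta>' where "\<zeta>' \<in> couplings (gibbs U) \<mu>" "?cost \<zeta>' \<le> ennreal (F \<eta>)"
        using improved_coupling[OF \<zeta> cost c \<eta>] unfolding F_def a_def q_def by blast
      then show ?thesis unfolding W_def by (rule INF_lower2)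
    qed
    \<comment> \<open>Only the bound is passed to the limit: W depends neither on \<eta> nor on the
      step h chosen for it, so no convergence of couplings is involved.\<close>
    then have "eventually (\<lambda>\<eta>. W \<le> ennreal (F \<eta>)) (at_right 0)"
      using eventually_at_right_less[of "0::real"] by (auto elim: eventually_mono)
    moreover have "((\<lambda>\<eta>. ennreal (F \<eta>)) \<longlongrightarrow> ennreal (F 0)) (at_right 0)"
      unfolding F_def by (intro tendsto_intros)
    ultimately have "W \<le> ennreal (F 0)"
      by (intro tendsto_lowerbound[of _ "ennreal (F 0)" "at_right (0::real)"]) auto
    also have "F 0 \<le> (1 - q / 2) * c + K"
    proof -
      have a2: "a\<^sup>2 = (1 - q) * c" using q c by (simp add: a_def)
      have "a\<^sup>2 \<le> c" unfolding a2 using q c by (simp add: mult_left_le_one_le)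
      \<comment> \<open>Young's inequality, weighted so that the cross term takes q / 2 out of the
        contraction q.\<close>
      have "0 \<le> (q * a - 2 * B)\<^sup>2 / (2 * q)" using q by simp
      also have "\<dots> = q / 2 * a\<^sup>2 + 2 * B\<^sup>2 / q - 2 * (a * B)"
        using q by (simp add: power2_eq_square field_simps)
      finally have "2 * (a * B) \<le> q / 2 * a\<^sup>2 + 2 * B\<^sup>2 / q" by simp
      also have "q / 2 * a\<^sup>2 \<le> q / 2 * c" using q \<open>a\<^sup>2 \<le> c\<close> by (intro mult_left_mono) auto
      finally have "2 * (a * B) \<le> q / 2 * c + 2 * B\<^sup>2 / q" by simp
      moreover have "F 0 = (1 - q) * c + 2 * (a * B) + C\<^sup>2"
        unfolding F_def a2[symmetric] B_def C_def by simp
      ultimately show ?thesis by (simp add: K_def algebra_simps)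
    qed
    finally show ?thesis by (simp add: ennreal_leI)
  qed
  obtain \<zeta>0 where "\<zeta>0 \<in> couplings (gibbs U) \<mu>" "?cost \<zeta>0 < \<infinity>" using finite_cost_coupling by blast
  then have "W < \<infinity>" unfolding W_def by (rule INF_lower[THEN le_less_trans])
  then obtain w where w: "W = ennreal w" "0 \<le> w" by (cases W) auto
  \<comment> \<open>A coupling of cost below w + \<delta> gives w <= (1 - q / 2) (w + \<delta>) + K;
    subtracting needs the finiteness of w.\<close>
  have "q / 2 * w \<le> K"
  proof (rule field_le_epsilon)
    fix \<delta> :: real assume \<delta>: "0 < \<delta>"
    have "W < ennreal (w + \<delta>)" using w \<delta> by (simp add: ennreal_lessI)
    then obtain \<zeta> where \<zeta>: "\<zeta> \<in> couplings (gibbs U) \<mu>" "?cost \<zeta> < ennreal (w + \<delta>)"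
      unfolding W_def by (auto simp: INF_less_iff)
    have "W \<le> ennreal ((1 - q / 2) * (w + \<delta>) + K)"
      using \<zeta> w \<delta> by (intro key) auto
    then have "w \<le> (1 - q / 2) * (w + \<delta>) + K"
      using w \<delta> q K by (subst (asm) w(1), subst (asm) ennreal_le_iff) auto
    moreover have "0 \<le> q / 2 * \<delta>" using q \<delta> by simp
    ultimately show "q / 2 * w \<le> K + \<delta>" by (simp add: algebra_simps)
  qed
  then have "w \<le> 2 / q * K" using q by (simp add: field_simps)
  then have "W \<le> ennreal (2 / q * K)" unfolding w(1) by (rule ennreal_leI)
  then show ?thesis by (simp add: wasserstein2_def W_def K_def)
qed

end

end

section \<open>The explicit bound\<close>

text \<open>\<open>grad\<close> is a definite description: the coordinates of the derivative supply
  a witness, and uniqueness of derivatives identifies it. The coordinate formula is the form in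
  which \<open>times_cont_differentiable\<close> allows a second differentiation.\<close>

lemma grad_has_derivative:
  fixes U :: "'a::euclidean_space \<Rightarrow> real"
  assumes "U differentiable (at x)"
  shows "(U has_derivative (\<lambda>v. grad U x \<bullet> v)) (at x)"
    and "grad U x = (\<Sum>b\<in>Basis. frechet_derivative U (at x) b *\<^sub>R b)"
proof -
  let ?D = "frechet_derivative U (at x)"
  let ?v = "\<Sum>b\<in>Basis. ?D b *\<^sub>R b"
  have D: "(U has_derivative ?D) (at x)" using assms frechet_derivative_works by blast
  have lin: "linear ?D" using D has_derivative_linear by blast
  have "?D h = h \<bullet> ?v" for h
  proof -
    have "?D h = ?D (\<Sum>b\<in>Basis. (h \<bullet> b) *\<^sub>R b)" by (simp add: euclidean_representation)
    also have "\<dots> = (\<Sum>b\<in>Basis. (h \<bullet> b) * ?D b)"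
      by (simp add: linear_sum[OF lin] linear_scale[OF lin])
    finally show ?thesis by (simp add: inner_sum_right mult.commute)
  qed
  then have "?D = (\<lambda>h. h \<bullet> ?v)" by (rule ext)
  then have G: "GDERIV U x :> ?v" unfolding gderiv_def by (rule has_derivative_subst[OF D])
  show eq: "grad U x = ?v" unfolding grad_def
  proof (rule the_equality[where P = "\<lambda>g. GDERIV U x :> g", OF G])
    fix w assume "GDERIV U x :> w"
    then have "(\<lambda>h. h \<bullet> w) = (\<lambda>h. h \<bullet> ?v)" using G unfolding gderiv_def by (rule has_derivative_unique)
    then have "\<forall>h. h \<bullet> w = h \<bullet> ?v" unfolding fun_eq_iff .
    then show "w = ?v" by (rule vector_eq_ldot[THEN iffD1])
  qed
  show "(U has_derivative (\<lambda>v. grad U x \<bullet> v)) (at x)"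
    using G unfolding eq gderiv_def by (simp add: inner_commute)
qed

lemma grad_differentiable:
  fixes U :: "'a::euclidean_space \<Rightarrow> real"
  assumes "times_cont_differentiable (Suc (Suc k)) U"
  shows "grad U differentiable (at x)"
proof -
  have "grad U = (\<lambda>x. \<Sum>b\<in>Basis. frechet_derivative U (at x) b *\<^sub>R b)"
    using assms by (auto intro: grad_has_derivative(2))
  moreover have "(\<lambda>x. \<Sum>b\<in>Basis. frechet_derivative U (at x) b *\<^sub>R b) differentiable (at x)"
    using assms by (intro differentiable_sum differentiable_scaleR differentiable_const) auto
  ultimately show ?thesis by simp
qed

lemma strongly_convex_potentialI:
  assumes C3: "times_cont_differentiable 3 U"
    and "m > 0" and "Lt \<ge> 0"
    and "\<And>x y. norm (grad U x - grad U y) \<le> L * norm (x - y)"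
    and "\<And>x y. U y \<ge> U x + grad U x \<bullet> (y - x) + m / 2 * (norm (x - y))\<^sup>2"
    and hess_Lipschitz: "\<And>x y. onorm (\<lambda>v. hess U x v - hess U y v) \<le> Lt * norm (x - y)"
  shows "strongly_convex_potential U (grad U) (hess U) L m Lt"
proof
  show "(U has_derivative (\<lambda>v. grad U x \<bullet> v)) (at x)" for x
    using C3 by (intro grad_has_derivative) (simp add: numeral_3_eq_3)
  show hd: "(grad U has_derivative hess U x) (at x)" for x
    using grad_differentiable[of "Suc 0" U x] C3 frechet_derivative_works
    by (auto simp: hess_def numeral_3_eq_3)
  fix x y v
  have "bounded_linear (\<lambda>v. hess U x v - hess U y v)"
    by (intro bounded_linear_sub has_derivative_bounded_linear[OF hd])
  then have "norm (hess U x v - hess U y v) \<le> onorm (\<lambda>v. hess U x v - hess U y v) * norm v"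
    by (rule onorm)
  also have "\<dots> \<le> Lt * norm (x - y) * norm v" by (intro mult_right_mono hess_Lipschitz) simp
  finally show "norm (hess U x v - hess U y v) \<le> Lt * norm (x - y) * norm v" .
qed (use assms in auto)

text \<open>The inequality (x + y)^2 <= 2 x^2 + 2 y^2 separates the parts of \<open>B\<close> and
  \<open>C\<close>, and L^3 <= L^4 / m, from m <= L, brings in the factor 1 / m. Each term is then
  dominated by one of the claimed bound, with room to spare: 16/9 against 2, 1 against 4/3, \<gamma>
  / 2 against \<gamma>.\<close>

lemma (in strongly_convex_potential) explicit_constant_le:
  assumes "0 < \<gamma>"
  defines "d \<equiv> real DIM('a)"
  defines "B \<equiv> \<gamma>\<^sup>2 / 2 * (L * G + d * Lt)"
    and "C \<equiv> L * (\<gamma>\<^sup>2 / 2 * G + sqrt (2 * d) * (2 / 3 * (\<gamma> * sqrt \<gamma>)))"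
    and "q \<equiv> kappa m L * \<gamma>"
  shows "2 / q * (2 * B\<^sup>2 / q + C\<^sup>2) \<le> 2 * inverse (kappa m L) * d * \<gamma>\<^sup>2 *
      (2 * L\<^sup>2 + \<gamma> * L ^ 4 * (\<gamma> / 6 + inverse m)
        + inverse (kappa m L) * (4 * d * Lt\<^sup>2 / 3 + \<gamma> * L ^ 4 + 4 * L ^ 4 / (3 * m)))"
proof -
  define i where "i = inverse (kappa m L)"
  have i: "0 < i" using kappa_pos by (simp add: i_def)
  have d: "0 \<le> d" by (simp add: d_def)
  have G2: "G\<^sup>2 = d * L" using L_pos by (simp add: G_def d_def)
  define M where "M = L ^ 4 / m"
  have "L ^ 3 * m \<le> L ^ 3 * L" using m_le_L L_pos by (intro mult_left_mono) auto
  then have M: "L ^ 3 \<le> M" using m_pos by (simp add: M_def field_simps eval_nat_numeral)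
  have two: "(x + y)\<^sup>2 \<le> 2 * x\<^sup>2 + 2 * y\<^sup>2" for x y :: real
    using sum_squares_bound[of x y] by (simp add: power2_sum)
  have "(L * G + d * Lt)\<^sup>2 \<le> 2 * (L * G)\<^sup>2 + 2 * (d * Lt)\<^sup>2" by (rule two)
  also have "\<dots> = 2 * d * (L ^ 3 + d * Lt\<^sup>2)"
    unfolding power_mult_distrib G2 by (simp add: eval_nat_numeral algebra_simps)
  also have "\<dots> \<le> 2 * d * (M + d * Lt\<^sup>2)" using M d by (intro mult_left_mono add_right_mono) auto
  finally have "\<gamma> ^ 4 / 4 * (L * G + d * Lt)\<^sup>2 \<le> \<gamma> ^ 4 / 4 * (2 * d * (M + d * Lt\<^sup>2))"
    by (intro mult_left_mono) auto
  moreover have "\<gamma> ^ 4 / 4 * (2 * d * (M + d * Lt\<^sup>2)) = \<gamma> ^ 4 / 2 * (d * (M + d * Lt\<^sup>2))"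
    by simp
  moreover have "B\<^sup>2 = \<gamma> ^ 4 / 4 * (L * G + d * Lt)\<^sup>2"
    by (simp add: B_def power_mult_distrib power_divide flip: power_mult)
  ultimately have B: "B\<^sup>2 \<le> \<gamma> ^ 4 / 2 * (d * (M + d * Lt\<^sup>2))" by (simp only:)
  have "(\<gamma>\<^sup>2 / 2 * G + sqrt (2 * d) * (2 / 3 * (\<gamma> * sqrt \<gamma>)))\<^sup>2
     \<le> 2 * (\<gamma>\<^sup>2 / 2 * G)\<^sup>2 + 2 * (sqrt (2 * d) * (2 / 3 * (\<gamma> * sqrt \<gamma>)))\<^sup>2" by (rule two)
  also have "\<dots> = \<gamma> ^ 4 / 2 * (d * L) + 16 / 9 * d * \<gamma> ^ 3"
    unfolding power_mult_distrib G2 using d assms(1) by (simp add: eval_nat_numeral field_simps)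
  finally have "L\<^sup>2 * (\<gamma>\<^sup>2 / 2 * G + sqrt (2 * d) * (2 / 3 * (\<gamma> * sqrt \<gamma>)))\<^sup>2 \<le> L\<^sup>2 * (\<gamma> ^ 4 / 2 * (d * L) + 16 / 9 * d * \<gamma> ^ 3)"
    by (intro mult_left_mono) auto
  then have "C\<^sup>2 \<le> \<gamma> ^ 3 * d * (\<gamma> / 2 * L ^ 3 + 16 / 9 * L\<^sup>2)"
    by (simp add: C_def power_mult_distrib eval_nat_numeral algebra_simps)
  also have "\<dots> \<le> \<gamma> ^ 3 * d * (\<gamma> / 2 * M + 16 / 9 * L\<^sup>2)"
    using M d assms(1) by (intro mult_left_mono add_right_mono) auto
  finally have C: "C\<^sup>2 \<le> \<gamma> ^ 3 * d * (\<gamma> / 2 * M + 16 / 9 * L\<^sup>2)" .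
  have "2 / q * (2 * B\<^sup>2 / q + C\<^sup>2) = 4 * i\<^sup>2 / \<gamma>\<^sup>2 * B\<^sup>2 + 2 * i / \<gamma> * C\<^sup>2"
    using assms(1) kappa_pos by (simp add: q_def i_def field_simps power2_eq_square)
  also have "\<dots> \<le> 4 * i\<^sup>2 / \<gamma>\<^sup>2 * (\<gamma> ^ 4 / 2 * (d * (M + d * Lt\<^sup>2))) + 2 * i / \<gamma> * (\<gamma> ^ 3 * d * (\<gamma> / 2 * M + 16 / 9 * L\<^sup>2))"
    using B C i assms(1) by (intro add_mono mult_left_mono) auto
  also have "\<dots> = 2 * i * d * \<gamma>\<^sup>2 * (i * (M + d * Lt\<^sup>2) + (\<gamma> / 2 * M + 16 / 9 * L\<^sup>2))"
  proof -
    have "4 * i\<^sup>2 / \<gamma>\<^sup>2 * (\<gamma> ^ 4 / 2 * X) = 2 * i * \<gamma>\<^sup>2 * (i * X)"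
      "2 * i / \<gamma> * (\<gamma> ^ 3 * d * Y) = 2 * i * d * \<gamma>\<^sup>2 * Y" for X Y
      using assms(1) by (simp_all add: eval_nat_numeral)
    then show ?thesis by (simp only:) (simp add: algebra_simps)
  qed
  also have "\<dots> \<le> 2 * i * d * \<gamma>\<^sup>2 * (i * (4 * d * Lt\<^sup>2 / 3 + \<gamma> * L ^ 4 + 4 * L ^ 4 / (3 * m)) + (\<gamma> * L ^ 4 * (\<gamma> / 6 + inverse m) + 2 * L\<^sup>2))"
  proof -
    have Mp: "0 \<le> M" using m_pos L_pos by (simp add: M_def)
    have "4 * L ^ 4 / (3 * m) = 4 / 3 * M" by (simp add: M_def)
    moreover have "0 \<le> d * Lt\<^sup>2" "0 \<le> \<gamma> * L ^ 4" using d assms(1) L_pos by auto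
    ultimately have 1: "M + d * Lt\<^sup>2 \<le> 4 * d * Lt\<^sup>2 / 3 + \<gamma> * L ^ 4 + 4 * L ^ 4 / (3 * m)" using Mp by simp
    have "\<gamma> * L ^ 4 * (\<gamma> / 6 + inverse m) = \<gamma>\<^sup>2 * L ^ 4 / 6 + \<gamma> * M"
      by (simp add: M_def field_simps power2_eq_square)
    moreover have "0 \<le> \<gamma> * M" "0 \<le> \<gamma>\<^sup>2 * L ^ 4 / 6" using Mp assms(1) by auto
    ultimately have 2: "\<gamma> / 2 * M \<le> \<gamma> * L ^ 4 * (\<gamma> / 6 + inverse m)" by linarith
    have "i * (M + d * Lt\<^sup>2) \<le> i * (4 * d * Lt\<^sup>2 / 3 + \<gamma> * L ^ 4 + 4 * L ^ 4 / (3 * m))"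
      using 1 i by (intro mult_left_mono) auto
    moreover have "16 / 9 * L\<^sup>2 \<le> 2 * L\<^sup>2" by simp
    ultimately show ?thesis using 2 i d by (intro mult_left_mono[OF _ mult_nonneg_nonneg] add_mono) auto
  qed
  finally show ?thesis unfolding i_def by (simp add: add.commute add.left_commute)
qed

theorem corollary9:
  fixes U :: "real ^ 'n \<Rightarrow> real"
    and L m Lt \<gamma> :: real
    and \<pi>\<^sub>\<gamma> :: "(real ^ 'n) measure"
  assumes C3: "times_cont_differentiable 3 U"
    and L_nonneg: "L \<ge> 0" and m_pos: "m > 0" and Lt_nonneg: "Lt \<ge> 0"
    and grad_Lipschitz: "\<And>x y. norm (grad U x - grad U y) \<le> L * norm (x - y)"
    and strongly_convex:
      "\<And>x y. U y \<ge> U x + grad U x \<bullet> (y - x) + m / 2 * (norm (x - y))\<^sup>2"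
    and hess_Lipschitz:
      "\<And>x y. onorm (\<lambda>v. hess U x v - hess U y v) \<le> Lt * norm (x - y)"
    and step: "0 < \<gamma>" "\<gamma> \<le> 1 / (m + L)"
    and stationary: "stationary_distribution (ula_kernel U \<gamma>) \<pi>\<^sub>\<gamma>"
  shows "(wasserstein2 (gibbs U) \<pi>\<^sub>\<gamma>)\<^sup>2 \<le> ennreal
    (2 * inverse (kappa m L) * real CARD('n) * \<gamma>\<^sup>2 *
      (2 * L\<^sup>2 + \<gamma> * L ^ 4 * (\<gamma> / 6 + inverse m)
        + inverse (kappa m L) *
            (4 * real CARD('n) * Lt\<^sup>2 / 3 + \<gamma> * L ^ 4 + 4 * L ^ 4 / (3 * m))))"
proof -
  interpret strongly_convex_potential U "grad U" "hess U" L m Lt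
    using C3 m_pos Lt_nonneg grad_Lipschitz strongly_convex hess_Lipschitz
    by (rule strongly_convex_potentialI)
  have "ula_kernel U \<gamma> = (\<lambda>x. isotropic_gaussian (x - \<gamma> *\<^sub>R grad U x) (2 * \<gamma>))"
    by (simp add: ula_kernel_def fun_eq_iff)
  with stationary have "stationary_distribution (\<lambda>x. isotropic_gaussian (x - \<gamma> *\<^sub>R grad U x) (2 * \<gamma>)) \<pi>\<^sub>\<gamma>"
    by simp
  from wasserstein2_gibbs_stationary[OF step this] show ?thesis
    using explicit_constant_le[OF step(1)] by (simp only: DIM_cart DIM_real mult_1_right) (meson ennreal_leI order_trans)
qed

end
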